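(* Let $I_1$ and $I_2$ be disjoint subsets of $\mathbb{N}$, let $\varphi_1$ and $\varphi_2$ be states of $\mathcal{A}(I_1)$ and $\mathcal{A}(I_2)$, where $\varphi_2$ is even and $\varphi_1$ is such that the GNS representations $\pi_{\varphi_1}$ and $\pi_{\varphi_1\Theta}$ of $\mathcal{A}(I_1)$ are disjoint. Let $\varphi$ be the product state extension of $\varphi_1$ and $\varphi_2$ to $\mathcal{A}(I_1\cup I_2)$. (1) $\varphi$ is pure if and only if $\varphi_1$ and the restriction $\varphi_{2+}$ of $\varphi_2$ to $\mathcal{A}(I_2)_+$ are both pure. (2) Assume that $\varphi$ is pure. Then $\varphi_2$ is not pure if and only if $$\varphi_2=\tfrac12\bigl(\widehat{\varphi}_2+\widehat{\varphi}_2\Theta\bigr)$$ for some pure state $\widehat{\varphi}_2$ of $\mathcal{A}(I_2)$ such that $\pi_{\widehat{\varphi}_2}$ and $\pi_{\widehat{\varphi}_2\Theta}$ are disjoint.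
   Context: $\mathbb{N}=\{1,2,\dots\}$. $\mathcal{A}$ is the CAR (Fermion) algebra: the unital $C^*$-algebra generated by elements $a_i, a_i^*$, $i\in\mathbb{N}$, satisfying $\{a_i^*,a_j\}=\delta_{i,j}\mathbf{1}$ and $\{a_i^*,a_j^*\}=\{a_i,a_j\}=0$ for all $i,j$, where $\{A,B\}=AB+BA$. For $I\subset\mathbb{N}$, $\mathcal{A}(I)$ is the (unital) $C^*$-subalgebra generated by $a_i,a_i^*$, $i\in I$. $\Theta$ is the unique automorphism of $\mathcal{A}$ with $\Theta(a_i)=-a_i$, $\Theta(a_i^* )=-a_i^*$ for all $i$; it preserves each $\mathcal{A}(I)$. Put $\mathcal{A}(I)_\pm=\{A\in\mathcal{A}(I): \Theta(A)=\pm A\}$ (so $\mathcal{A}(I)_+$ is the even subalgebra, not the positive cone). A state $\varphi$ of $\mathcal{A}(I)$ is called even if $\varphi(\Theta(A))=\varphi(A)$ for all $A\in\mathcal{A}(I)$. For a state $\varphi$, $\varphi\Theta$ denotes the state $A\mapsto\varphi(\Theta(A))$, and $\pi_\varphi$ denotes the GNS representation of $\varphi$. The product state extension of $\varphi_1$ and $\varphi_2$ is the state $\varphi$ of $\mathcal{A}(I_1\cup I_2)$ with $\varphi(A_1A_2)=\varphi_1(A_1)\varphi_2(A_2)$ for all $A_1\in\mathcal{A}(I_1)$, $A_2\in\mathcal{A}(I_2)$; it exists and is unique when at least one of $\varphi_1,\varphi_2$ is even. Two representations of a $C^*$-algebra are disjoint if they have no unitarily equivalent non-zero subrepresentations (equivalently,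 no non-zero intertwiner). *)

theory Defs
  imports "HOL-Analysis.Analysis"
begin

class cstar_algebra = real_normed_algebra_1 + banach +
  fixes scaleC :: "complex \<Rightarrow> 'a \<Rightarrow> 'a"  (infixr "*\<^sub>C" 75)
    and adj :: "'a \<Rightarrow> 'a"
  assumes scaleC_add_right: "c *\<^sub>C (x + y) = c *\<^sub>C x + c *\<^sub>C y"
    and scaleC_add_left: "(c + d) *\<^sub>C x = c *\<^sub>C x + d *\<^sub>C x"
    and scaleC_scaleC: "c *\<^sub>C d *\<^sub>C x = (c * d) *\<^sub>C x"
    and scaleC_of_real: "complex_of_real r *\<^sub>C x = r *\<^sub>R x"
    and scaleC_mult_left: "c *\<^sub>C x * y = c *\<^sub>C (x * y)"
    and scaleC_mult_right: "x * c *\<^sub>C y = c *\<^sub>C (x * y)"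
    and norm_scaleC: "norm (c *\<^sub>C x) = cmod c * norm x"
    and adj_adj: "adj (adj x) = x"
    and adj_add: "adj (x + y) = adj x + adj y"
    and adj_scaleC: "adj (c *\<^sub>C x) = cnj c *\<^sub>C adj x"
    and adj_mult: "adj (x * y) = adj y * adj x"
    and cstar_identity: "norm (adj x * x) = (norm x)\<^sup>2"

definition cstar_subalgebra :: "'a::cstar_algebra set \<Rightarrow> bool" where
  "cstar_subalgebra B \<longleftrightarrow>
     1 \<in> B \<and> (\<forall>x\<in>B. \<forall>y\<in>B. x + y \<in> B) \<and> (\<forall>c. \<forall>x\<in>B. c *\<^sub>C x \<in> B) \<and>
     (\<forall>x\<in>B. \<forall>y\<in>B. x * y \<in> B) \<and> (\<forall>x\<in>B. adj x \<in> B) \<and> closed B"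

definition cstar_generated :: "'a::cstar_algebra set \<Rightarrow> 'a set" where
  "cstar_generated S = \<Inter>{B. cstar_subalgebra B \<and> S \<subseteq> B}"

definition star_automorphism :: "('a::cstar_algebra \<Rightarrow> 'a) \<Rightarrow> bool" where
  "star_automorphism \<alpha> \<longleftrightarrow>
     bij \<alpha> \<and> (\<forall>x y. \<alpha> (x + y) = \<alpha> x + \<alpha> y) \<and> (\<forall>c x. \<alpha> (c *\<^sub>C x) = c *\<^sub>C \<alpha> x) \<and>
     (\<forall>x y. \<alpha> (x * y) = \<alpha> x * \<alpha> y) \<and> (\<forall>x. \<alpha> (adj x) = adj (\<alpha> x))"

text \<open>A functional on a unital \<open>C\<^sup>*\<close>-subalgebra \<open>B\<close> is represented by a function on the whole
  type of which only the values on \<open>B\<close> matter. Hence restricting a functional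
  to a smaller subalgebra leaves the function unchanged, and equality of functionals on \<open>B\<close>
  is equality at all points of \<open>B\<close>.\<close>

definition state_on :: "'a::cstar_algebra set \<Rightarrow> ('a \<Rightarrow> complex) \<Rightarrow> bool" where
  "state_on B \<phi> \<longleftrightarrow>
     (\<forall>x\<in>B. \<forall>y\<in>B. \<phi> (x + y) = \<phi> x + \<phi> y) \<and> (\<forall>c. \<forall>x\<in>B. \<phi> (c *\<^sub>C x) = c * \<phi> x) \<and>
     (\<forall>x\<in>B. \<phi> (adj x * x) \<in> \<real>\<^sub>\<ge>\<^sub>0) \<and> \<phi> 1 = 1"

definition pure_state_on :: "'a::cstar_algebra set \<Rightarrow> ('a \<Rightarrow> complex) \<Rightarrow> bool" where
  "pure_state_on B \<phi> \<longleftrightarrow> state_on B \<phi> \<and>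
     (\<forall>\<psi> \<omega> t. state_on B \<psi> \<and> state_on B \<omega> \<and> 0 < t \<and> t < 1 \<and>
        (\<forall>x\<in>B. \<phi> x = complex_of_real t * \<psi> x + complex_of_real (1 - t) * \<omega> x)
        \<longrightarrow> (\<forall>x\<in>B. \<psi> x = \<phi> x \<and> \<omega> x = \<phi> x))"

text \<open>The Hilbert space is given by an explicit carrier, because the GNS space depends on the
  state. The inner product is antilinear in its first argument.\<close>

record ('a, 'h) rep =
  vecs :: "'h set"
  vzero :: 'h
  vadd :: "'h \<Rightarrow> 'h \<Rightarrow> 'h"
  vscale :: "complex \<Rightarrow> 'h \<Rightarrow> 'h"
  vinner :: "'h \<Rightarrow> 'h \<Rightarrow> complex"
  act :: "'a \<Rightarrow> 'h \<Rightarrow> 'h"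

definition vdist :: "('a, 'h) rep \<Rightarrow> 'h \<Rightarrow> 'h \<Rightarrow> real" where
  "vdist R u v = (let w = vadd R u (vscale R (- 1) v) in sqrt (Re (vinner R w w)))"

definition closed_subspace :: "('a, 'h) rep \<Rightarrow> 'h set \<Rightarrow> bool" where
  "closed_subspace R K \<longleftrightarrow>
     K \<subseteq> vecs R \<and> vzero R \<in> K \<and> (\<forall>u\<in>K. \<forall>v\<in>K. vadd R u v \<in> K) \<and>
     (\<forall>c. \<forall>u\<in>K. vscale R c u \<in> K) \<and>
     (\<forall>s. \<forall>u\<in>vecs R. (\<forall>n. s n \<in> K) \<and> (\<lambda>n. vdist R (s n) u) \<longlonglongrightarrow> 0 \<longrightarrow> u \<in> K)"

definition nonzero_subrep :: "'a set \<Rightarrow> ('a, 'h) rep \<Rightarrow> ('a, 'h) rep \<Rightarrow> bool" where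
  "nonzero_subrep B R S \<longleftrightarrow>
     (\<exists>K. closed_subspace R K \<and> (\<forall>b\<in>B. \<forall>u\<in>K. act R b u \<in> K) \<and> K \<noteq> {vzero R} \<and>
          S = R\<lparr>vecs := K\<rparr>)"

definition unitarily_equivalent :: "'a set \<Rightarrow> ('a, 'h) rep \<Rightarrow> ('a, 'k) rep \<Rightarrow> bool" where
  "unitarily_equivalent B R S \<longleftrightarrow>
     (\<exists>U. bij_betw U (vecs R) (vecs S) \<and>
        (\<forall>u\<in>vecs R. \<forall>v\<in>vecs R. U (vadd R u v) = vadd S (U u) (U v)) \<and>
        (\<forall>c. \<forall>u\<in>vecs R. U (vscale R c u) = vscale S c (U u)) \<and>
        (\<forall>u\<in>vecs R. \<forall>v\<in>vecs R. vinner S (U u) (U v) = vinner R u v) \<and>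
        (\<forall>b\<in>B. \<forall>u\<in>vecs R. U (act R b u) = act S b (U u)))"

definition disjoint_reps :: "'a set \<Rightarrow> ('a, 'h) rep \<Rightarrow> ('a, 'k) rep \<Rightarrow> bool" where
  "disjoint_reps B R S \<longleftrightarrow>
     \<not> (\<exists>R' S'. nonzero_subrep B R R' \<and> nonzero_subrep B S S' \<and> unitarily_equivalent B R' S')"

text \<open>The GNS space is the completion of \<open>B\<close> modulo the null space of the semi-inner product
  \<open>\<phi> (adj x * y)\<close>. Quotient and completion are taken in one step, as the Cauchy sequences
  for the seminorm \<open>sqrt (\<phi> (adj x * x))\<close> modulo those that differ by a null sequence; the
  operations are lifted to classes as in \<open>Equiv_Relations\<close>.\<close>

definition gns_seminorm :: "('a::cstar_algebra \<Rightarrow> complex) \<Rightarrow> 'a \<Rightarrow> real" where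
  "gns_seminorm \<phi> x = sqrt (Re (\<phi> (adj x * x)))"

definition gns_cauchy :: "'a::cstar_algebra set \<Rightarrow> ('a \<Rightarrow> complex) \<Rightarrow> (nat \<Rightarrow> 'a) set" where
  "gns_cauchy B \<phi> = {X. (\<forall>n. X n \<in> B) \<and>
     (\<forall>e>0. \<exists>N. \<forall>m\<ge>N. \<forall>n\<ge>N. gns_seminorm \<phi> (X m - X n) < e)}"

definition gns_rel ::
    "'a::cstar_algebra set \<Rightarrow> ('a \<Rightarrow> complex) \<Rightarrow> ((nat \<Rightarrow> 'a) \<times> (nat \<Rightarrow> 'a)) set" where
  "gns_rel B \<phi> = {(X, Y). X \<in> gns_cauchy B \<phi> \<and> Y \<in> gns_cauchy B \<phi> \<and>
     (\<lambda>n. gns_seminorm \<phi> (X n - Y n)) \<longlonglongrightarrow> 0}"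

definition gns ::
    "'a::cstar_algebra set \<Rightarrow> ('a \<Rightarrow> complex) \<Rightarrow> ('a, (nat \<Rightarrow> 'a) set) rep" where
  "gns B \<phi> = \<lparr>
     vecs = gns_cauchy B \<phi> // gns_rel B \<phi>,
     vzero = gns_rel B \<phi> `` {\<lambda>n. 0},
     vadd = (\<lambda>u v. \<Union>X\<in>u. \<Union>Y\<in>v. gns_rel B \<phi> `` {\<lambda>n. X n + Y n}),
     vscale = (\<lambda>c u. \<Union>X\<in>u. gns_rel B \<phi> `` {\<lambda>n. c *\<^sub>C X n}),
     vinner = (\<lambda>u v. the_elem (\<Union>X\<in>u. \<Union>Y\<in>v. {lim (\<lambda>n. \<phi> (adj (X n) * Y n))})),
     act = (\<lambda>b u. \<Union>X\<in>u. gns_rel B \<phi> `` {\<lambda>n. b * X n})\<rparr>"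

text \<open>The type \<open>'a\<close> together with the generators \<open>a\<close> is the CAR algebra: these
  relations determine the generated \<open>C\<^sup>*\<close>-algebra up to isomorphism. The countable index set is
  \<open>nat\<close>, so the labels start at 0 rather than at 1.\<close>

definition anticommutator :: "'a::cstar_algebra \<Rightarrow> 'a \<Rightarrow> 'a" where
  "anticommutator x y = x * y + y * x"

definition car_generators :: "(nat \<Rightarrow> 'a::cstar_algebra) \<Rightarrow> bool" where
  "car_generators a \<longleftrightarrow>
     (\<forall>i j. anticommutator (adj (a i)) (a j) = (if i = j then 1 else 0)) \<and>
     (\<forall>i j. anticommutator (adj (a i)) (adj (a j)) = 0) \<and>
     (\<forall>i j. anticommutator (a i) (a j) = 0) \<and>
     cstar_generated (range a \<union> adj ` range a) = UNIV"

definition car_sub :: "(nat \<Rightarrow> 'a::cstar_algebra) \<Rightarrow> nat set \<Rightarrow> 'a set" where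
  "car_sub a I = cstar_generated (a ` I \<union> adj ` a ` I)"

definition parity_automorphism ::
    "(nat \<Rightarrow> 'a::cstar_algebra) \<Rightarrow> ('a \<Rightarrow> 'a) \<Rightarrow> bool" where
  "parity_automorphism a \<Theta> \<longleftrightarrow> star_automorphism \<Theta> \<and>
     (\<forall>i. \<Theta> (a i) = - a i \<and> \<Theta> (adj (a i)) = - adj (a i))"

definition car_even ::
    "(nat \<Rightarrow> 'a::cstar_algebra) \<Rightarrow> ('a \<Rightarrow> 'a) \<Rightarrow> nat set \<Rightarrow> 'a set" where
  "car_even a \<Theta> I = {x \<in> car_sub a I. \<Theta> x = x}"

definition even_on ::
    "'a::cstar_algebra set \<Rightarrow> ('a \<Rightarrow> 'a) \<Rightarrow> ('a \<Rightarrow> complex) \<Rightarrow> bool" where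
  "even_on B \<Theta> \<phi> \<longleftrightarrow> (\<forall>x\<in>B. \<phi> (\<Theta> x) = \<phi> x)"

definition product_state_extension ::
    "(nat \<Rightarrow> 'a::cstar_algebra) \<Rightarrow> nat set \<Rightarrow> nat set \<Rightarrow>
     ('a \<Rightarrow> complex) \<Rightarrow> ('a \<Rightarrow> complex) \<Rightarrow> ('a \<Rightarrow> complex) \<Rightarrow> bool" where
  "product_state_extension a I J \<phi>\<^sub>1 \<phi>\<^sub>2 \<phi> \<longleftrightarrow> state_on (car_sub a (I \<union> J)) \<phi> \<and>
     (\<forall>x\<in>car_sub a I. \<forall>y\<in>car_sub a J. \<phi> (x * y) = \<phi>\<^sub>1 x * \<phi>\<^sub>2 y)"

end

theory Submission
  imports Defs
begin

text \<open>
  No von Neumann algebra theory is needed: bounded intertwiners between GNS representations are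
  handled as functionals \<open>g\<close> on the algebra with
  \<open>\<bar>g (adj x * y)\<bar> \<le> C * gns_seminorm \<sigma> x * gns_seminorm \<tau> y\<close>. If \<open>\<sigma> = \<tau>\<close> is pure, such a \<open>g\<close> is a
  multiple of \<open>\<sigma>\<close>; if \<open>\<tau>\<close> is pure, there is a nonzero \<open>g\<close> exactly when the two GNS
  representations are not disjoint.

  If \<open>\<phi>\<close> is pure, a decomposition of \<open>\<phi>\<^sub>1\<close> or of \<open>\<phi>\<^sub>2\<^sub>+\<close> extends to one of \<open>\<phi>\<close>, because a functional that
  factorises with an even second factor is positive (Schur's product theorem). Conversely, a state
  \<open>\<psi>\<close> dominated by \<open>\<phi>\<close> agrees with \<open>\<phi>\<close> on products \<open>x * y\<close> with even \<open>y\<close>, by purity of the two factors;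
  for odd \<open>y\<close>, the functional \<open>x \<mapsto> \<psi> (adj y * x)\<close> is an intertwiner between the GNS representations of
  \<open>\<phi>\<^sub>1\<close> and \<open>\<phi>\<^sub>1 \<circ> \<Theta>\<close>, hence zero.

  If \<open>\<phi>\<^sub>2\<close> is not pure but \<open>\<phi>\<^sub>2\<^sub>+\<close> is, some component of \<open>\<phi>\<^sub>2\<close> differs from it by an odd functional
  \<open>\<langle>\<Omega>, S x \<Omega>\<rangle>\<close>, where \<open>S\<close> is odd, commutes with the algebra and can be scaled to \<open>S\<^sup>2 = 1\<close>. Its two
  eigenspaces carry \<open>\<pi>\<^sub>\<psi>\<close> and \<open>\<pi>\<^sub>\<psi>\<^sub>\<Theta>\<close>.
\<close>

section \<open>C*-algebras\<close>

text \<open>The form \<open>g (adj x * y)\<close> depends on the product \<open>adj x * y\<close>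
  alone, so the operator \<open>T\<close> with \<langle>x, T y\<rangle> =
  \<open>g (adj x * y)\<close> automatically commutes with left multiplication; boundedness is all
  that has to be carried along. Disjointness, however, speaks of unitary equivalence of closed
  subrepresentations, so a nonzero \<open>T\<close> has to become a partial isometry, ordinarily by
  polar decomposition. Purity of \<tau> replaces that: b \<mapsto> \<langle>T \<Omega>, b T
  \<Omega>\<rangle> is dominated by \<tau>, hence a multiple of it, so \<open>T\<close> is a scalar
  times an isometry. The same device makes \<open>S\<close> unitary after scaling: on the even part,
  b \<mapsto> \<langle>S \<Omega>, b S \<Omega>\<rangle> is a multiple of
  \<open>\<phi>\<^sub>2\<^sub>+\<close>. GNS vectors are classes of Cauchy sequences, so a vector
  that is only known through its inner products must be produced as a sequence of algebra elements;
  \<open>Riesz\<close> does this with approximate minimisers.\<close>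

lemma scaleC_zero_right [simp]: "c *\<^sub>C (0::'a::cstar_algebra) = 0"
  using scaleC_add_right[of c 0 0] by simp

lemma scaleC_zero_left [simp]: "0 *\<^sub>C (x::'a::cstar_algebra) = 0"
  using scaleC_add_left[of 0 0 x] by simp

lemma scaleC_one [simp]: "1 *\<^sub>C (x::'a::cstar_algebra) = x"
  using scaleC_of_real[of 1 x] by simp

lemma scaleC_minus_right [simp]: "c *\<^sub>C (- (x::'a::cstar_algebra)) = - (c *\<^sub>C x)"
  using scaleC_add_right[of c x "- x"] by (simp add: minus_unique)

lemma scaleC_minus_left [simp]: "(- c) *\<^sub>C (x::'a::cstar_algebra) = - (c *\<^sub>C x)"
  using scaleC_add_left[of c "- c" x] by (simp add: minus_unique)

lemma scaleC_diff_right: "c *\<^sub>C ((x::'a::cstar_algebra) - y) = c *\<^sub>C x - c *\<^sub>C y"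
  using scaleC_add_right[of c x "- y"] by simp

lemma scaleR_eq_scaleC: "r *\<^sub>R (x::'a::cstar_algebra) = complex_of_real r *\<^sub>C x"
  by (simp add: scaleC_of_real)

lemma scaleC_scaleR: "c *\<^sub>C r *\<^sub>R (x::'a::cstar_algebra) = r *\<^sub>R c *\<^sub>C x"
  by (simp add: scaleR_eq_scaleC scaleC_scaleC mult.commute)

lemma adj_zero [simp]: "adj (0::'a::cstar_algebra) = 0"
  using adj_add[of "0::'a" 0] by simp

lemma adj_minus [simp]: "adj (- (x::'a::cstar_algebra)) = - adj x"
  using adj_scaleC[of "-1" x] by simp

lemma adj_diff: "adj ((x::'a::cstar_algebra) - y) = adj x - adj y"
  using adj_add[of x "- y"] by simp

lemma adj_one [simp]: "adj (1::'a::cstar_algebra) = 1"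
  by (metis adj_adj adj_mult mult.right_neutral mult.left_neutral)

lemma adj_scaleR [simp]: "adj (r *\<^sub>R (x::'a::cstar_algebra)) = r *\<^sub>R adj x"
  by (simp add: scaleR_eq_scaleC adj_scaleC)

lemma norm_adj [simp]: "norm (adj (x::'a::cstar_algebra)) = norm x"
proof -
  have le: "norm y \<le> norm (adj y)" for y :: 'a
  proof (cases "y = 0")
    case False
    have "norm y * norm y \<le> norm (adj y) * norm y"
      using norm_mult_ineq[of "adj y" y] by (simp add: cstar_identity power2_eq_square)
    then show ?thesis using False by simp
  qed simp
  show ?thesis using le[of x] le[of "adj x"] by (simp add: adj_adj)
qed

lemma bounded_linear_adj: "bounded_linear (adj :: 'a::cstar_algebra \<Rightarrow> 'a)"
  by (rule bounded_linear_intro[where K = 1]) (auto simp: adj_add)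

lemma bounded_linear_scaleC: "bounded_linear (\<lambda>x::'a::cstar_algebra. c *\<^sub>C x)"
  by (rule bounded_linear_intro[where K = "cmod c"])
    (auto simp: scaleC_add_right scaleC_scaleR norm_scaleC mult.commute)

lemmas tendsto_adj = bounded_linear.tendsto[OF bounded_linear_adj]
lemmas tendsto_scaleC = bounded_linear.tendsto[OF bounded_linear_scaleC]

lemma adj_sum: "adj (sum f A) = (\<Sum>i\<in>A. adj (f i :: 'a::cstar_algebra))"
  by (induction A rule: infinite_finite_induct) (auto simp: adj_add)

locale cstar_sub =
  fixes B :: "'a::cstar_algebra set"
  assumes subalgebra: "cstar_subalgebra B"
begin

lemma one_mem [simp, intro]: "1 \<in> B"
  and add_mem [simp, intro]: "x \<in> B \<Longrightarrow> y \<in> B \<Longrightarrow> x + y \<in> B"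
  and scaleC_mem [simp, intro]: "x \<in> B \<Longrightarrow> c *\<^sub>C x \<in> B"
  and mult_mem [simp, intro]: "x \<in> B \<Longrightarrow> y \<in> B \<Longrightarrow> x * y \<in> B"
  and adj_mem [simp, intro]: "x \<in> B \<Longrightarrow> adj x \<in> B"
  and closed: "closed B"
  using subalgebra by (auto simp: cstar_subalgebra_def)

lemma zero_mem [simp, intro]: "0 \<in> B"
  using scaleC_mem[OF one_mem, of 0] by simp

lemma minus_mem [simp, intro]: "x \<in> B \<Longrightarrow> - x \<in> B"
  using scaleC_mem[of x "- 1"] by simp

lemma diff_mem [simp, intro]: "x \<in> B \<Longrightarrow> y \<in> B \<Longrightarrow> x - y \<in> B"
  using add_mem[of x "- y"] by simp

lemma scaleR_mem [simp, intro]: "x \<in> B \<Longrightarrow> r *\<^sub>R x \<in> B"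
  by (simp add: scaleR_eq_scaleC)

lemma power_mem [simp, intro]: "x \<in> B \<Longrightarrow> x ^ n \<in> B"
  by (induction n) auto

lemma sum_mem [intro]: "(\<And>i. i \<in> A \<Longrightarrow> f i \<in> B) \<Longrightarrow> sum f A \<in> B"
  by (induction A rule: infinite_finite_induct) auto

lemma limit_mem: "(\<And>n. f n \<in> B) \<Longrightarrow> f \<longlonglongrightarrow> x \<Longrightarrow> x \<in> B"
  using closed closed_sequentially by blast

end

section \<open>Square roots by the binomial series, and continuity of automorphisms\<close>

lemma abs_gbinomial_half_le_1: "\<bar>(1 / 2 :: real) gchoose n\<bar> \<le> 1"
proof (induction n)
  case (Suc n)
  have "real (Suc n) * ((1/2 :: real) gchoose Suc n) = (1/2 - real n) * ((1/2) gchoose n)"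
    by (simp only: gbinomial_absorb_comp gbinomial_absorption)
  then have "(1/2 :: real) gchoose Suc n = ((1/2) gchoose n) * ((1/2 - real n) / (real n + 1))"
    by (simp add: field_simps)
  moreover have "\<bar>(1/2 - real n) / (real n + 1)\<bar> \<le> 1"
    by (simp add: abs_le_iff field_simps)
  ultimately show ?case using Suc by (simp only: abs_mult mult_le_one abs_ge_zero)
qed simp

text \<open>Takes the place of continuous functional calculus. The root is the binomial series of
  exponent 1/2 in \<open>- h\<close>; its coefficients are at most 1 in modulus, so
  \<open>norm h < 1\<close> gives absolute convergence. Real coefficients make the sum self-adjoint,
  and as a limit of polynomials in \<open>h\<close> it commutes with whatever commutes with
  \<open>h\<close>.\<close>

lemma (in cstar_sub) sqrt_one_minus:
  assumes "h \<in> B" "adj h = h" "norm h < 1"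
  obtains y where "y \<in> B" "adj y = y" "y * y = 1 - h" "\<And>z. z * h = h * z \<Longrightarrow> y * z = z * y"
proof
  define f where "f n = ((1/2 :: real) gchoose n) *\<^sub>R (- h) ^ n" for n
  define y where "y = suminf f"
  have "norm (f n) \<le> norm h ^ n" for n
  proof -
    have "norm (f n) \<le> 1 * norm ((- h) ^ n)"
      unfolding f_def norm_scaleR real_norm_def
      by (rule mult_right_mono[OF abs_gbinomial_half_le_1]) simp
    also have "\<dots> \<le> norm h ^ n" using norm_power_ineq[of "- h" n] by simp
    finally show ?thesis .
  qed
  then have sn: "summable (\<lambda>n. norm (f n))"
    using assms(3) by (intro summable_comparison_test'[OF summable_geometric[of "norm h"]]) auto
  have s: "summable f" using sn summable_norm_cancel by blast
  have lim: "(\<lambda>n. \<Sum>i<n. f i) \<longlonglongrightarrow> y"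
    using summable_LIMSEQ[OF s] unfolding y_def .
  have fB: "f n \<in> B" for n using assms(1) unfolding f_def by auto
  show "y \<in> B" using limit_mem[OF _ lim] fB by blast
  have adjp: "adj ((- h) ^ n) = (- h) ^ n" for n
    using assms(2) power_commutes[of "- h"] by (induction n) (auto simp: adj_mult)
  have adjf: "adj (f n) = f n" for n unfolding f_def by (simp only: adj_scaleR adjp)
  have "(\<lambda>n. \<Sum>i<n. f i) \<longlonglongrightarrow> adj y"
    using tendsto_adj[OF lim] by (simp only: adj_sum adjf)
  then show "adj y = y" using lim LIMSEQ_unique by blast
  \<comment> \<open>Vandermonde's identity adds the exponents 1/2 + 1/2, so the Cauchy square is the
    binomial series of exponent 1, which stops after two terms.\<close>
  have "(\<Sum>i\<le>k. f i * f (k - i)) = (if k = 0 then 1 else if k = 1 then - h else 0)" for k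
  proof -
    have "(\<Sum>i\<le>k. f i * f (k - i)) =
      (\<Sum>i\<le>k. (((1/2) gchoose i) * ((1/2) gchoose (k - i))) *\<^sub>R (- h) ^ k)"
      unfolding f_def by (intro sum.cong refl) (simp flip: power_add)
    also have "\<dots> = ((1 :: real) gchoose k) *\<^sub>R (- h) ^ k"
      using gbinomial_Vandermonde[of "1/2 :: real" "1/2" k]
      by (simp add: scaleR_sum_left[symmetric] atMost_atLeast0)
    also have "(1 :: real) gchoose k = of_nat (1 choose k)"
      using binomial_gbinomial[of 1 k, where 'a = real] by simp
    also have "1 choose k = (if k = 0 \<or> k = 1 then 1 else 0)"
      by (cases k) auto
    finally show ?thesis by auto
  qed
  then have "(\<lambda>k. if k = 0 then 1 else if k = 1 then - h else 0) sums (y * y)"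
    using Cauchy_product_sums[OF sn sn] unfolding y_def by simp
  moreover have "(\<lambda>k. if k = 0 then 1 else if k = 1 then - h else 0) sums
      (\<Sum>k\<in>{0,1::nat}. if k = 0 then 1 else if k = 1 then - h else 0)"
    by (rule sums_finite) auto
  ultimately show "y * y = 1 - h" using sums_unique2 by fastforce
  show "y * z = z * y" if z: "z * h = h * z" for z
  proof -
    have "(- h) ^ n * z = z * (- h) ^ n" for n
    proof (induction n)
      case (Suc n)
      have "(- h) ^ Suc n * z = - h * ((- h) ^ n * z)" by (simp add: mult.assoc)
      also have "\<dots> = (- h * z) * (- h) ^ n" by (simp only: Suc mult.assoc)
      also have "- h * z = z * - h" using z by simp
      finally show ?case by (simp add: mult.assoc)
    qed simp
    then have comm: "f n * z = z * f n" for n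
      unfolding f_def by simp
    have "(\<lambda>n. z * (\<Sum>i<n. f i)) \<longlonglongrightarrow> y * z"
      using tendsto_mult_right[OF lim, of z] by (simp only: sum_distrib_left sum_distrib_right comm)
    then show ?thesis using LIMSEQ_unique tendsto_mult_left[OF lim, of z] by blast
  qed
qed

lemma star_automorphism_one:
  assumes "star_automorphism \<alpha>" shows "\<alpha> 1 = 1"
proof -
  obtain u where u: "\<alpha> u = 1" using assms by (metis star_automorphism_def bij_pointE)
  have "\<alpha> 1 = \<alpha> 1 * \<alpha> u" using u by simp
  also have "\<dots> = \<alpha> (1 * u)" using assms unfolding star_automorphism_def by metis
  also have "\<dots> = 1" using u by simp
  finally show ?thesis .
qed

text \<open>If \<open>h\<close> is self-adjoint with \<open>norm h < 1\<close> and \<open>y\<^sup>2 = 1 - h\<^sup>2\<close>, then \<open>\<alpha> h + \<i> \<alpha> y\<close> is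
  an isometry with real part \<open>\<alpha> h\<close>, so no spectral theory is needed.\<close>

lemma star_automorphism_norm_le:
  assumes \<alpha>: "star_automorphism (\<alpha> :: 'a::cstar_algebra \<Rightarrow> 'a)" shows "norm (\<alpha> x) \<le> norm x"
proof -
  have add: "\<alpha> (x + y) = \<alpha> x + \<alpha> y" and sc: "\<alpha> (c *\<^sub>C x) = c *\<^sub>C \<alpha> x"
    and mult: "\<alpha> (x * y) = \<alpha> x * \<alpha> y" and adj: "\<alpha> (adj x) = adj (\<alpha> x)" for x y c
    using \<alpha> by (auto simp: star_automorphism_def)
  note one = star_automorphism_one[OF \<alpha>]
  have min: "\<alpha> (- x) = - \<alpha> x" for x using sc[of "-1" x] by simp
  interpret cstar_sub "UNIV :: 'a set" by unfold_locales (simp add: cstar_subalgebra_def)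
  have sa: "norm (\<alpha> h) \<le> 1" if h: "adj h = h" "norm h < 1" for h
  proof -
    have "norm (h * h) < 1" using cstar_identity[of h] h by (simp add: power_less_one_iff)
    moreover have "adj (h * h) = h * h" using h by (simp add: adj_mult)
    ultimately obtain y where y: "adj y = y" "y * y = 1 - h * h" "y * h = h * y"
      using sqrt_one_minus[of "h * h"] mult.assoc[of h h h] UNIV_I by metis
    define k where "k = \<alpha> h"
    define w where "w = \<alpha> y"
    have ad: "adj k = k" "adj w = w" using h y by (simp_all add: k_def w_def flip: adj)
    have kw: "w * w = 1 - k * k"
      unfolding k_def w_def using y(2) add[of 1 "- (h * h)"] by (simp add: min one flip: mult)
    have com: "w * k = k * w" unfolding k_def w_def using y(3) by (simp flip: mult)
    define u where "u = k + \<i> *\<^sub>C w"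
    have "adj u * u = 1"
      unfolding u_def by (simp add: adj_add adj_scaleC ad algebra_simps scaleC_mult_left
        scaleC_mult_right scaleC_scaleC scaleC_diff_right scaleC_add_right kw com)
    then have "(norm u)\<^sup>2 = 1" using cstar_identity[of u] by simp
    then have "norm u = 1" using norm_ge_zero[of u] by (auto simp: power2_eq_1_iff)
    have "2 *\<^sub>R k = u + adj u"
      unfolding u_def by (simp add: adj_add adj_scaleC ad scaleR_2)
    then have "2 * norm k \<le> norm u + norm (adj u)"
      by (metis norm_scaleR norm_triangle_ineq abs_numeral)
    then show ?thesis using \<open>norm u = 1\<close> by (simp add: k_def)
  qed
  have scR: "\<alpha> (r *\<^sub>R x) = r *\<^sub>R \<alpha> x" for r x by (simp add: scaleR_eq_scaleC sc)
  have sa': "norm (\<alpha> h) \<le> norm h" if h: "adj h = h" for h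
  proof (rule field_le_epsilon)
    fix e :: real assume e: "e > 0"
    \<comment> \<open>\<open>sa\<close> needs a norm strictly below 1, so \<open>h\<close> is
      divided by a number slightly above its norm.\<close>
    define r where "r = norm h + e"
    have r: "r > 0" using e by (simp add: r_def add_nonneg_pos)
    have "norm (\<alpha> ((1 / r) *\<^sub>R h)) \<le> 1"
      using sa[of "(1 / r) *\<^sub>R h"] h e r by (simp add: r_def)
    then show "norm (\<alpha> h) \<le> norm h + e" using r by (simp add: scR field_simps) (simp add: r_def add.commute)
  qed
  have "(norm (\<alpha> x))\<^sup>2 = norm (\<alpha> (adj x * x))" by (simp add: mult adj cstar_identity)
  also have "\<dots> \<le> norm (adj x * x)" by (rule sa') (simp add: adj_mult adj_adj)
  also have "\<dots> = (norm x)\<^sup>2" by (rule cstar_identity)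
  finally show ?thesis by (simp add: power2_le_iff_abs_le)
qed

text \<open>\<open>star_automorphism\<close> is purely algebraic. Continuity makes sets such as
  \<open>{x. \<Theta> x = x}\<close> closed, so that identities involving \<Theta> can be checked on
  generators.\<close>

lemma bounded_linear_star_automorphism:
  assumes \<alpha>: "star_automorphism (\<alpha> :: 'a::cstar_algebra \<Rightarrow> 'a)" shows "bounded_linear \<alpha>"
  using star_automorphism_norm_le[OF \<alpha>] \<alpha>
  by (intro bounded_linear_intro[where K = 1]) (auto simp: star_automorphism_def scaleR_eq_scaleC)

section \<open>States on a C*-subalgebra\<close>

text \<open>The best \<open>z\<close> is a real multiple of \<open>cnj d\<close>. The constant
  \<open>a\<close> need not be the square of a seminorm: \<open>Cauchy_Schwarz\<close> takes such a
  square, \<open>Riesz\<close> takes a small tolerance.\<close>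

lemma quadratic_nonneg_discriminant:
  assumes "\<And>z. 0 \<le> a + 2 * Re (z * d) + (cmod z)\<^sup>2 * b" "0 \<le> b"
  shows "(cmod d)\<^sup>2 \<le> a * b"
proof -
  have e: "Re (complex_of_real s * cnj d * d) = s * (cmod d)\<^sup>2" for s
    by (simp add: cmod_power2 distrib_left) (simp add: power2_eq_square)
  show ?thesis
  proof (cases "b = 0")
    case True
    show ?thesis
    proof (rule ccontr)
      assume n: "\<not> ?thesis"
      then have d: "(cmod d)\<^sup>2 > 0" using True by simp
      \<comment> \<open>With \<open>b = 0\<close> the expression is affine in \<open>s\<close>, and
        this \<open>s\<close> gives it the negative value
        \<open>a - 2 * (\<bar>a\<bar> + 1)\<close>.\<close>
      define s where "s = - (\<bar>a\<bar> + 1) / (cmod d)\<^sup>2"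
      have "0 \<le> a + 2 * (s * (cmod d)\<^sup>2)"
        using assms(1)[of "complex_of_real s * cnj d"] True by (simp only: e)
      also have "s * (cmod d)\<^sup>2 = - (\<bar>a\<bar> + 1)" using d by (simp add: s_def)
      finally show False by simp
    qed
  next
    case False
    then have b: "b > 0" using assms(2) by simp
    have m: "(cmod (complex_of_real (- 1 / b) * cnj d))\<^sup>2 * b = (cmod d)\<^sup>2 / b"
      using b by (simp add: norm_mult norm_divide power_mult_distrib power_divide power2_eq_square)
    show ?thesis
      using assms(1)[of "complex_of_real (- 1 / b) * cnj d"] b unfolding e m by (simp add: field_simps)
  qed
qed

definition functional_on :: "'a::cstar_algebra set \<Rightarrow> ('a \<Rightarrow> complex) \<Rightarrow> bool" where
  "functional_on B g \<longleftrightarrow>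
     (\<forall>x\<in>B. \<forall>y\<in>B. g (x + y) = g x + g y) \<and> (\<forall>c. \<forall>x\<in>B. g (c *\<^sub>C x) = c * g x)"

locale cstar_functional = cstar_sub B for B :: "'a::cstar_algebra set" +
  fixes g :: "'a \<Rightarrow> complex"
  assumes functional: "functional_on B g"
begin

lemma map_add: "x \<in> B \<Longrightarrow> y \<in> B \<Longrightarrow> g (x + y) = g x + g y"
  and map_scaleC: "x \<in> B \<Longrightarrow> g (c *\<^sub>C x) = c * g x"
  using functional by (auto simp: functional_on_def)

lemma map_zero [simp]: "g 0 = 0"
  using map_scaleC[OF zero_mem, of 0] by simp

lemma map_minus: "x \<in> B \<Longrightarrow> g (- x) = - g x"
  using map_scaleC[of x "-1"] by simp

lemma map_diff: "x \<in> B \<Longrightarrow> y \<in> B \<Longrightarrow> g (x - y) = g x - g y"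
  using map_add[of x "- y"] by (simp add: map_minus)

lemma map_scaleR: "x \<in> B \<Longrightarrow> g (r *\<^sub>R x) = complex_of_real r * g x"
  by (simp add: scaleR_eq_scaleC map_scaleC)

lemma map_sum: "(\<And>i. i \<in> A \<Longrightarrow> f i \<in> B) \<Longrightarrow> g (sum f A) = (\<Sum>i\<in>A. g (f i))"
  by (induction A rule: infinite_finite_induct) (auto simp: map_add sum_mem)

lemmas map_linear = map_add map_scaleC map_minus map_diff map_scaleR

end

lemma functional_on_limit:
  assumes "cstar_subalgebra B" and f: "\<And>k. functional_on B (f k)"
    and lim: "\<And>x. x \<in> B \<Longrightarrow> (\<lambda>k. f k x) \<longlonglongrightarrow> g x"
  shows "functional_on B g"
proof -
  interpret cstar_sub B using assms(1) by unfold_locales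
  have "g (x + y) = g x + g y" if x: "x \<in> B" and y: "y \<in> B" for x y
  proof (rule LIMSEQ_unique[OF lim])
    show "(\<lambda>k. f k (x + y)) \<longlonglongrightarrow> g x + g y"
      using tendsto_add[OF lim[OF x] lim[OF y]] f x y by (simp add: functional_on_def)
  qed (use x y in auto)
  moreover have "g (c *\<^sub>C x) = c * g x" if x: "x \<in> B" for c x
  proof (rule LIMSEQ_unique[OF lim])
    show "(\<lambda>k. f k (c *\<^sub>C x)) \<longlonglongrightarrow> c * g x"
      using tendsto_mult_left[OF lim[OF x]] f x by (simp add: functional_on_def)
  qed (use x in auto)
  ultimately show ?thesis by (simp add: functional_on_def)
qed

locale cstar_state = cstar_sub B for B :: "'a::cstar_algebra set" +
  fixes \<phi> :: "'a \<Rightarrow> complex"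
  assumes state: "state_on B \<phi>"

sublocale cstar_state \<subseteq> cstar_functional B \<phi>
  using state by unfold_locales (auto simp: state_on_def functional_on_def)

context cstar_state
begin

abbreviation p :: "'a \<Rightarrow> real" where "p \<equiv> gns_seminorm \<phi>"

lemma map_one [simp]: "\<phi> 1 = 1"
  using state by (simp add: state_on_def)

lemma positive: "x \<in> B \<Longrightarrow> \<phi> (adj x * x) \<in> \<real>\<^sub>\<ge>\<^sub>0"
  using state by (simp add: state_on_def)

lemma Re_positive: "x \<in> B \<Longrightarrow> 0 \<le> Re (\<phi> (adj x * x))"
  and Im_positive: "x \<in> B \<Longrightarrow> Im (\<phi> (adj x * x)) = 0"
  using positive by (auto simp: complex_nonneg_Reals_iff)

lemma seminorm_sq: "x \<in> B \<Longrightarrow> (p x)\<^sup>2 = Re (\<phi> (adj x * x))"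
  by (simp add: gns_seminorm_def Re_positive)

lemma map_adj_mult_self: "x \<in> B \<Longrightarrow> \<phi> (adj x * x) = complex_of_real ((p x)\<^sup>2)"
  by (simp add: seminorm_sq complex_eq_iff Im_positive)

lemma seminorm_nonneg [simp]: "x \<in> B \<Longrightarrow> 0 \<le> p x"
  by (simp add: gns_seminorm_def Re_positive)

text \<open>\<open>state_on\<close> demands positivity; hermiticity is read off from the vanishing
  imaginary parts at \<open>x + 1\<close> and \<open>x + \<i> *\<^sub>C 1\<close>.\<close>

lemma map_adj:
  assumes x: "x \<in> B" shows "\<phi> (adj x) = cnj (\<phi> x)"
proof (rule complex_eqI)
  have "Im (\<phi> (adj (x + 1) * (x + 1))) = 0" using x by (intro Im_positive) auto
  also have "\<phi> (adj (x + 1) * (x + 1)) = \<phi> (adj x * x) + \<phi> (adj x) + \<phi> x + 1"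
    using x by (simp add: adj_add distrib_left distrib_right map_linear)
  finally show "Im (\<phi> (adj x)) = Im (cnj (\<phi> x))" using x by (simp add: Im_positive)
  have "Im (\<phi> (adj (x + \<i> *\<^sub>C 1) * (x + \<i> *\<^sub>C 1))) = 0" using x by (intro Im_positive) auto
  also have "\<phi> (adj (x + \<i> *\<^sub>C 1) * (x + \<i> *\<^sub>C 1)) = \<phi> (adj x * x) + \<i> * \<phi> (adj x) - \<i> * \<phi> x + 1"
    using x by (simp add: adj_add adj_scaleC ring_distribs map_linear
        scaleC_mult_left scaleC_mult_right scaleC_scaleC)
  finally show "Re (\<phi> (adj x)) = Re (cnj (\<phi> x))" using x by (simp add: Im_positive)
qed

lemma map_adj_mult_swap: "x \<in> B \<Longrightarrow> y \<in> B \<Longrightarrow> \<phi> (adj y * x) = cnj (\<phi> (adj x * y))"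
  using map_adj[of "adj x * y"] by (simp add: adj_mult adj_adj)

lemma expand_square:
  assumes "x \<in> B" "y \<in> B"
  shows "(p (x + z *\<^sub>C y))\<^sup>2 = (p x)\<^sup>2 + 2 * Re (z * \<phi> (adj x * y)) + (cmod z)\<^sup>2 * (p y)\<^sup>2"
proof -
  have "\<phi> (adj (x + z *\<^sub>C y) * (x + z *\<^sub>C y)) =
      \<phi> (adj x * x) + z * \<phi> (adj x * y) + cnj (z * \<phi> (adj x * y)) + (z * cnj z) * \<phi> (adj y * y)"
    using assms by (simp add: adj_add adj_scaleC ring_distribs map_linear
        scaleC_mult_left scaleC_mult_right scaleC_scaleC map_adj_mult_swap[of x y])
  also have "z * cnj z = complex_of_real ((cmod z)\<^sup>2)" using complex_norm_square[of z] by simp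
  finally show ?thesis using assms by (simp add: seminorm_sq)
qed

lemma Cauchy_Schwarz:
  assumes "x \<in> B" "y \<in> B" shows "cmod (\<phi> (adj x * y)) \<le> p x * p y"
proof -
  have "0 \<le> (p x)\<^sup>2 + 2 * Re (z * \<phi> (adj x * y)) + (cmod z)\<^sup>2 * (p y)\<^sup>2" for z
    unfolding expand_square[OF assms, symmetric] by simp
  then have "(cmod (\<phi> (adj x * y)))\<^sup>2 \<le> (p x)\<^sup>2 * (p y)\<^sup>2"
    by (rule quadratic_nonneg_discriminant) simp
  then show ?thesis using assms by (simp add: power2_le_iff_abs_le flip: power_mult_distrib)
qed

lemma seminorm_triangle:
  assumes "x \<in> B" "y \<in> B" shows "p (x + y) \<le> p x + p y"
proof -
  have "(p (x + y))\<^sup>2 = (p x)\<^sup>2 + 2 * Re (\<phi> (adj x * y)) + (p y)\<^sup>2"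
    using expand_square[OF assms, of 1] by simp
  also have "\<dots> \<le> (p x + p y)\<^sup>2"
    using Cauchy_Schwarz[OF assms] abs_Re_le_cmod[of "\<phi> (adj x * y)"]
    unfolding power2_sum by linarith
  finally show ?thesis using assms by (simp add: power2_le_iff_abs_le)
qed

lemma seminorm_scaleC: "x \<in> B \<Longrightarrow> p (c *\<^sub>C x) = cmod c * p x"
proof -
  assume x: "x \<in> B"
  have "(p (c *\<^sub>C x))\<^sup>2 = (cmod c * p x)\<^sup>2" using expand_square[OF zero_mem x, of c] x
    by (simp add: power_mult_distrib gns_seminorm_def)
  then show ?thesis using x by (simp add: power2_eq_iff_nonneg)
qed

lemma seminorm_minus [simp]: "x \<in> B \<Longrightarrow> p (- x) = p x"
  using seminorm_scaleC[of x "-1"] by simp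

lemma seminorm_zero [simp]: "p 0 = 0" by (simp add: gns_seminorm_def)
lemma seminorm_one [simp]: "p 1 = 1" by (simp add: gns_seminorm_def)

lemma seminorm_minus_commute: "x \<in> B \<Longrightarrow> y \<in> B \<Longrightarrow> p (x - y) = p (y - x)"
  using seminorm_minus[of "x - y"] by simp

lemma seminorm_diff_triangle: "x \<in> B \<Longrightarrow> y \<in> B \<Longrightarrow> z \<in> B \<Longrightarrow> p (x - z) \<le> p (x - y) + p (y - z)"
  using seminorm_triangle[of "x - y" "y - z"] by simp

lemma seminorm_reverse_triangle: "x \<in> B \<Longrightarrow> y \<in> B \<Longrightarrow> \<bar>p x - p y\<bar> \<le> p (x - y)"
  using seminorm_triangle[of "x - y" y] seminorm_triangle[of "y - x" x]
  by (simp add: abs_le_iff seminorm_minus_commute[of x y])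

text \<open>The algebra has to act on the GNS space by bounded operators. For
  \<open>norm b < 1\<close> write \<open>1 - adj b * b = y * y\<close> with \<open>y\<close>
  self-adjoint; then \<open>(p (y * x))\<^sup>2 = (p x)\<^sup>2 - (p (b * x))\<^sup>2\<close>, and
  the left side is nonnegative. Scaling removes the restriction on \<open>b\<close>.\<close>

lemma seminorm_mult_left:
  assumes b: "b \<in> B" and x: "x \<in> B" shows "p (b * x) \<le> norm b * p x"
proof -
  have contr: "p (b * x) \<le> p x" if b: "b \<in> B" and n: "norm b < 1" for b
  proof -
    have "norm (adj b * b) < 1" using n by (simp add: cstar_identity power_less_one_iff)
    moreover have "adj b * b \<in> B" "adj (adj b * b) = adj b * b" using b by (simp_all add: adj_mult adj_adj)
    ultimately obtain y where y: "y \<in> B" "adj y = y" "y * y = 1 - adj b * b"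
      using sqrt_one_minus by blast
    have "adj (y * x) * (y * x) = adj x * (y * y) * x" by (simp only: adj_mult y(2) mult.assoc)
    also have "\<dots> = adj x * x - adj (b * x) * (b * x)"
      unfolding y(3) by (simp add: algebra_simps adj_mult)
    finally have "(p (y * x))\<^sup>2 = (p x)\<^sup>2 - (p (b * x))\<^sup>2"
      using x y b by (simp add: seminorm_sq map_linear)
    then have "(p (b * x))\<^sup>2 \<le> (p x)\<^sup>2" using zero_le_power2[of "p (y * x)"] by linarith
    then show ?thesis using x b by (simp add: power2_le_iff_abs_le)
  qed
  have "p (b * x) \<le> r * p x" if r: "norm b < r" for r
  proof -
    have r0: "r > 0" using r norm_ge_zero[of b] by linarith
    have "p (((1 / r) *\<^sub>R b) * x) \<le> p x" using r r0 b by (intro contr) auto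
    moreover have "((1 / r) *\<^sub>R b) * x = complex_of_real (1 / r) *\<^sub>C (b * x)"
      by (simp add: scaleR_eq_scaleC scaleC_mult_left del: of_real_divide)
    ultimately show ?thesis using r0 x b by (simp add: seminorm_scaleC norm_divide field_simps)
  qed
  note le = this
  show ?thesis
  proof (cases "p x = 0")
    case True
    then show ?thesis using le[of "norm b + 1"] by simp
  next
    case False
    then have "p x > 0" using seminorm_nonneg[OF x] by linarith
    show ?thesis
    proof (rule field_le_epsilon)
      fix e :: real assume "e > 0"
      then have "p (b * x) \<le> (norm b + e / p x) * p x" using \<open>p x > 0\<close> by (intro le) simp
      then show "p (b * x) \<le> norm b * p x + e" using \<open>p x > 0\<close> by (simp add: distrib_right)
    qed
  qed
qed

lemma seminorm_le_norm: "x \<in> B \<Longrightarrow> p x \<le> norm x"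
  using seminorm_mult_left[of x 1] by simp

lemma map_norm_le: "x \<in> B \<Longrightarrow> cmod (\<phi> x) \<le> norm x"
  using Cauchy_Schwarz[of 1 x] seminorm_le_norm[of x] by simp

section \<open>Cauchy sequences for the GNS seminorm\<close>

lemma cauchyI:
  assumes "\<And>n. X n \<in> B" "\<And>m n. p (X m - X n) \<le> \<epsilon> m + \<epsilon> n" "\<epsilon> \<longlonglongrightarrow> 0"
  shows "X \<in> gns_cauchy B \<phi>"
proof -
  have "\<exists>N. \<forall>m\<ge>N. \<forall>n\<ge>N. p (X m - X n) < e" if e: "e > 0" for e
  proof -
    obtain N where N: "\<forall>n\<ge>N. \<epsilon> n < e / 2"
      using order_tendstoD(2)[OF assms(3), of "e / 2"] e by (auto simp: eventually_sequentially)
    have "p (X m - X n) < e" if "m \<ge> N" "n \<ge> N" for m n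
      using assms(2)[of m n] N[rule_format, OF that(1)] N[rule_format, OF that(2)] by linarith
    then show ?thesis by blast
  qed
  then show ?thesis using assms(1) unfolding gns_cauchy_def by simp
qed

lemma cauchy_mem: "X \<in> gns_cauchy B \<phi> \<Longrightarrow> X n \<in> B"
  by (simp add: gns_cauchy_def)

lemma cauchyD:
  assumes "X \<in> gns_cauchy B \<phi>" "e > 0"
  obtains N where "\<And>m n. m \<ge> N \<Longrightarrow> n \<ge> N \<Longrightarrow> p (X m - X n) < e"
proof -
  have "\<exists>N. \<forall>m\<ge>N. \<forall>n\<ge>N. p (X m - X n) < e" using assms unfolding gns_cauchy_def by simp
  then show ?thesis using that by metis
qed

lemma cauchy_seminorm_convergent:
  assumes X: "X \<in> gns_cauchy B \<phi>" shows "convergent (\<lambda>n. p (X n))"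
proof (rule Cauchy_convergent, rule CauchyI)
  note [simp] = cauchy_mem[OF X]
  fix e :: real assume "0 < e"
  then obtain N where N: "\<And>m n. m \<ge> N \<Longrightarrow> n \<ge> N \<Longrightarrow> p (X m - X n) < e" using cauchyD[OF X] by metis
  have "norm (p (X m) - p (X n)) < e" if "m \<ge> N" "n \<ge> N" for m n
    using seminorm_reverse_triangle[of "X m" "X n"] N[OF that] by simp
  then show "\<exists>M. \<forall>m\<ge>M. \<forall>n\<ge>M. norm (p (X m) - p (X n)) < e" by blast
qed

lemma cauchy_bounded:
  assumes X: "X \<in> gns_cauchy B \<phi>" obtains K where "K > 0" "\<And>n. p (X n) \<le> K"
proof -
  have "Bseq (\<lambda>n. p (X n))" using cauchy_seminorm_convergent[OF X] by (rule convergent_imp_Bseq)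
  then obtain K where "K > 0" "\<forall>n. norm (p (X n)) \<le> K" by (auto simp: Bseq_def)
  then show ?thesis using that by (simp add: abs_le_iff)
qed

lemma cauchy_add:
  assumes X: "X \<in> gns_cauchy B \<phi>" and Y: "Y \<in> gns_cauchy B \<phi>"
  shows "(\<lambda>n. X n + Y n) \<in> gns_cauchy B \<phi>"
proof -
  note [simp] = cauchy_mem[OF X]
  note [simp] = cauchy_mem[OF Y]
  have "\<exists>N. \<forall>m\<ge>N. \<forall>n\<ge>N. p ((X m + Y m) - (X n + Y n)) < e" if e: "e > 0" for e
  proof -
    obtain N M where N: "\<And>m n. m \<ge> N \<Longrightarrow> n \<ge> N \<Longrightarrow> p (X m - X n) < e/2"
      and M: "\<And>m n. m \<ge> M \<Longrightarrow> n \<ge> M \<Longrightarrow> p (Y m - Y n) < e/2"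
      using cauchyD[OF X] cauchyD[OF Y] e by (metis half_gt_zero)
    have "p ((X m + Y m) - (X n + Y n)) < e" if "m \<ge> max N M" "n \<ge> max N M" for m n
      using seminorm_triangle[of "X m - X n" "Y m - Y n"] N[of m n] M[of m n] that X Y
      by (simp add: algebra_simps)
    then show ?thesis by blast
  qed
  then show ?thesis using X Y unfolding gns_cauchy_def by simp
qed

lemma cauchy_mult_left:
  assumes X: "X \<in> gns_cauchy B \<phi>" and b: "b \<in> B"
  shows "(\<lambda>n. b * X n) \<in> gns_cauchy B \<phi>"
proof -
  note [simp] = cauchy_mem[OF X]
  have "\<exists>N. \<forall>m\<ge>N. \<forall>n\<ge>N. p (b * X m - b * X n) < e" if e: "e > 0" for e
  proof -
    have nb: "norm b + 1 > 0" using norm_ge_zero[of b] by linarith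
    obtain N where N: "\<And>m n. m \<ge> N \<Longrightarrow> n \<ge> N \<Longrightarrow> p (X m - X n) < e/(norm b + 1)"
      using cauchyD[OF X] e nb by (metis divide_pos_pos)
    have "p (b * X m - b * X n) < e" if "m \<ge> N" "n \<ge> N" for m n
    proof -
      have "p (b * X m - b * X n) \<le> norm b * p (X m - X n)"
        using seminorm_mult_left[of b "X m - X n"] X b by (simp add: right_diff_distrib)
      also have "\<dots> \<le> (norm b + 1) * p (X m - X n)"
        using X by (intro mult_right_mono) auto
      also have "\<dots> < e" using N[OF that] nb by (simp add: field_simps)
      finally show ?thesis .
    qed
    then show ?thesis by blast
  qed
  then show ?thesis using X b unfolding gns_cauchy_def by simp
qed

lemma cauchy_scaleC:
  assumes X: "X \<in> gns_cauchy B \<phi>" shows "(\<lambda>n. c *\<^sub>C X n) \<in> gns_cauchy B \<phi>"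
  using cauchy_mult_left[OF X, of "c *\<^sub>C 1"] by (simp add: scaleC_mult_left)

lemma cauchy_diff:
  assumes "X \<in> gns_cauchy B \<phi>" "Y \<in> gns_cauchy B \<phi>"
  shows "(\<lambda>n. X n - Y n) \<in> gns_cauchy B \<phi>"
  using cauchy_add[OF assms(1) cauchy_scaleC[OF assms(2), of "-1"]] by simp

lemma cauchy_const: "x \<in> B \<Longrightarrow> (\<lambda>n. x) \<in> gns_cauchy B \<phi>"
  unfolding gns_cauchy_def by simp

lemma inner_diff_bound:
  assumes "x \<in> B" "y \<in> B" "x' \<in> B" "y' \<in> B"
  shows "cmod (\<phi> (adj x * y) - \<phi> (adj x' * y')) \<le> p (x - x') * p y + p x' * p (y - y')"
proof -
  have "\<phi> (adj x * y) - \<phi> (adj x' * y') = \<phi> (adj (x - x') * y) + \<phi> (adj x' * (y - y'))"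
    using assms by (simp add: adj_diff algebra_simps map_linear)
  then show ?thesis
    using Cauchy_Schwarz[of "x - x'" y] Cauchy_Schwarz[of x' "y - y'"] assms
      norm_triangle_ineq[of "\<phi> (adj (x - x') * y)" "\<phi> (adj x' * (y - y'))"] by simp
qed

lemma cauchy_inner_convergent:
  assumes X: "X \<in> gns_cauchy B \<phi>" and Y: "Y \<in> gns_cauchy B \<phi>"
  shows "convergent (\<lambda>n. \<phi> (adj (X n) * Y n))"
proof (rule Cauchy_convergent, rule CauchyI)
  note [simp] = cauchy_mem[OF X]
  note [simp] = cauchy_mem[OF Y]
  fix e :: real assume e: "0 < e"
  obtain K L where K: "K > 0" "\<And>n. p (X n) \<le> K" and L: "L > 0" "\<And>n. p (Y n) \<le> L"
    using cauchy_bounded[OF X] cauchy_bounded[OF Y] by metis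
  have "e/(2*L) > 0" "e/(2*K) > 0" using e K L by simp_all
  then obtain N M where N: "\<And>m n. m \<ge> N \<Longrightarrow> n \<ge> N \<Longrightarrow> p (X m - X n) < e/(2*L)"
    and M: "\<And>m n. m \<ge> M \<Longrightarrow> n \<ge> M \<Longrightarrow> p (Y m - Y n) < e/(2*K)"
    using cauchyD[OF X] cauchyD[OF Y] by metis
  have "norm (\<phi> (adj (X m) * Y m) - \<phi> (adj (X n) * Y n)) < e" if "m \<ge> max N M" "n \<ge> max N M" for m n
  proof -
    have "norm (\<phi> (adj (X m) * Y m) - \<phi> (adj (X n) * Y n)) \<le>
        p (X m - X n) * p (Y m) + p (X n) * p (Y m - Y n)"
      using X Y by (intro inner_diff_bound) auto
    also have "\<dots> \<le> p (X m - X n) * L + K * p (Y m - Y n)"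
      using X Y K L by (intro add_mono mult_left_mono mult_right_mono) auto
    also have "\<dots> < e/(2*L) * L + K * (e/(2*K))"
      using N[of m n] M[of m n] that K L
      by (intro add_strict_mono mult_strict_right_mono mult_strict_left_mono) auto
    also have "\<dots> = e" using K L by simp
    finally show ?thesis .
  qed
  then show "\<exists>M. \<forall>m\<ge>M. \<forall>n\<ge>M. norm (\<phi> (adj (X m) * Y m) - \<phi> (adj (X n) * Y n)) < e" by blast
qed

end

section \<open>Riesz representation and purity\<close>

lemma cstar_stateI: "cstar_subalgebra B \<Longrightarrow> state_on B \<phi> \<Longrightarrow> cstar_state B \<phi>"
  by unfold_locales

lemma pure_state_onD:
  assumes "pure_state_on B \<phi>" "state_on B \<psi>" "state_on B \<omega>" "0 < t" "t < 1"
    "\<And>x. x \<in> B \<Longrightarrow> \<phi> x = complex_of_real t * \<psi> x + complex_of_real (1 - t) * \<omega> x"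
  shows "\<forall>x\<in>B. \<psi> x = \<phi> x \<and> \<omega> x = \<phi> x"
proof -
  have "state_on B \<psi> \<and> state_on B \<omega> \<and> 0 < t \<and> t < 1 \<and>
      (\<forall>x\<in>B. \<phi> x = complex_of_real t * \<psi> x + complex_of_real (1 - t) * \<omega> x)"
    using assms(2-6) by (intro conjI ballI) assumption+
  then show ?thesis using assms(1) unfolding pure_state_on_def by meson
qed

context cstar_state
begin

text \<open>Only approximate representing vectors exist inside the algebra. \<open>J\<close> is the
  quadratic functional whose minimiser would represent \<open>h\<close>; it is bounded below by
  \<open>- C\<^sup>2\<close>, and \<open>\<eta> k\<close> comes within 1/(k+1) of its infimum. The
  discriminant argument turns this gap into the error \<open>\<epsilon> k\<close>, its square root,
  and the same estimate applied to differences \<open>\<eta> i - \<eta> j\<close> makes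
  \<open>\<eta>\<close> Cauchy. \<open>h\<close> is antilinear because it plays the role of x
  \<mapsto> \<langle>x, \<eta>\<rangle>; a subspace \<open>M\<close> is allowed so that the vector
  can later be kept odd.\<close>

lemma Riesz:
  assumes MB: "M \<subseteq> B" and M0: "0 \<in> M"
    and Madd: "\<And>x y. x \<in> M \<Longrightarrow> y \<in> M \<Longrightarrow> x + y \<in> M"
    and Msc: "\<And>c x. x \<in> M \<Longrightarrow> c *\<^sub>C x \<in> M"
    and hadd: "\<And>x y. x \<in> M \<Longrightarrow> y \<in> M \<Longrightarrow> h (x + y) = h x + h y"
    and hsc: "\<And>c x. x \<in> M \<Longrightarrow> h (c *\<^sub>C x) = cnj c * h x"
    and hb: "\<And>x. x \<in> M \<Longrightarrow> cmod (h x) \<le> C * p x"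
  obtains \<eta> \<epsilon> where "\<And>k. \<eta> k \<in> M" "\<eta> \<in> gns_cauchy B \<phi>" "\<epsilon> \<longlonglongrightarrow> 0"
    "\<And>k x. x \<in> M \<Longrightarrow> cmod (\<phi> (adj x * \<eta> k) - h x) \<le> \<epsilon> k * p x"
proof -
  define J where "J \<xi> = (p \<xi>)\<^sup>2 - 2 * Re (h \<xi>)" for \<xi>
  define \<delta> where "\<delta> k = 1 / real (Suc k)" for k
  define \<epsilon> where "\<epsilon> k = sqrt (\<delta> k)" for k
  have \<delta>: "\<delta> k > 0" for k by (simp add: \<delta>_def)
  have lower: "- C\<^sup>2 \<le> J \<xi>" if "\<xi> \<in> M" for \<xi>
  proof -
    have "Re (h \<xi>) \<le> C * p \<xi>" using hb[OF that] abs_Re_le_cmod[of "h \<xi>"] by linarith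
    moreover have "0 \<le> (p \<xi> - C)\<^sup>2" by simp
    ultimately show ?thesis unfolding J_def power2_diff by (simp add: algebra_simps)
  qed
  define m where "m = Inf (J ` M)"
  have bdd: "bdd_below (J ` M)" using lower by (intro bdd_belowI2) auto
  have m: "m \<le> J \<xi>" if "\<xi> \<in> M" for \<xi>
    unfolding m_def using that bdd by (intro cInf_lower) auto
  have "\<exists>\<xi>\<in>M. J \<xi> < m + \<delta> k" for k
  proof -
    have "Inf (J ` M) < m + \<delta> k" using \<delta>[of k] by (simp add: m_def)
    moreover have "J ` M \<noteq> {}" using M0 by auto
    ultimately obtain y where "y \<in> J ` M" "y < m + \<delta> k"
      using cInf_lessD[of "J ` M" "m + \<delta> k"] by metis
    then show ?thesis by auto
  qed
  then obtain \<eta> where \<eta>: "\<And>k. \<eta> k \<in> M" "\<And>k. J (\<eta> k) < m + \<delta> k" by metis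
  have \<eta>B: "\<eta> k \<in> B" for k using \<eta>(1) MB by blast
  have est: "cmod (\<phi> (adj x * \<eta> k) - h x) \<le> \<epsilon> k * p x" if x: "x \<in> M" for k x
  proof -
    define d where "d = \<phi> (adj (\<eta> k) * x) - cnj (h x)"
    have xB: "x \<in> B" using x MB by blast
    have "0 \<le> \<delta> k + 2 * Re (z * d) + (cmod z)\<^sup>2 * (p x)\<^sup>2" for z
    proof -
      have "J (\<eta> k + z *\<^sub>C x) = J (\<eta> k) + 2 * Re (z * d) + (cmod z)\<^sup>2 * (p x)\<^sup>2"
        unfolding J_def d_def using expand_square[OF \<eta>B xB, of k z] \<eta>(1) x
        by (simp add: hadd hsc Msc algebra_simps)
      moreover have "m \<le> J (\<eta> k + z *\<^sub>C x)" using \<eta>(1) x by (intro m Madd Msc)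
      ultimately show ?thesis using \<eta>(2)[of k] by linarith
    qed
    then have "(cmod d)\<^sup>2 \<le> \<delta> k * (p x)\<^sup>2" by (rule quadratic_nonneg_discriminant) simp
    then have "cmod d \<le> \<epsilon> k * p x"
      unfolding \<epsilon>_def using xB real_le_rsqrt[of "cmod d" "\<delta> k * (p x)\<^sup>2"] by (simp add: real_sqrt_mult)
    moreover have "\<phi> (adj x * \<eta> k) - h x = cnj d"
      unfolding d_def using map_adj_mult_swap[OF \<eta>B xB, of k] by simp
    ultimately show ?thesis by simp
  qed
  have lim: "\<epsilon> \<longlonglongrightarrow> 0"
    unfolding \<epsilon>_def \<delta>_def using tendsto_real_sqrt[OF LIMSEQ_inverse_real_of_nat]
    by (simp add: inverse_eq_divide)
  have "p (\<eta> i - \<eta> j) \<le> \<epsilon> i + \<epsilon> j" for i j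
  proof -
    define x where "x = \<eta> i - \<eta> j"
    have xM: "x \<in> M" unfolding x_def using Madd[OF \<eta>(1)[of i] Msc[OF \<eta>(1)[of j], of "-1"]] by simp
    then have xB: "x \<in> B" using MB by blast
    have "(p x)\<^sup>2 = cmod (\<phi> (adj x * x))" using xB by (simp add: map_adj_mult_self norm_power)
    also have "\<phi> (adj x * x) = (\<phi> (adj x * \<eta> i) - h x) - (\<phi> (adj x * \<eta> j) - h x)"
      using xB \<eta>B by (simp add: x_def right_diff_distrib map_linear)
    also have "cmod \<dots> \<le> \<epsilon> i * p x + \<epsilon> j * p x"
      using est[OF xM, of i] est[OF xM, of j] norm_triangle_ineq4 order_trans add_mono by meson
    finally have "p x * p x \<le> (\<epsilon> i + \<epsilon> j) * p x" by (simp add: power2_eq_square distrib_right)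
    moreover have "0 \<le> \<epsilon> i + \<epsilon> j" using \<delta> by (simp add: \<epsilon>_def less_imp_le)
    moreover have "0 \<le> p x" using xB by simp
    ultimately have "p x \<le> \<epsilon> i + \<epsilon> j" by (cases "p x = 0") auto
    then show ?thesis by (simp add: x_def)
  qed
  then have "\<eta> \<in> gns_cauchy B \<phi>" by (rule cauchyI[where \<epsilon> = \<epsilon>, OF \<eta>B _ lim])
  from that[OF \<eta>(1) this lim est] show ?thesis .
qed

text \<open>Testing the representing relation with \<open>adj b * (b * \<eta> k)\<close> produces
  the square of \<open>p (b * \<eta> k)\<close>, while \<open>bound\<close> contains only its first
  power; dividing and letting \<open>k\<close> tend to infinity leaves \<open>K\<close>. In this way
  a bound on an intertwining functional becomes a bound on \<parallel>b \<eta>\<parallel>.\<close>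

lemma Riesz_seminorm_le:
  assumes \<eta>: "\<And>k. \<eta> k \<in> B" "\<epsilon> \<longlonglongrightarrow> 0" and b: "b \<in> B" and K: "0 \<le> K"
    and est: "\<And>k. cmod (\<phi> (adj (adj b * (b * \<eta> k)) * \<eta> k) - h (adj b * (b * \<eta> k))) \<le> \<epsilon> k * p (adj b * (b * \<eta> k))"
    and bound: "\<And>k. cmod (h (adj b * (b * \<eta> k))) \<le> K * p (b * \<eta> k)"
    and lim: "(\<lambda>k. p (b * \<eta> k)) \<longlonglongrightarrow> l"
  shows "l \<le> K"
proof -
  have "p (b * \<eta> k) \<le> K + \<bar>\<epsilon> k\<bar> * norm b" for k
  proof -
    define a where "a = p (b * \<eta> k)"
    have a0: "0 \<le> a" using b \<eta> by (simp add: a_def)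
    have "a * a = cmod (\<phi> (adj (b * \<eta> k) * (b * \<eta> k)))"
      using b \<eta> by (simp add: map_adj_mult_self a_def norm_power power2_eq_square norm_mult)
    also have "adj (b * \<eta> k) * (b * \<eta> k) = adj (adj b * (b * \<eta> k)) * \<eta> k"
      by (simp add: adj_mult adj_adj mult.assoc)
    also have "cmod (\<phi> \<dots>) \<le> K * a + \<epsilon> k * p (adj b * (b * \<eta> k))"
      using est[of k] bound[of k] norm_triangle_ineq2[of "\<phi> (adj (adj b * (b * \<eta> k)) * \<eta> k)" "h (adj b * (b * \<eta> k))"]
      unfolding a_def by linarith
    also have "\<epsilon> k * p (adj b * (b * \<eta> k)) \<le> \<bar>\<epsilon> k\<bar> * (norm b * a)"
      using seminorm_mult_left[of "adj b" "b * \<eta> k"] b \<eta> unfolding a_def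
      by (intro mult_mono) auto
    finally have "a * a \<le> (K + \<bar>\<epsilon> k\<bar> * norm b) * a" by (simp add: algebra_simps)
    then show ?thesis using a0 K unfolding a_def[symmetric] by (cases "a = 0") auto
  qed
  moreover have "(\<lambda>k. K + \<bar>\<epsilon> k\<bar> * norm b) \<longlonglongrightarrow> K + \<bar>0\<bar> * norm b"
    by (intro tendsto_intros \<eta>(2))
  ultimately show ?thesis using LIMSEQ_le[OF lim] by fastforce
qed

text \<open>The vector functional b \<mapsto> \<langle>v, b v\<rangle> of the GNS vector
  \<open>v\<close> that \<open>\<eta>\<close> represents, without normalisation.\<close>

definition vf :: "(nat \<Rightarrow> 'a) \<Rightarrow> 'a \<Rightarrow> complex" where
  "vf \<eta> b = lim (\<lambda>k. \<phi> (adj (\<eta> k) * (b * \<eta> k)))"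

lemma vf_tendsto:
  assumes "\<eta> \<in> gns_cauchy B \<phi>" "b \<in> B"
  shows "(\<lambda>k. \<phi> (adj (\<eta> k) * (b * \<eta> k))) \<longlonglongrightarrow> vf \<eta> b"
  unfolding vf_def using cauchy_inner_convergent[OF assms(1) cauchy_mult_left[OF assms]]
  by (simp add: convergent_LIMSEQ_iff)

lemma seminorm_mult_tendsto:
  assumes "\<eta> \<in> gns_cauchy B \<phi>" "b \<in> B"
  shows "(\<lambda>k. p (b * \<eta> k)) \<longlonglongrightarrow> lim (\<lambda>k. p (b * \<eta> k))"
  using cauchy_seminorm_convergent[OF cauchy_mult_left[OF assms]] by (simp add: convergent_LIMSEQ_iff)

lemma vf_functional:
  assumes \<eta>: "\<eta> \<in> gns_cauchy B \<phi>"
  shows "functional_on B (vf \<eta>)"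
  by (rule functional_on_limit[OF subalgebra _ vf_tendsto[OF \<eta>]])
    (use cauchy_mem[OF \<eta>] in \<open>simp add: functional_on_def ring_distribs map_linear
      scaleC_mult_left scaleC_mult_right\<close>)

lemma vf_adj_mult_self:
  assumes \<eta>: "\<eta> \<in> gns_cauchy B \<phi>" and x: "x \<in> B"
  shows "vf \<eta> (adj x * x) = complex_of_real ((lim (\<lambda>k. p (x * \<eta> k)))\<^sup>2)"
proof -
  note [simp] = cauchy_mem[OF \<eta>]
  have "\<phi> (adj (\<eta> k) * (adj x * x * \<eta> k)) = complex_of_real ((p (x * \<eta> k))\<^sup>2)" for k
    using map_adj_mult_self[of "x * \<eta> k"] x by (simp add: adj_mult mult.assoc)
  then have "(\<lambda>k. \<phi> (adj (\<eta> k) * (adj x * x * \<eta> k))) \<longlonglongrightarrow> complex_of_real ((lim (\<lambda>k. p (x * \<eta> k)))\<^sup>2)"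
    using seminorm_mult_tendsto[OF \<eta> x] by (simp only:) (intro tendsto_intros)
  then show ?thesis using vf_tendsto[OF \<eta>, of "adj x * x"] x LIMSEQ_unique by blast
qed

lemma lim_seminorm_nonneg:
  assumes \<eta>: "\<eta> \<in> gns_cauchy B \<phi>" and x: "x \<in> B"
  shows "0 \<le> lim (\<lambda>k. p (x * \<eta> k))"
  using seminorm_mult_tendsto[OF assms] cauchy_mem[OF \<eta>] x
  by (intro LIMSEQ_le_const[OF seminorm_mult_tendsto[OF assms]]) auto

lemma vf_bound:
  assumes \<eta>: "\<eta> \<in> gns_cauchy B \<phi>" and x: "x \<in> B" and y: "y \<in> B"
  shows "cmod (vf \<eta> (adj x * y)) \<le> lim (\<lambda>k. p (x * \<eta> k)) * lim (\<lambda>k. p (y * \<eta> k))"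
proof -
  note [simp] = cauchy_mem[OF \<eta>]
  have "cmod (\<phi> (adj (\<eta> k) * (adj x * y * \<eta> k))) \<le> p (x * \<eta> k) * p (y * \<eta> k)" for k
    using Cauchy_Schwarz[of "x * \<eta> k" "y * \<eta> k"] x y by (simp add: adj_mult mult.assoc)
  then show ?thesis
    using LIMSEQ_le[OF tendsto_norm[OF vf_tendsto[OF \<eta>, of "adj x * y"]]
        tendsto_mult[OF seminorm_mult_tendsto[OF \<eta> x] seminorm_mult_tendsto[OF \<eta> y]]] x y by simp
qed

lemma vf_state:
  assumes \<eta>: "\<eta> \<in> gns_cauchy B \<phi>" and one: "vf \<eta> 1 = 1"
  shows "state_on B (vf \<eta>)"
  using vf_functional[OF \<eta>] one
  by (auto simp: state_on_def functional_on_def vf_adj_mult_self[OF \<eta>] complex_nonneg_Reals_iff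
      simp flip: of_real_power)

lemma vf_seminorm:
  assumes \<eta>: "\<eta> \<in> gns_cauchy B \<phi>" and x: "x \<in> B"
  shows "gns_seminorm (vf \<eta>) x = lim (\<lambda>k. p (x * \<eta> k))"
  unfolding gns_seminorm_def[of "vf \<eta>"] vf_adj_mult_self[OF assms]
  using lim_seminorm_nonneg[OF assms] by simp

lemma vf_scale:
  assumes \<eta>: "\<eta> \<in> gns_cauchy B \<phi>" and b: "b \<in> B"
  shows "vf (\<lambda>k. c *\<^sub>C \<eta> k) b = complex_of_real ((cmod c)\<^sup>2) * vf \<eta> b"
proof -
  note [simp] = cauchy_mem[OF \<eta>]
  have "\<phi> (adj (c *\<^sub>C \<eta> k) * (b * c *\<^sub>C \<eta> k)) = (c * cnj c) * \<phi> (adj (\<eta> k) * (b * \<eta> k))" for k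
    using b by (simp add: adj_scaleC scaleC_mult_left scaleC_mult_right scaleC_scaleC map_linear)
  then have "(\<lambda>k. \<phi> (adj (c *\<^sub>C \<eta> k) * (b * c *\<^sub>C \<eta> k))) \<longlonglongrightarrow> (c * cnj c) * vf \<eta> b"
    using tendsto_mult_left[OF vf_tendsto[OF \<eta> b], of "c * cnj c"] by simp
  from LIMSEQ_unique[OF vf_tendsto[OF cauchy_scaleC[OF \<eta>] b] this]
  show ?thesis using complex_norm_square[of c] by simp
qed

text \<open>\<open>\<phi>\<close> is the midpoint of the positive functionals \<open>\<phi> \<plusminus> r g\<close> for small \<open>r\<close>.\<close>

lemma pure_dominated_hermitian:
  assumes pure: "pure_state_on B \<phi>" and g: "functional_on B g"
    and herm: "\<And>x. x \<in> B \<Longrightarrow> g (adj x) = cnj (g x)"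
    and bound: "\<And>x y. x \<in> B \<Longrightarrow> y \<in> B \<Longrightarrow> cmod (g (adj x * y)) \<le> C * p x * p y"
    and x: "x \<in> B"
  shows "g x = g 1 * \<phi> x"
proof -
  interpret g: cstar_functional B g using g by unfold_locales
  have C1: "cmod (g 1) \<le> C" using bound[of 1 1] by simp
  then have C: "C \<ge> 0" using norm_ge_zero order_trans by blast
  \<comment> \<open>\<open>r * C \<le> 1 / 2\<close> keeps both perturbed functionals positive and
    their values at 1 at least 1/2.\<close>
  define r where "r = 1 / (2 * (C + 1))"
  have r: "r > 0" "r * C \<le> 1 / 2" using C by (auto simp: r_def field_simps)
  have g1: "g 1 = complex_of_real (Re (g 1))"
    using herm[OF one_mem] by (simp add: complex_eq_iff)
  define a where "a = r * Re (g 1)"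
  have a: "\<bar>a\<bar> \<le> 1 / 2"
  proof -
    have "\<bar>a\<bar> = r * \<bar>Re (g 1)\<bar>" using r by (simp add: a_def abs_mult)
    also have "\<dots> \<le> r * C" using r C1 abs_Re_le_cmod[of "g 1"] by (intro mult_left_mono) auto
    finally show ?thesis using r by linarith
  qed
  have st: "state_on B (\<lambda>x. (\<phi> x + complex_of_real (s * r) * g x) / complex_of_real (1 + s * a))"
    if s: "\<bar>s\<bar> = 1" for s
  proof -
    have sa: "1 + s * a > 0" using a s by (auto simp: abs_if split: if_splits)
    have pos: "(\<phi> (adj x * x) + complex_of_real (s * r) * g (adj x * x)) / complex_of_real (1 + s * a) \<in> \<real>\<^sub>\<ge>\<^sub>0"
      if x: "x \<in> B" for x
    proof -
      have "g (adj x * x) = cnj (g (adj x * x))"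
        using herm[of "adj x * x"] x by (simp add: adj_mult adj_adj)
      then have im: "Im (g (adj x * x)) = 0" by (simp add: complex_eq_iff)
      have "\<bar>Re (g (adj x * x))\<bar> \<le> C * (p x * p x)"
        using bound[OF x x] abs_Re_le_cmod[of "g (adj x * x)"] by (simp add: mult.assoc)
      then have "\<bar>s * r * Re (g (adj x * x))\<bar> \<le> r * (C * (p x * p x))"
        using r s by (simp add: abs_mult)
      also have "\<dots> \<le> 1 * (p x * p x)"
        unfolding mult.assoc[symmetric] using r x by (intro mult_right_mono) auto
      finally have "0 \<le> (p x)\<^sup>2 + s * r * Re (g (adj x * x))" by (simp add: power2_eq_square)
      then show ?thesis
        using sa x im by (simp add: complex_nonneg_Reals_iff map_adj_mult_self Re_divide_of_real Im_divide_of_real)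
    qed
    have "(\<phi> 1 + complex_of_real (s * r) * g 1) / complex_of_real (1 + s * a) = 1"
    proof -
      have "\<phi> 1 + complex_of_real (s * r) * g 1 = complex_of_real (1 + s * a)"
        by (subst g1) (simp add: a_def mult.assoc)
      moreover have "complex_of_real (1 + s * a) \<noteq> 0" using sa by (metis of_real_eq_0_iff less_irrefl)
      ultimately show ?thesis by simp
    qed
    then show ?thesis unfolding state_on_def
      using pos by (auto simp: map_linear g.map_linear add_divide_distrib algebra_simps)
  qed
  \<comment> \<open>The two perturbed functionals take the values \<open>1 + a\<close> and
    \<open>1 - a\<close> at 1; these weights undo the normalisation.\<close>
  define t where "t = (1 + a) / 2"
  have t: "0 < t" "t < 1" using a by (auto simp: t_def abs_if split: if_splits)
  have t': "1 - t = (1 - a) / 2" by (simp add: t_def field_simps)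
  have ne: "complex_of_real (1 + a) \<noteq> 0" "complex_of_real (1 - a) \<noteq> 0"
    using a by (auto simp: abs_if simp del: of_real_add of_real_diff split: if_splits)
  have dec: "\<phi> x = complex_of_real t * ((\<phi> x + complex_of_real r * g x) / complex_of_real (1 + a)) +
    complex_of_real (1 - t) * ((\<phi> x - complex_of_real r * g x) / complex_of_real (1 - a))" for x
  proof -
    have "complex_of_real t * (u / complex_of_real (1 + a)) = u / 2"
      "complex_of_real (1 - t) * (u / complex_of_real (1 - a)) = u / 2" for u
      using ne unfolding t' by (simp_all add: t_def del: of_real_add of_real_diff)
    then show ?thesis by (simp only:) (simp flip: add_divide_distrib)
  qed
  have st1: "state_on B (\<lambda>x. (\<phi> x + complex_of_real r * g x) / complex_of_real (1 + a))"
    using st[of 1] by simp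
  have st2: "state_on B (\<lambda>x. (\<phi> x - complex_of_real r * g x) / complex_of_real (1 - a))"
    using st[of "-1"] by simp
  have "(\<phi> x + complex_of_real r * g x) / complex_of_real (1 + a) = \<phi> x"
    using pure_state_onD[OF pure st1 st2 t dec] x by blast
  then have "\<phi> x + complex_of_real r * g x = \<phi> x + complex_of_real a * \<phi> x"
    using ne by (simp add: divide_eq_eq algebra_simps)
  then have "complex_of_real r * g x = complex_of_real r * (g 1 * \<phi> x)"
    by (subst g1) (simp add: a_def mult.assoc)
  then show ?thesis using r by simp
qed

text \<open>Schur's lemma in terms of functionals: a bounded operator commuting with the irreducible
  GNS representation is a scalar. The hermitian case is applied to the real and imaginary parts of
  \<open>g\<close>, up to factors.\<close>

lemma pure_dominated:
  assumes pure: "pure_state_on B \<phi>" and g: "functional_on B g"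
    and bound: "\<And>x y. x \<in> B \<Longrightarrow> y \<in> B \<Longrightarrow> cmod (g (adj x * y)) \<le> C * p x * p y"
    and x: "x \<in> B"
  shows "g x = g 1 * \<phi> x"
proof -
  interpret g: cstar_functional B g using g by unfold_locales
  have bound': "cmod (cnj (g (adj (adj x * y)))) \<le> C * p x * p y" if "x \<in> B" "y \<in> B" for x y
    using bound[OF that(2,1)] by (simp add: adj_mult adj_adj mult_ac)
  have "g x + cnj (g (adj x)) = (g 1 + cnj (g (adj 1))) * \<phi> x"
  proof (rule pure_dominated_hermitian[OF pure _ _ _ x, where C = "2 * C"])
    show "functional_on B (\<lambda>x. g x + cnj (g (adj x)))"
      by (simp add: functional_on_def g.map_linear adj_add adj_scaleC algebra_simps)
    show "cmod (g (adj x * y) + cnj (g (adj (adj x * y)))) \<le> 2 * C * p x * p y"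
      if "x \<in> B" "y \<in> B" for x y
      using order_trans[OF norm_triangle_ineq add_mono[OF bound[OF that] bound'[OF that]]] by simp
  qed (auto simp: adj_adj)
  moreover have "\<i> * (g x - cnj (g (adj x))) = (\<i> * (g 1 - cnj (g (adj 1)))) * \<phi> x"
  proof (rule pure_dominated_hermitian[OF pure _ _ _ x, where C = "2 * C"])
    show "functional_on B (\<lambda>x. \<i> * (g x - cnj (g (adj x))))"
      by (simp add: functional_on_def g.map_linear adj_add adj_scaleC algebra_simps)
    show "cmod (\<i> * (g (adj x * y) - cnj (g (adj (adj x * y))))) \<le> 2 * C * p x * p y"
      if "x \<in> B" "y \<in> B" for x y
      using order_trans[OF norm_triangle_ineq4 add_mono[OF bound[OF that] bound'[OF that]]]
      by (simp add: norm_mult)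
  qed (auto simp: adj_adj algebra_simps)
  then have "g x - cnj (g (adj x)) = (g 1 - cnj (g (adj 1))) * \<phi> x"
    by (simp add: mult.assoc)
  ultimately have "(g x + cnj (g (adj x))) + (g x - cnj (g (adj x))) =
      (g 1 + cnj (g (adj 1))) * \<phi> x + (g 1 - cnj (g (adj 1))) * \<phi> x" by (simp only:)
  then show ?thesis by (simp add: algebra_simps)
qed

end

section \<open>Intertwiners as functionals\<close>

text \<open>A functional \<open>g\<close> with \<open>\<bar>g (x\<^sup>* y)\<bar> \<le> C \<sigma>(x\<^sup>* x)\<^sup>1\<^sup>/\<^sup>2 \<tau>(y\<^sup>* y)\<^sup>1\<^sup>/\<^sup>2\<close> encodes the bounded
  intertwiner \<open>T\<close> from the GNS space of \<open>\<tau>\<close> to that of \<open>\<sigma>\<close> with \<open>g (x\<^sup>* y) = \<langle>x, T y\<rangle>\<close>.\<close>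

lemma intertwiner_vector:
  fixes B :: "'a::cstar_algebra set"
  assumes B: "cstar_subalgebra B" and \<sigma>: "state_on B \<sigma>" and pure: "pure_state_on B \<tau>"
    and g: "functional_on B g"
    and bound: "\<And>x y. x \<in> B \<Longrightarrow> y \<in> B \<Longrightarrow> cmod (g (adj x * y)) \<le> C * gns_seminorm \<sigma> x * gns_seminorm \<tau> y"
    and x0: "x0 \<in> B" "g x0 \<noteq> 0"
  obtains \<eta> where "\<eta> \<in> gns_cauchy B \<sigma>"
    "\<And>b. b \<in> B \<Longrightarrow> (\<lambda>k. \<sigma> (adj (\<eta> k) * (b * \<eta> k))) \<longlonglongrightarrow> \<tau> b"
proof -
  have \<tau>: "state_on B \<tau>" using pure by (simp add: pure_state_on_def)
  interpret s: cstar_state B \<sigma> using B \<sigma> by (rule cstar_stateI)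
  interpret t: cstar_state B \<tau> using B \<tau> by (rule cstar_stateI)
  interpret g: cstar_functional B g using g by unfold_locales
  have C1: "cmod (g 1) \<le> C" using bound[of 1 1] by simp
  then have C: "C \<ge> 0" using norm_ge_zero order_trans by blast
  have hb: "cmod (g (adj x)) \<le> C * s.p x" if "x \<in> B" for x
    using bound[OF that s.one_mem] by simp
  obtain \<eta> \<epsilon> where \<eta>: "\<And>k. \<eta> k \<in> B" "\<eta> \<in> gns_cauchy B \<sigma>" "\<epsilon> \<longlonglongrightarrow> 0"
    and est: "\<And>k x. x \<in> B \<Longrightarrow> cmod (\<sigma> (adj x * \<eta> k) - g (adj x)) \<le> \<epsilon> k * s.p x"
  proof (rule s.Riesz[of B "\<lambda>x. g (adj x)" C])
    show "g (adj (x + y)) = g (adj x) + g (adj y)" if "x \<in> B" "y \<in> B" for x y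
      using that by (simp add: adj_add g.map_add)
    show "g (adj (c *\<^sub>C x)) = cnj c * g (adj x)" if "x \<in> B" for c x
      using that by (simp add: adj_scaleC g.map_scaleC)
  qed (use hb in auto)
  \<comment> \<open>\<open>\<eta>\<close> approximates \<open>T \<Omega>\<close>, with \<Omega> the
    cyclic vector of \<tau>, so this says \<parallel>T b \<Omega>\<parallel> \<le> C \<parallel>b
    \<Omega>\<parallel>.\<close>
  have seminorm_le: "lim (\<lambda>k. s.p (b * \<eta> k)) \<le> C * t.p b" if b: "b \<in> B" for b
  proof (rule s.Riesz_seminorm_le[where h = "\<lambda>x. g (adj x)", OF \<eta>(1) \<eta>(3) b])
    show "cmod (g (adj (adj b * (b * \<eta> k)))) \<le> C * t.p b * s.p (b * \<eta> k)" for k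
      using bound[of "b * \<eta> k" b] b \<eta>(1) by (simp add: adj_mult adj_adj mult_ac)
    show "(\<lambda>k. s.p (b * \<eta> k)) \<longlonglongrightarrow> lim (\<lambda>k. s.p (b * \<eta> k))"
      by (rule s.seminorm_mult_tendsto[OF \<eta>(2) b])
  qed (use b C \<eta>(1) est in auto)
  \<comment> \<open>The vector functional of \<open>T \<Omega>\<close> is dominated by \<tau> with
    constant \<open>C * C\<close>. Purity makes it a multiple of \<tau>, that is, \<open>T\<close>
    is a multiple of an isometry.\<close>
  have vf: "s.vf \<eta> b = s.vf \<eta> 1 * \<tau> b" if b: "b \<in> B" for b
  proof (rule t.pure_dominated[OF pure s.vf_functional[OF \<eta>(2)] _ b])
    fix x y assume xy: "x \<in> B" "y \<in> B"
    have "cmod (s.vf \<eta> (adj x * y)) \<le> lim (\<lambda>k. s.p (x * \<eta> k)) * lim (\<lambda>k. s.p (y * \<eta> k))"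
      using s.vf_bound[OF \<eta>(2)] xy by blast
    also have "\<dots> \<le> (C * t.p x) * (C * t.p y)"
      using seminorm_le s.lim_seminorm_nonneg[OF \<eta>(2)] xy C by (intro mult_mono) auto
    finally show "cmod (s.vf \<eta> (adj x * y)) \<le> (C * C) * t.p x * t.p y" by (simp add: mult_ac)
  qed
  define l where "l = lim (\<lambda>k. s.p (1 * \<eta> k))"
  have l: "(\<lambda>k. s.p (\<eta> k)) \<longlonglongrightarrow> l"
    using s.seminorm_mult_tendsto[OF \<eta>(2) s.one_mem] by (simp add: l_def)
  have l0: "0 \<le> l" unfolding l_def by (rule s.lim_seminorm_nonneg[OF \<eta>(2) s.one_mem])
  have one: "s.vf \<eta> 1 = complex_of_real (l\<^sup>2)"
    using s.vf_adj_mult_self[OF \<eta>(2) s.one_mem] by (simp add: l_def)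
  \<comment> \<open>If \<open>T \<Omega>\<close> were 0, then \<open>est\<close> would make
    \<open>g\<close> vanish everywhere, against the choice of \<open>x0\<close>.\<close>
  have "l \<noteq> 0"
  proof
    assume "l = 0"
    define x where "x = adj x0"
    have x: "x \<in> B" "g (adj x) \<noteq> 0" using x0 by (auto simp: x_def adj_adj)
    have "cmod (g (adj x)) \<le> s.p x * s.p (\<eta> k) + \<epsilon> k * s.p x" for k
      using est[OF x(1), of k] s.Cauchy_Schwarz[OF x(1) \<eta>(1), of k]
        norm_triangle_ineq4[of "\<sigma> (adj x * \<eta> k)" "\<sigma> (adj x * \<eta> k) - g (adj x)"] by simp
    moreover have "(\<lambda>k. s.p x * s.p (\<eta> k) + \<epsilon> k * s.p x) \<longlonglongrightarrow> s.p x * 0 + 0 * s.p x"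
      using l \<open>l = 0\<close> \<eta>(3) by (intro tendsto_intros) auto
    ultimately have "cmod (g (adj x)) \<le> 0"
      using LIMSEQ_le_const[of "\<lambda>k. s.p x * s.p (\<eta> k) + \<epsilon> k * s.p x" 0 "cmod (g (adj x))"] by simp
    then show False using x by simp
  qed
  define c where "c = complex_of_real (1 / l)"
  have "s.vf (\<lambda>k. c *\<^sub>C \<eta> k) b = \<tau> b" if b: "b \<in> B" for b
    using s.vf_scale[OF \<eta>(2) b, of c] vf[OF b] \<open>l \<noteq> 0\<close> l0
    by (simp add: one c_def norm_divide power_divide)
  then have "(\<lambda>k. \<sigma> (adj (c *\<^sub>C \<eta> k) * (b * (c *\<^sub>C \<eta> k)))) \<longlonglongrightarrow> \<tau> b" if "b \<in> B" for b
    using s.vf_tendsto[OF s.cauchy_scaleC[OF \<eta>(2), of c] that] that by simp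
  then show ?thesis using that[of "\<lambda>k. c *\<^sub>C \<eta> k"] s.cauchy_scaleC[OF \<eta>(2), of c] by blast
qed

text \<open>The null sequence \<open>h\<close> may depend on \<open>e\<close>. This permits an
  approximating vector to be frozen at an index chosen from \<open>e\<close> before the limit in
  \<open>k\<close> is taken.\<close>

lemma tendsto_zero_if_eventually_le:
  fixes f :: "nat \<Rightarrow> complex"
  assumes "f \<longlonglongrightarrow> l" "\<And>e. e > 0 \<Longrightarrow> \<exists>h. h \<longlonglongrightarrow> 0 \<and> (\<forall>k. cmod (f k) \<le> h k + e * K)" "K \<ge> 0"
  shows "l = 0"
proof -
  have "cmod l \<le> e * K" if e: "e > 0" for e
  proof -
    obtain h where h: "h \<longlonglongrightarrow> 0" "\<And>k. cmod (f k) \<le> h k + e * K" using assms(2)[OF e] by blast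
    have "(\<lambda>k. h k + e * K) \<longlonglongrightarrow> 0 + e * K" by (intro tendsto_intros h)
    then show ?thesis using LIMSEQ_le[OF tendsto_norm[OF assms(1)]] h(2) by fastforce
  qed
  note le = this
  have "cmod l \<le> 0"
  proof (rule field_le_epsilon)
    fix e :: real assume e: "e > 0"
    have "cmod l \<le> e / (K + 1) * K" using e assms(3) by (intro le) simp
    also have "\<dots> \<le> e" using e assms(3) by (simp add: field_simps)
    finally show "cmod l \<le> 0 + e" by simp
  qed
  then show ?thesis by simp
qed

text \<open>If vectors \<open>v\<close> and \<open>w\<close> of the two GNS spaces (limits of \<open>V\<close> and \<open>W\<close>) define the same state
  \<open>\<nu>\<close>, the intertwiner is \<open>b v \<mapsto> b w\<close> after projecting onto the closure of \<open>B v\<close>. The projection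
  of the cyclic vector is the limit of \<open>\<beta>\<^sub>k v\<close>, with \<open>\<beta>\<close> from Riesz' lemma for \<open>\<nu>\<close>.\<close>

lemma common_vector_state_intertwiner:
  fixes B :: "'a::cstar_algebra set"
  assumes B: "cstar_subalgebra B" and \<sigma>: "state_on B \<sigma>" and \<tau>: "state_on B \<tau>"
    and V: "V \<in> gns_cauchy B \<sigma>" and W: "W \<in> gns_cauchy B \<tau>"
    and eq: "\<And>b. b \<in> B \<Longrightarrow> cstar_state.vf \<sigma> V b = cstar_state.vf \<tau> W b"
    and V1: "cstar_state.vf \<sigma> V 1 = 1"
  obtains g where "functional_on B g"
    "\<And>x y. x \<in> B \<Longrightarrow> y \<in> B \<Longrightarrow> cmod (g (adj x * y)) \<le> gns_seminorm \<tau> x * gns_seminorm \<sigma> y"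
    "\<exists>x\<in>B. g x \<noteq> 0"
proof -
  interpret s: cstar_state B \<sigma> using B \<sigma> by (rule cstar_stateI)
  interpret t: cstar_state B \<tau> using B \<tau> by (rule cstar_stateI)
  define \<nu> where "\<nu> = s.vf V"
  have \<nu>': "\<nu> b = t.vf W b" if "b \<in> B" for b using eq that by (simp add: \<nu>_def)
  interpret n: cstar_state B \<nu>
    unfolding \<nu>_def using V1 by (intro cstar_stateI B s.vf_state[OF V])
  note [simp] = s.cauchy_mem[OF V] t.cauchy_mem[OF W]
  have pV: "(\<lambda>n. s.p (b * V n)) \<longlonglongrightarrow> n.p b" if "b \<in> B" for b
    using s.seminorm_mult_tendsto[OF V that] s.vf_seminorm[OF V that] by (simp add: \<nu>_def)
  have pW: "(\<lambda>n. t.p (b * W n)) \<longlonglongrightarrow> n.p b" if "b \<in> B" for b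
  proof -
    have "n.p b = gns_seminorm (t.vf W) b"
      using that \<nu>' by (simp add: gns_seminorm_def)
    then show ?thesis
      using t.seminorm_mult_tendsto[OF W that] t.vf_seminorm[OF W that] by simp
  qed
  \<comment> \<open>\<open>r x\<close> is \<langle>\<Omega>, x v\<rangle> with the cyclic vector
    \<Omega> of \<sigma>; \<open>r'\<close> is its counterpart for \<tau> and
    \<open>w\<close>.\<close>
  define r where "r x = lim (\<lambda>n. \<sigma> (x * V n))" for x
  define r' where "r' x = lim (\<lambda>n. \<tau> (x * W n))" for x
  have r: "(\<lambda>n. \<sigma> (x * V n)) \<longlonglongrightarrow> r x" if "x \<in> B" for x
    using s.cauchy_inner_convergent[OF s.cauchy_const[of "adj x"] V] that
    unfolding r_def by (simp add: adj_adj convergent_LIMSEQ_iff)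
  have r': "(\<lambda>n. \<tau> (x * W n)) \<longlonglongrightarrow> r' x" if "x \<in> B" for x
    using t.cauchy_inner_convergent[OF t.cauchy_const[of "adj x"] W] that
    unfolding r'_def by (simp add: adj_adj convergent_LIMSEQ_iff)
  have r_fun: "functional_on B r"
    by (rule functional_on_limit[OF B _ r])
      (simp add: functional_on_def distrib_right scaleC_mult_left s.map_linear)
  interpret r: cstar_functional B r using r_fun by unfold_locales
  have "functional_on B r'"
    by (rule functional_on_limit[OF B _ r'])
      (simp add: functional_on_def distrib_right scaleC_mult_left t.map_linear)
  then interpret r': cstar_functional B r' by unfold_locales
  have r_bound: "cmod (r (adj x * y)) \<le> s.p x * n.p y" if xy: "x \<in> B" "y \<in> B" for x y
  proof (rule LIMSEQ_le[OF tendsto_norm[OF r]])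
    show "(\<lambda>n. s.p x * s.p (y * V n)) \<longlonglongrightarrow> s.p x * n.p y"
      using pV[OF xy(2)] by (intro tendsto_intros)
    show "\<exists>N. \<forall>n\<ge>N. cmod (\<sigma> (adj x * y * V n)) \<le> s.p x * s.p (y * V n)"
      using s.Cauchy_Schwarz[of x "y * V n" for n] xy by (simp add: mult.assoc)
  qed (use xy in auto)
  have r'_bound: "cmod (r' (adj x * y)) \<le> t.p x * n.p y" if xy: "x \<in> B" "y \<in> B" for x y
  proof (rule LIMSEQ_le[OF tendsto_norm[OF r']])
    show "(\<lambda>n. t.p x * t.p (y * W n)) \<longlonglongrightarrow> t.p x * n.p y"
      using pW[OF xy(2)] by (intro tendsto_intros)
    show "\<exists>N. \<forall>n\<ge>N. cmod (\<tau> (adj x * y * W n)) \<le> t.p x * t.p (y * W n)"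
      using t.Cauchy_Schwarz[of x "y * W n" for n] xy by (simp add: mult.assoc)
  qed (use xy in auto)
  have hb: "cmod (cnj (r x)) \<le> 1 * n.p x" if "x \<in> B" for x
    using r_bound[of 1 x] that by simp
  obtain \<beta> \<epsilon> where \<beta>: "\<And>k. \<beta> k \<in> B" "\<beta> \<in> gns_cauchy B \<nu>" "\<epsilon> \<longlonglongrightarrow> 0"
    and est: "\<And>k x. x \<in> B \<Longrightarrow> cmod (\<nu> (adj x * \<beta> k) - cnj (r x)) \<le> \<epsilon> k * n.p x"
    by (rule n.Riesz[of B "\<lambda>x. cnj (r x)" 1]) (use hb in \<open>auto simp: r.map_linear\<close>)
  have seminorm_le: "lim (\<lambda>k. n.p (x * \<beta> k)) \<le> s.p x" if x: "x \<in> B" for x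
  proof (rule n.Riesz_seminorm_le[where h = "\<lambda>x. cnj (r x)", OF \<beta>(1) \<beta>(3) x])
    show "cmod (cnj (r (adj x * (x * \<beta> k)))) \<le> s.p x * n.p (x * \<beta> k)" for k
      using r_bound[of x "x * \<beta> k"] x \<beta>(1) by simp
    show "(\<lambda>k. n.p (x * \<beta> k)) \<longlonglongrightarrow> lim (\<lambda>k. n.p (x * \<beta> k))"
      by (rule n.seminorm_mult_tendsto[OF \<beta>(2) x])
  qed (use x \<beta>(1) est in auto)
  \<comment> \<open>Since \<open>v\<close> and \<open>w\<close> have the same vector functional, the
    image of the projected cyclic vector is the limit of \<open>\<beta> k\<close> applied to
    \<open>w\<close>; \<open>g x\<close> pairs \<open>x\<close> times that image with the cyclic
    vector of \<tau>.\<close>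
  define g where "g x = lim (\<lambda>k. r' (x * \<beta> k))" for x
  have g: "(\<lambda>k. r' (x * \<beta> k)) \<longlonglongrightarrow> g x" if x: "x \<in> B" for x
  proof -
    have "Cauchy (\<lambda>k. r' (x * \<beta> k))"
    proof (rule CauchyI)
      fix e :: real assume e: "e > 0"
      define K where "K = t.p (adj x) + 1"
      have K: "K > 0" "t.p (adj x) \<le> K" using t.seminorm_nonneg[OF s.adj_mem[OF x]] unfolding K_def by linarith+
      have "e / K > 0" using e K by simp
      then obtain N where N: "\<And>m n. m \<ge> N \<Longrightarrow> n \<ge> N \<Longrightarrow> n.p (\<beta> m - \<beta> n) < e / K"
        using n.cauchyD[OF \<beta>(2)] by metis
      have "norm (r' (x * \<beta> m) - r' (x * \<beta> n)) < e" if "m \<ge> N" "n \<ge> N" for m n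
      proof -
        have "r' (x * \<beta> m) - r' (x * \<beta> n) = r' (adj (adj x) * (\<beta> m - \<beta> n))"
          using x \<beta>(1) by (simp add: adj_adj right_diff_distrib r'.map_diff)
        then have "norm (r' (x * \<beta> m) - r' (x * \<beta> n)) \<le> t.p (adj x) * n.p (\<beta> m - \<beta> n)"
          using r'_bound[of "adj x" "\<beta> m - \<beta> n"] x \<beta>(1) by simp
        also have "\<dots> \<le> K * n.p (\<beta> m - \<beta> n)" using K \<beta>(1) by (intro mult_right_mono) auto
        also have "\<dots> < e" using N[OF that] K by (simp add: field_simps)
        finally show ?thesis .
      qed
      then show "\<exists>M. \<forall>m\<ge>M. \<forall>n\<ge>M. norm (r' (x * \<beta> m) - r' (x * \<beta> n)) < e" by blast
    qed
    then show ?thesis unfolding g_def by (simp add: Cauchy_convergent_iff convergent_LIMSEQ_iff)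
  qed
  have "functional_on B g"
    by (rule functional_on_limit[OF B _ g])
      (use \<beta>(1) in \<open>simp add: functional_on_def distrib_right scaleC_mult_left r'.map_linear\<close>)
  moreover have "cmod (g (adj x * y)) \<le> t.p x * s.p y" if xy: "x \<in> B" "y \<in> B" for x y
  proof -
    have "cmod (g (adj x * y)) \<le> t.p x * lim (\<lambda>k. n.p (y * \<beta> k))"
    proof (rule LIMSEQ_le[OF tendsto_norm[OF g]])
      show "(\<lambda>k. t.p x * n.p (y * \<beta> k)) \<longlonglongrightarrow> t.p x * lim (\<lambda>k. n.p (y * \<beta> k))"
        by (intro tendsto_intros n.seminorm_mult_tendsto \<beta>(2) xy)
      show "\<exists>N. \<forall>k\<ge>N. cmod (r' (adj x * y * \<beta> k)) \<le> t.p x * n.p (y * \<beta> k)"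
        using r'_bound[of x "y * \<beta> k" for k] xy \<beta>(1) by (simp add: mult.assoc)
    qed (use xy in auto)
    also have "\<dots> \<le> t.p x * s.p y" using seminorm_le xy by (intro mult_left_mono) auto
    finally show ?thesis .
  qed
  moreover have "\<exists>x\<in>B. g x \<noteq> 0"
  proof (rule ccontr)
    assume "\<not> ?thesis"
    then have g0: "g x = 0" if "x \<in> B" for x using that by blast
    obtain L where L: "L > 0" "\<And>k. n.p (\<beta> k) \<le> L" using n.cauchy_bounded[OF \<beta>(2)] by metis
    \<comment> \<open>\<open>\<nu> (adj x * \<beta> k)\<close> is \<langle>x w, \<beta> k
      w\<rangle>. Replacing the left \<open>w\<close> by the algebra element \<open>W N\<close>
      gives \<open>r' (adj (x * W N) * \<beta> k)\<close>, which tends to a value of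
      \<open>g\<close>, hence to 0.\<close>
    have "cnj (r x) = 0" if x: "x \<in> B" for x
    proof (rule tendsto_zero_if_eventually_le)
      show "(\<lambda>k. \<nu> (adj x * \<beta> k)) \<longlonglongrightarrow> cnj (r x)"
      proof -
        have "(\<lambda>k. \<nu> (adj x * \<beta> k) - cnj (r x)) \<longlonglongrightarrow> 0"
        proof (rule Lim_null_comparison)
          show "\<forall>\<^sub>F k in sequentially. norm (\<nu> (adj x * \<beta> k) - cnj (r x)) \<le> \<epsilon> k * n.p x"
            using est[OF x] by simp
          show "(\<lambda>k. \<epsilon> k * n.p x) \<longlonglongrightarrow> 0" using tendsto_mult_left_zero[OF \<beta>(3)] .
        qed
        then show ?thesis by (simp add: LIM_zero_iff)
      qed
      show "norm x * L \<ge> 0" using L by simp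
      fix e :: real assume e: "e > 0"
      obtain N where N: "\<And>m n. m \<ge> N \<Longrightarrow> n \<ge> N \<Longrightarrow> t.p (W m - W n) < e"
        using t.cauchyD[OF W e] by metis
      define h where "h k = cmod (r' (adj (x * W N) * \<beta> k))" for k
      have "h \<longlonglongrightarrow> 0"
        unfolding h_def using tendsto_norm[OF g[of "adj (x * W N)"]] g0[of "adj (x * W N)"] x by simp
      moreover have "cmod (\<nu> (adj x * \<beta> k)) \<le> h k + e * (norm x * L)" for k
      proof -
        have lim1: "(\<lambda>m. \<tau> (adj (x * W m) * (\<beta> k * W m))) \<longlonglongrightarrow> \<nu> (adj x * \<beta> k)"
          using t.vf_tendsto[OF W, of "adj x * \<beta> k"] x \<beta>(1) \<nu>' by (simp add: adj_mult mult.assoc)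
        have lim2: "(\<lambda>m. \<tau> (adj (x * W N) * (\<beta> k * W m))) \<longlonglongrightarrow> r' (adj (x * W N) * \<beta> k)"
          using r'[of "adj (x * W N) * \<beta> k"] x \<beta>(1) by (simp add: mult.assoc)
        have lim3: "(\<lambda>m. norm x * e * t.p (\<beta> k * W m)) \<longlonglongrightarrow> norm x * e * n.p (\<beta> k)"
          by (intro tendsto_intros pW \<beta>(1))
        have "cmod (\<nu> (adj x * \<beta> k) - r' (adj (x * W N) * \<beta> k)) \<le> norm x * e * n.p (\<beta> k)"
        proof (rule LIMSEQ_le[OF tendsto_norm[OF tendsto_diff[OF lim1 lim2]] lim3])
          have "cmod (\<tau> (adj (x * W m) * (\<beta> k * W m)) - \<tau> (adj (x * W N) * (\<beta> k * W m)))
              \<le> norm x * e * t.p (\<beta> k * W m)" if "m \<ge> N" for m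
          proof -
            have "\<tau> (adj (x * W m) * (\<beta> k * W m)) - \<tau> (adj (x * W N) * (\<beta> k * W m)) =
                \<tau> (adj (x * (W m - W N)) * (\<beta> k * W m))"
              using x \<beta>(1) by (simp add: right_diff_distrib left_diff_distrib adj_diff t.map_diff)
            also have "cmod \<dots> \<le> t.p (x * (W m - W N)) * t.p (\<beta> k * W m)"
              using x \<beta>(1) by (intro t.Cauchy_Schwarz) auto
            also have "t.p (x * (W m - W N)) \<le> norm x * t.p (W m - W N)"
              using x by (intro t.seminorm_mult_left) auto
            also have "\<dots> \<le> norm x * e"
              using N[OF that order_refl] by (intro mult_left_mono) auto
            finally show ?thesis using \<beta>(1) by (simp add: mult_right_mono)
          qed
          then show "\<exists>M. \<forall>m\<ge>M. cmod (\<tau> (adj (x * W m) * (\<beta> k * W m)) - \<tau> (adj (x * W N) * (\<beta> k * W m)))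
              \<le> norm x * e * t.p (\<beta> k * W m)" by blast
        qed
        also have "\<dots> \<le> norm x * e * L" using L(2) e by (intro mult_left_mono) auto
        finally show ?thesis
          unfolding h_def using norm_triangle_ineq2[of "\<nu> (adj x * \<beta> k)" "r' (adj (x * W N) * \<beta> k)"]
          by (simp add: mult_ac)
      qed
      ultimately show "\<exists>h. h \<longlonglongrightarrow> 0 \<and> (\<forall>k. cmod (\<nu> (adj x * \<beta> k)) \<le> h k + e * (norm x * L))" by blast
    qed
    then have r0: "r x = 0" if "x \<in> B" for x using that by simp
    \<comment> \<open>\<open>r = 0\<close> makes \<open>v\<close> orthogonal to the orbit of the
      cyclic vector, which is dense. Concretely, an algebra element \<open>V N\<close> within 1/2 of
      \<open>v\<close> is orthogonal to \<open>v\<close>, which contradicts \<parallel>v\<parallel>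
      = 1.\<close>
    have one: "(\<lambda>m. s.p (V m)) \<longlonglongrightarrow> 1" using pV[of 1] by simp
    obtain N where N: "\<And>m n. m \<ge> N \<Longrightarrow> n \<ge> N \<Longrightarrow> s.p (V m - V n) < 1/2"
      using s.cauchyD[OF V, of "1/2"] by auto
    have lim1: "(\<lambda>m. \<sigma> (adj (V N) * V m)) \<longlonglongrightarrow> 0" using r[of "adj (V N)"] r0 by simp
    have lim2: "(\<lambda>m. cmod (\<sigma> (adj (V N) * V m)) + 1/2 * s.p (V m)) \<longlonglongrightarrow> cmod 0 + 1/2 * 1"
      by (intro tendsto_intros lim1 one)
    have "1\<^sup>2 \<le> cmod 0 + 1/2 * (1::real)"
    proof (rule LIMSEQ_le[OF tendsto_power[OF one] lim2])
      have "(s.p (V m))\<^sup>2 \<le> cmod (\<sigma> (adj (V N) * V m)) + 1/2 * s.p (V m)" if "m \<ge> N" for m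
      proof -
        have "(s.p (V m))\<^sup>2 = cmod (\<sigma> (adj (V N) * V m) + \<sigma> (adj (V m - V N) * V m))"
          by (simp add: adj_diff left_diff_distrib s.map_diff s.map_adj_mult_self norm_power)
        also have "\<dots> \<le> cmod (\<sigma> (adj (V N) * V m)) + s.p (V m - V N) * s.p (V m)"
          using s.Cauchy_Schwarz[of "V m - V N" "V m"] norm_triangle_le by fastforce
        also have "s.p (V m - V N) * s.p (V m) \<le> 1/2 * s.p (V m)"
          using N[OF that order_refl] by (intro mult_right_mono) auto
        finally show ?thesis by simp
      qed
      then show "\<exists>M. \<forall>m\<ge>M. (s.p (V m))\<^sup>2 \<le> cmod (\<sigma> (adj (V N) * V m)) + 1/2 * s.p (V m)"
        by blast
    qed
    then show False by simp
  qed
  ultimately show ?thesis using that by blast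
qed

section \<open>The GNS representation\<close>

context cstar_state
begin

definition cls :: "(nat \<Rightarrow> 'a) \<Rightarrow> (nat \<Rightarrow> 'a) set" where
  "cls X = gns_rel B \<phi> `` {X}"

lemma gns_rel_iff:
  "(X, Y) \<in> gns_rel B \<phi> \<longleftrightarrow>
    X \<in> gns_cauchy B \<phi> \<and> Y \<in> gns_cauchy B \<phi> \<and> (\<lambda>n. p (X n - Y n)) \<longlonglongrightarrow> 0"
  by (simp add: gns_rel_def)

lemma null_seminormI:
  assumes "\<And>n. X n \<in> B" "\<And>n. p (X n) \<le> f n" "f \<longlonglongrightarrow> 0"
  shows "(\<lambda>n. p (X n)) \<longlonglongrightarrow> 0"
  by (rule Lim_null_comparison[OF _ assms(3)]) (use assms(1,2) in simp)

lemma gns_rel_add: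
  assumes "(X, X') \<in> gns_rel B \<phi>" "(Y, Y') \<in> gns_rel B \<phi>"
  shows "(\<lambda>n. X n + Y n, \<lambda>n. X' n + Y' n) \<in> gns_rel B \<phi>"
proof -
  have mem: "X n \<in> B" "X' n \<in> B" "Y n \<in> B" "Y' n \<in> B" for n
    using assms cauchy_mem unfolding gns_rel_iff by blast+
  have "(\<lambda>n. p ((X n + Y n) - (X' n + Y' n))) \<longlonglongrightarrow> 0"
  proof (rule null_seminormI)
    show "p ((X n + Y n) - (X' n + Y' n)) \<le> p (X n - X' n) + p (Y n - Y' n)" for n
      using seminorm_triangle[of "X n - X' n" "Y n - Y' n"] mem by (simp add: algebra_simps)
    show "(\<lambda>n. p (X n - X' n) + p (Y n - Y' n)) \<longlonglongrightarrow> 0"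
      using tendsto_add[of _ 0 _ _ 0] assms unfolding gns_rel_iff by fastforce
  qed (use mem in auto)
  then show ?thesis using assms cauchy_add unfolding gns_rel_iff by blast
qed

lemma gns_rel_mult_left:
  assumes "(X, X') \<in> gns_rel B \<phi>" and b: "b \<in> B"
  shows "(\<lambda>n. b * X n, \<lambda>n. b * X' n) \<in> gns_rel B \<phi>"
proof -
  have mem: "X n \<in> B" "X' n \<in> B" for n
    using assms cauchy_mem unfolding gns_rel_iff by blast+
  have "(\<lambda>n. p (b * X n - b * X' n)) \<longlonglongrightarrow> 0"
  proof (rule null_seminormI)
    show "p (b * X n - b * X' n) \<le> norm b * p (X n - X' n)" for n
      using seminorm_mult_left[of b "X n - X' n"] mem b by (simp add: algebra_simps)
    show "(\<lambda>n. norm b * p (X n - X' n)) \<longlonglongrightarrow> 0"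
      using tendsto_mult_right_zero assms unfolding gns_rel_iff by blast
  qed (use mem b in auto)
  then show ?thesis using assms cauchy_mult_left unfolding gns_rel_iff by blast
qed

lemma gns_rel_scaleC:
  assumes "(X, X') \<in> gns_rel B \<phi>"
  shows "(\<lambda>n. c *\<^sub>C X n, \<lambda>n. c *\<^sub>C X' n) \<in> gns_rel B \<phi>"
  using gns_rel_mult_left[OF assms, of "c *\<^sub>C 1"] by (simp add: scaleC_mult_left)

lemma equiv_gns_rel: "equiv (gns_cauchy B \<phi>) (gns_rel B \<phi>)"
proof (rule equivI)
  show "gns_rel B \<phi> \<subseteq> gns_cauchy B \<phi> \<times> gns_cauchy B \<phi>" by (auto simp: gns_rel_iff)
  show "refl_on (gns_cauchy B \<phi>) (gns_rel B \<phi>)" by (simp add: refl_on_def gns_rel_iff)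
  show "sym (gns_rel B \<phi>)"
  proof (rule symI)
    fix X Y assume XY: "(X, Y) \<in> gns_rel B \<phi>"
    then have "p (Y n - X n) = p (X n - Y n)" for n
      using cauchy_mem unfolding gns_rel_iff by (intro seminorm_minus_commute) blast+
    then show "(Y, X) \<in> gns_rel B \<phi>" using XY by (simp add: gns_rel_iff)
  qed
  show "trans (gns_rel B \<phi>)"
  proof (rule transI)
    fix X Y Z assume XY: "(X, Y) \<in> gns_rel B \<phi>" and YZ: "(Y, Z) \<in> gns_rel B \<phi>"
    have mem: "X n \<in> B" "Y n \<in> B" "Z n \<in> B" for n
      using XY YZ cauchy_mem unfolding gns_rel_iff by blast+
    have "(\<lambda>n. p (X n - Z n)) \<longlonglongrightarrow> 0"
    proof (rule null_seminormI)
      show "p (X n - Z n) \<le> p (X n - Y n) + p (Y n - Z n)" for n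
        using mem by (intro seminorm_diff_triangle)
      show "(\<lambda>n. p (X n - Y n) + p (Y n - Z n)) \<longlonglongrightarrow> 0"
        using tendsto_add[of _ 0 _ _ 0] XY YZ unfolding gns_rel_iff by fastforce
    qed (use mem in auto)
    then show "(X, Z) \<in> gns_rel B \<phi>" using XY YZ unfolding gns_rel_iff by blast
  qed
qed

lemma mem_cls: "Y \<in> cls X \<longleftrightarrow> (X, Y) \<in> gns_rel B \<phi>"
  by (simp add: cls_def)

lemma cls_self: "X \<in> gns_cauchy B \<phi> \<Longrightarrow> X \<in> cls X"
  by (simp add: mem_cls gns_rel_iff)

lemma cls_eqI: "(X, Y) \<in> gns_rel B \<phi> \<Longrightarrow> cls X = cls Y"
  unfolding cls_def by (rule equiv_class_eq[OF equiv_gns_rel])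

lemma cls_eqD: "cls X = cls Y \<Longrightarrow> Y \<in> gns_cauchy B \<phi> \<Longrightarrow> (X, Y) \<in> gns_rel B \<phi>"
  using cls_self[of Y] mem_cls by blast

lemma vecs_gns: "vecs (gns B \<phi>) = cls ` gns_cauchy B \<phi>"
  by (auto simp: gns_def quotient_def cls_def)

lemma vzero_gns: "vzero (gns B \<phi>) = cls (\<lambda>n. 0)"
  by (simp add: gns_def cls_def)

text \<open>The operations of \<open>gns\<close> are unions over representatives; once independence
  of the representative is known, the family is constant and the union collapses.\<close>

lemma UN_cls:
  assumes "X \<in> gns_cauchy B \<phi>" "\<And>X'. X' \<in> cls X \<Longrightarrow> f X' = c"
  shows "(\<Union>X'\<in>cls X. f X') = c"
  using cls_self[OF assms(1)] assms(2) by auto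

lemma vadd_gns:
  assumes X: "X \<in> gns_cauchy B \<phi>" and Y: "Y \<in> gns_cauchy B \<phi>"
  shows "vadd (gns B \<phi>) (cls X) (cls Y) = cls (\<lambda>n. X n + Y n)"
proof -
  have eq: "cls (\<lambda>n. X' n + Y' n) = cls (\<lambda>n. X n + Y n)" if "X' \<in> cls X" "Y' \<in> cls Y" for X' Y'
    using cls_eqI[OF gns_rel_add] that by (simp add: mem_cls)
  have "vadd (gns B \<phi>) (cls X) (cls Y) = (\<Union>X'\<in>cls X. \<Union>Y'\<in>cls Y. cls (\<lambda>n. X' n + Y' n))"
    by (simp add: gns_def cls_def)
  also have "\<dots> = cls (\<lambda>n. X n + Y n)" using eq by (intro UN_cls X Y)
  finally show ?thesis .
qed

lemma vscale_gns:
  assumes X: "X \<in> gns_cauchy B \<phi>"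
  shows "vscale (gns B \<phi>) c (cls X) = cls (\<lambda>n. c *\<^sub>C X n)"
proof -
  have eq: "cls (\<lambda>n. c *\<^sub>C X' n) = cls (\<lambda>n. c *\<^sub>C X n)" if "X' \<in> cls X" for X'
    using cls_eqI[OF gns_rel_scaleC] that by (simp add: mem_cls)
  have "vscale (gns B \<phi>) c (cls X) = (\<Union>X'\<in>cls X. cls (\<lambda>n. c *\<^sub>C X' n))"
    by (simp add: gns_def cls_def)
  also have "\<dots> = cls (\<lambda>n. c *\<^sub>C X n)" using eq by (intro UN_cls X)
  finally show ?thesis .
qed

lemma act_gns:
  assumes X: "X \<in> gns_cauchy B \<phi>" and b: "b \<in> B"
  shows "act (gns B \<phi>) b (cls X) = cls (\<lambda>n. b * X n)"
proof -
  have eq: "cls (\<lambda>n. b * X' n) = cls (\<lambda>n. b * X n)" if "X' \<in> cls X" for X'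
    using cls_eqI[OF gns_rel_mult_left] that b by (simp add: mem_cls)
  have "act (gns B \<phi>) b (cls X) = (\<Union>X'\<in>cls X. cls (\<lambda>n. b * X' n))"
    by (simp add: gns_def cls_def)
  also have "\<dots> = cls (\<lambda>n. b * X n)" using eq by (intro UN_cls X)
  finally show ?thesis .
qed

lemma inner_tendsto:
  assumes X: "X \<in> gns_cauchy B \<phi>" and Y: "Y \<in> gns_cauchy B \<phi>"
  shows "(\<lambda>n. \<phi> (adj (X n) * Y n)) \<longlonglongrightarrow> lim (\<lambda>n. \<phi> (adj (X n) * Y n))"
  using cauchy_inner_convergent[OF assms] by (simp add: convergent_LIMSEQ_iff)

lemma vinner_gns:
  assumes X: "X \<in> gns_cauchy B \<phi>" and Y: "Y \<in> gns_cauchy B \<phi>"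
  shows "vinner (gns B \<phi>) (cls X) (cls Y) = lim (\<lambda>n. \<phi> (adj (X n) * Y n))"
proof -
  have eq: "lim (\<lambda>n. \<phi> (adj (X' n) * Y' n)) = lim (\<lambda>n. \<phi> (adj (X n) * Y n))"
    if X': "X' \<in> cls X" and Y': "Y' \<in> cls Y" for X' Y'
  proof -
    have C: "X' \<in> gns_cauchy B \<phi>" "Y' \<in> gns_cauchy B \<phi>" and
      l: "(\<lambda>n. p (X n - X' n)) \<longlonglongrightarrow> 0" "(\<lambda>n. p (Y n - Y' n)) \<longlonglongrightarrow> 0"
      using X' Y' by (auto simp: mem_cls gns_rel_iff)
    obtain K L where K: "K > 0" "\<And>n. p (X' n) \<le> K" and L: "L > 0" "\<And>n. p (Y n) \<le> L"
      using cauchy_bounded[OF C(1)] cauchy_bounded[OF Y] by metis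
    note mem = cauchy_mem[OF X] cauchy_mem[OF Y] cauchy_mem[OF C(1)] cauchy_mem[OF C(2)]
    have "(\<lambda>n. \<phi> (adj (X n) * Y n) - \<phi> (adj (X' n) * Y' n)) \<longlonglongrightarrow> 0"
    proof (rule Lim_null_comparison)
      have "norm (\<phi> (adj (X n) * Y n) - \<phi> (adj (X' n) * Y' n)) \<le>
          p (X n - X' n) * L + K * p (Y n - Y' n)" for n
        using order_trans[OF inner_diff_bound[OF mem(1) mem(2) mem(3) mem(4), of n n n n]
            add_mono[OF mult_left_mono[OF L(2)] mult_right_mono[OF K(2)]]] mem by simp
      then show "\<forall>\<^sub>F n in sequentially. norm (\<phi> (adj (X n) * Y n) - \<phi> (adj (X' n) * Y' n)) \<le>
          p (X n - X' n) * L + K * p (Y n - Y' n)" by simp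
      show "(\<lambda>n. p (X n - X' n) * L + K * p (Y n - Y' n)) \<longlonglongrightarrow> 0"
        using tendsto_add[OF tendsto_mult_right[OF l(1), of L] tendsto_mult_left[OF l(2), of K]] by simp
    qed
    then have "(\<lambda>n. \<phi> (adj (X n) * Y n) - (\<phi> (adj (X n) * Y n) - \<phi> (adj (X' n) * Y' n)))
        \<longlonglongrightarrow> lim (\<lambda>n. \<phi> (adj (X n) * Y n)) - 0"
      by (rule tendsto_diff[OF inner_tendsto[OF X Y]])
    then have "(\<lambda>n. \<phi> (adj (X' n) * Y' n)) \<longlonglongrightarrow> lim (\<lambda>n. \<phi> (adj (X n) * Y n))" by simp
    from LIMSEQ_unique[OF inner_tendsto[OF C] this] show ?thesis .
  qed
  have "(\<Union>X'\<in>cls X. \<Union>Y'\<in>cls Y. {lim (\<lambda>n. \<phi> (adj (X' n) * Y' n))}) = {lim (\<lambda>n. \<phi> (adj (X n) * Y n))}"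
    using eq by (intro UN_cls X Y) simp
  then show ?thesis by (simp add: gns_def)
qed

lemma seminorm_tendsto:
  assumes X: "X \<in> gns_cauchy B \<phi>"
  shows "(\<lambda>n. p (X n)) \<longlonglongrightarrow> lim (\<lambda>n. p (X n))"
  using cauchy_seminorm_convergent[OF X] by (simp add: convergent_LIMSEQ_iff)

lemma vdist_gns:
  assumes X: "X \<in> gns_cauchy B \<phi>" and Y: "Y \<in> gns_cauchy B \<phi>"
  shows "(\<lambda>n. p (X n - Y n)) \<longlonglongrightarrow> vdist (gns B \<phi>) (cls X) (cls Y)"
proof -
  define Z where "Z n = X n + (- 1) *\<^sub>C Y n" for n
  have Z: "Z \<in> gns_cauchy B \<phi>" unfolding Z_def using X Y by (intro cauchy_add cauchy_scaleC)
  have "vdist (gns B \<phi>) (cls X) (cls Y) = sqrt (Re (lim (\<lambda>n. \<phi> (adj (Z n) * Z n))))"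
    unfolding vdist_def Let_def vscale_gns[OF Y] vadd_gns[OF X cauchy_scaleC[OF Y]]
      vinner_gns[OF Z Z, unfolded Z_def] by (simp add: Z_def)
  moreover have "(\<lambda>n. sqrt (Re (\<phi> (adj (Z n) * Z n)))) \<longlonglongrightarrow> sqrt (Re (lim (\<lambda>n. \<phi> (adj (Z n) * Z n))))"
    by (intro tendsto_intros inner_tendsto Z)
  moreover have "p (X n - Y n) = sqrt (Re (\<phi> (adj (Z n) * Z n)))" for n
    by (simp add: gns_seminorm_def Z_def)
  ultimately show ?thesis by simp
qed

end

text \<open>A unitary intertwiner sends a vector to one with the same vector functional. A vector
  other than \<open>vzero\<close> has positive norm \<open>l\<close>, and scaling both vectors by
  \<open>1 / l\<close> normalises them and keeps the functionals equal.\<close>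

lemma common_vector_state:
  assumes B: "cstar_subalgebra B" and \<sigma>: "state_on B \<sigma>" and \<tau>: "state_on B \<tau>"
    and nd: "\<not> disjoint_reps B (gns B \<sigma>) (gns B \<tau>)"
  obtains V W where "V \<in> gns_cauchy B \<sigma>" "W \<in> gns_cauchy B \<tau>"
    "\<And>b. b \<in> B \<Longrightarrow> cstar_state.vf \<sigma> V b = cstar_state.vf \<tau> W b" "cstar_state.vf \<sigma> V 1 = 1"
proof -
  interpret s: cstar_state B \<sigma> using B \<sigma> by (rule cstar_stateI)
  interpret t: cstar_state B \<tau> using B \<tau> by (rule cstar_stateI)
  obtain K L U where K: "closed_subspace (gns B \<sigma>) K" "K \<noteq> {vzero (gns B \<sigma>)}"
      "\<And>b u. b \<in> B \<Longrightarrow> u \<in> K \<Longrightarrow> act (gns B \<sigma>) b u \<in> K"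
    and L: "closed_subspace (gns B \<tau>) L"
    and U: "bij_betw U K L"
      "\<And>u v. u \<in> K \<Longrightarrow> v \<in> K \<Longrightarrow> vinner (gns B \<tau>) (U u) (U v) = vinner (gns B \<sigma>) u v"
      "\<And>b u. b \<in> B \<Longrightarrow> u \<in> K \<Longrightarrow> U (act (gns B \<sigma>) b u) = act (gns B \<tau>) b (U u)"
  proof -
    obtain R' S' where RS: "nonzero_subrep B (gns B \<sigma>) R'" "nonzero_subrep B (gns B \<tau>) S'"
      "unitarily_equivalent B R' S'"
      using nd unfolding disjoint_reps_def by blast
    obtain K where K: "closed_subspace (gns B \<sigma>) K" "\<forall>b\<in>B. \<forall>u\<in>K. act (gns B \<sigma>) b u \<in> K"
      "K \<noteq> {vzero (gns B \<sigma>)}" "R' = gns B \<sigma>\<lparr>vecs := K\<rparr>"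
      using RS(1) unfolding nonzero_subrep_def by blast
    obtain L where L: "closed_subspace (gns B \<tau>) L" "S' = gns B \<tau>\<lparr>vecs := L\<rparr>"
      using RS(2) unfolding nonzero_subrep_def by blast
    obtain U where "bij_betw U K L"
      "\<forall>u\<in>K. \<forall>v\<in>K. vinner (gns B \<tau>) (U u) (U v) = vinner (gns B \<sigma>) u v"
      "\<forall>b\<in>B. \<forall>u\<in>K. U (act (gns B \<sigma>) b u) = act (gns B \<tau>) b (U u)"
      using RS(3) unfolding unitarily_equivalent_def K(4) L(2) by auto
    then show thesis using K L by (intro that[of K L U]) simp_all
  qed
  obtain v where v: "v \<in> K" "v \<noteq> vzero (gns B \<sigma>)"
    using K(1,2) unfolding closed_subspace_def by blast
  obtain V where V: "V \<in> gns_cauchy B \<sigma>" "v = s.cls V"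
    using v(1) K(1) unfolding closed_subspace_def s.vecs_gns by blast
  have "U v \<in> L" using U(1) v(1) by (auto simp: bij_betw_def)
  then obtain W where W: "W \<in> gns_cauchy B \<tau>" "U v = t.cls W"
    using L unfolding closed_subspace_def t.vecs_gns by blast
  have eq: "s.vf V b = t.vf W b" if b: "b \<in> B" for b
  proof -
    have "t.vf W b = vinner (gns B \<tau>) (U v) (act (gns B \<tau>) b (U v))"
      using t.vinner_gns[OF W(1) t.cauchy_mult_left[OF W(1) b]] t.act_gns[OF W(1) b] W(2)
      by (simp add: t.vf_def)
    also have "\<dots> = vinner (gns B \<sigma>) v (act (gns B \<sigma>) b v)"
      using U(2)[OF v(1) K(3)[OF b v(1)]] U(3)[OF b v(1)] by simp
    also have "\<dots> = s.vf V b"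
      using s.vinner_gns[OF V(1) s.cauchy_mult_left[OF V(1) b]] s.act_gns[OF V(1) b] V(2)
      by (simp add: s.vf_def)
    finally show ?thesis by simp
  qed
  define l where "l = lim (\<lambda>n. s.p (1 * V n))"
  have l: "(\<lambda>n. s.p (V n)) \<longlonglongrightarrow> l"
    using s.seminorm_mult_tendsto[OF V(1) s.one_mem] by (simp add: l_def)
  have "l \<noteq> 0"
  proof
    assume "l = 0"
    then have "(V, \<lambda>n. 0) \<in> gns_rel B \<sigma>"
      using l V(1) s.cauchy_const[of 0] by (simp add: s.gns_rel_iff)
    then show False using v(2) V(2) s.cls_eqI by (simp add: s.vzero_gns)
  qed
  moreover have "0 \<le> l" unfolding l_def by (rule s.lim_seminorm_nonneg[OF V(1) s.one_mem])
  moreover have "s.vf V 1 = complex_of_real (l\<^sup>2)"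
    using s.vf_adj_mult_self[OF V(1) s.one_mem] by (simp add: l_def)
  ultimately have one: "s.vf (\<lambda>n. complex_of_real (1 / l) *\<^sub>C V n) 1 = 1"
    using s.vf_scale[OF V(1) s.one_mem, of "complex_of_real (1 / l)"]
    by (simp add: norm_divide power_divide)
  have "s.vf (\<lambda>n. complex_of_real (1 / l) *\<^sub>C V n) b = t.vf (\<lambda>n. complex_of_real (1 / l) *\<^sub>C W n) b"
    if b: "b \<in> B" for b
    using s.vf_scale[OF V(1) b] t.vf_scale[OF W(1) b] eq[OF b] by simp
  from that[OF s.cauchy_scaleC[OF V(1)] t.cauchy_scaleC[OF W(1)] this one] show ?thesis .
qed

text \<open>The intertwiner built from a common vector state is a contraction, so it is enough to
  exclude functionals with constant 1.\<close>

lemma disjoint_reps_if_no_intertwiner: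
  assumes "cstar_subalgebra B" "state_on B \<sigma>" "state_on B \<tau>"
    and "\<And>g x. functional_on B g \<Longrightarrow>
      (\<And>x y. x \<in> B \<Longrightarrow> y \<in> B \<Longrightarrow> cmod (g (adj x * y)) \<le> gns_seminorm \<tau> x * gns_seminorm \<sigma> y) \<Longrightarrow>
      x \<in> B \<Longrightarrow> g x = 0"
  shows "disjoint_reps B (gns B \<sigma>) (gns B \<tau>)"
proof (rule ccontr)
  assume "\<not> ?thesis"
  from common_vector_state[OF assms(1-3) this] obtain V W where
    VW: "V \<in> gns_cauchy B \<sigma>" "W \<in> gns_cauchy B \<tau>"
    "\<And>b. b \<in> B \<Longrightarrow> cstar_state.vf \<sigma> V b = cstar_state.vf \<tau> W b" "cstar_state.vf \<sigma> V 1 = 1"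
    by metis
  show False
    using common_vector_state_intertwiner[OF assms(1-3) VW] assms(4) by metis
qed

text \<open>With \<open>v\<close> the class of \<open>\<eta>\<close>, the map x \<Omega> \<mapsto> x
  v preserves norms by \<open>\<tau>_lim\<close> and extends to an isometry T between the GNS
  spaces. For a fixed \<open>x\<close> the image is already a sequence, \<open>x * \<eta> k\<close>,
  so the image of a Cauchy sequence \<open>X\<close> needs a diagonal choice; this is controlled by
  distances.\<close>

locale vector_state = s: cstar_state B \<sigma> + t: cstar_state B \<tau>
  for B :: "'a::cstar_algebra set" and \<sigma> \<tau> +
  fixes \<eta> :: "nat \<Rightarrow> 'a"
  assumes \<eta>: "\<eta> \<in> gns_cauchy B \<sigma>"
    and \<tau>_lim: "b \<in> B \<Longrightarrow> (\<lambda>k. \<sigma> (adj (\<eta> k) * (b * \<eta> k))) \<longlonglongrightarrow> \<tau> b"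
begin

text \<open>In the GNS space of \<open>\<sigma>\<close>, \<open>D y x\<close> is the distance of \<open>y\<close> from \<open>x \<eta>\<close>.\<close>

definition D :: "'a \<Rightarrow> 'a \<Rightarrow> real" where
  "D y x = lim (\<lambda>k. s.p (y - x * \<eta> k))"

lemma \<eta>_mem [simp]: "\<eta> k \<in> B"
  using s.cauchy_mem[OF \<eta>] .

lemma D_tendsto:
  assumes "y \<in> B" "x \<in> B"
  shows "(\<lambda>k. s.p (y - x * \<eta> k)) \<longlonglongrightarrow> D y x"
  unfolding D_def
  by (rule s.seminorm_tendsto[OF s.cauchy_diff[OF s.cauchy_const[OF assms(1)] s.cauchy_mult_left[OF \<eta> assms(2)]]])

lemma D_nonneg: "y \<in> B \<Longrightarrow> x \<in> B \<Longrightarrow> 0 \<le> D y x"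
  by (rule LIMSEQ_le_const[OF D_tendsto]) auto

lemma D_triangle:
  assumes "y \<in> B" "x \<in> B" "y' \<in> B" "x' \<in> B"
  shows "D (y + y') (x + x') \<le> D y x + D y' x'"
proof (rule LIMSEQ_le[OF D_tendsto tendsto_add[OF D_tendsto D_tendsto]])
  have "s.p (y + y' - (x + x') * \<eta> k) \<le> s.p (y - x * \<eta> k) + s.p (y' - x' * \<eta> k)" for k
    using s.seminorm_triangle[of "y - x * \<eta> k" "y' - x' * \<eta> k"] assms by (simp add: algebra_simps)
  then show "\<exists>N. \<forall>k\<ge>N. s.p (y + y' - (x + x') * \<eta> k) \<le> s.p (y - x * \<eta> k) + s.p (y' - x' * \<eta> k)" by blast
qed (use assms in auto)

lemma D_mult_left:
  assumes "b \<in> B" "y \<in> B" "x \<in> B"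
  shows "D (b * y) (b * x) \<le> norm b * D y x"
proof (rule LIMSEQ_le[OF D_tendsto tendsto_mult_left[OF D_tendsto]])
  have "s.p (b * y - b * x * \<eta> k) \<le> norm b * s.p (y - x * \<eta> k)" for k
    using s.seminorm_mult_left[of b "y - x * \<eta> k"] assms by (simp add: algebra_simps)
  then show "\<exists>N. \<forall>k\<ge>N. s.p (b * y - b * x * \<eta> k) \<le> norm b * s.p (y - x * \<eta> k)" by blast
qed (use assms in auto)

lemma seminorm_mult_\<eta>: "x \<in> B \<Longrightarrow> (\<lambda>k. s.p (x * \<eta> k)) \<longlonglongrightarrow> t.p x"
proof -
  assume x: "x \<in> B"
  have "(\<lambda>k. sqrt (Re (\<sigma> (adj (\<eta> k) * (adj x * x * \<eta> k))))) \<longlonglongrightarrow> sqrt (Re (\<tau> (adj x * x)))"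
    using x by (intro tendsto_intros \<tau>_lim) auto
  then show ?thesis by (simp add: gns_seminorm_def adj_mult mult.assoc)
qed

lemma D_zero_left: "x \<in> B \<Longrightarrow> D 0 x = t.p x"
  using LIMSEQ_unique[OF D_tendsto[of 0 x] _] seminorm_mult_\<eta>[of x] by simp

lemma D_zero_right: "y \<in> B \<Longrightarrow> D y 0 = s.p y"
  using LIMSEQ_unique[OF D_tendsto[of y 0], of "s.p y"] by simp

lemma D_minus: "y \<in> B \<Longrightarrow> x \<in> B \<Longrightarrow> D (- y) (- x) = D y x"
  using LIMSEQ_unique[OF D_tendsto[of "- y" "- x"], of "D y x"] D_tendsto[of y x]
    s.seminorm_minus_commute[of "x * \<eta> k" y for k] by (simp add: algebra_simps)

lemma D_diff:
  assumes "y \<in> B" "x \<in> B" "y' \<in> B" "x' \<in> B"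
  shows "D (y - y') (x - x') \<le> D y x + D y' x'"
  using D_triangle[of y x "- y'" "- x'"] D_minus[of y' x'] assms by simp

text \<open>\<open>D y x\<close> is \<parallel>y - T x\<parallel>, and \<open>D_zero_left\<close>
  says that T is isometric. This and the next lemma are the resulting triangle inequalities; they
  transfer Cauchy and null sequences between the two spaces.\<close>

lemma seminorm_source_le:
  assumes "y \<in> B" "x \<in> B" "y' \<in> B" "x' \<in> B"
  shows "t.p (x - x') \<le> D y x + D y' x' + s.p (y - y')"
  using D_triangle[of "y - y'" "x - x'" "- (y - y')" 0] D_minus[of "y - y'" 0] D_diff[of y x y' x']
    D_zero_right[of "y - y'"] D_zero_left[of "x - x'"] assms by simp

lemma seminorm_target_le:
  assumes "y \<in> B" "x \<in> B" "y' \<in> B" "x' \<in> B"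
  shows "s.p (y - y') \<le> D y x + D y' x' + t.p (x - x')"
  using D_triangle[of "y - y'" "x - x'" 0 "- (x - x')"] D_minus[of 0 "x - x'"] D_diff[of y x y' x']
    D_zero_right[of "y - y'"] D_zero_left[of "x - x'"] assms by simp

lemma D_le_target:
  assumes "y \<in> B" "x \<in> B" "y' \<in> B"
  shows "D y' x \<le> D y x + s.p (y' - y)"
  using D_triangle[of y x "y' - y" 0] D_zero_right[of "y' - y"] assms by simp

lemma inner_D_bound:
  assumes "y \<in> B" "x \<in> B" "y' \<in> B" "x' \<in> B"
  shows "cmod (\<sigma> (adj y * y') - \<tau> (adj x * x')) \<le> D y x * s.p y' + t.p x * D y' x'"
proof (rule LIMSEQ_le)
  show "(\<lambda>k. cmod (\<sigma> (adj y * y') - \<sigma> (adj (\<eta> k) * (adj x * x' * \<eta> k))))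
      \<longlonglongrightarrow> cmod (\<sigma> (adj y * y') - \<tau> (adj x * x'))"
    using assms by (intro tendsto_intros \<tau>_lim) auto
  show "(\<lambda>k. s.p (y - x * \<eta> k) * s.p y' + s.p (x * \<eta> k) * s.p (y' - x' * \<eta> k))
      \<longlonglongrightarrow> D y x * s.p y' + t.p x * D y' x'"
    using assms by (intro tendsto_intros D_tendsto seminorm_mult_\<eta>)
  have "cmod (\<sigma> (adj y * y') - \<sigma> (adj (\<eta> k) * (adj x * x' * \<eta> k)))
      \<le> s.p (y - x * \<eta> k) * s.p y' + s.p (x * \<eta> k) * s.p (y' - x' * \<eta> k)" for k
    using s.inner_diff_bound[of y y' "x * \<eta> k" "x' * \<eta> k"] assms by (simp add: adj_mult mult.assoc)
  then show "\<exists>N. \<forall>k\<ge>N. cmod (\<sigma> (adj y * y') - \<sigma> (adj (\<eta> k) * (adj x * x' * \<eta> k)))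
      \<le> s.p (y - x * \<eta> k) * s.p y' + s.p (x * \<eta> k) * s.p (y' - x' * \<eta> k)" by blast
qed

text \<open>\<open>G X Y\<close> says that the unitary maps the class of \<open>X\<close> to the class of \<open>Y\<close>.\<close>

definition G :: "(nat \<Rightarrow> 'a) \<Rightarrow> (nat \<Rightarrow> 'a) \<Rightarrow> bool" where
  "G X Y \<longleftrightarrow> X \<in> gns_cauchy B \<tau> \<and> Y \<in> gns_cauchy B \<sigma> \<and> (\<lambda>n. D (Y n) (X n)) \<longlonglongrightarrow> 0"

lemma null_D:
  assumes "\<And>n. Y n \<in> B" "\<And>n. X n \<in> B" "\<And>n. D (Y n) (X n) \<le> f n" "f \<longlonglongrightarrow> 0"
  shows "(\<lambda>n. D (Y n) (X n)) \<longlonglongrightarrow> 0"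
  by (rule Lim_null_comparison[OF _ assms(4)]) (use assms(1-3) D_nonneg in simp)

lemma G_source_cauchy:
  assumes X: "\<And>n. X n \<in> B" and Y: "Y \<in> gns_cauchy B \<sigma>" and D: "(\<lambda>n. D (Y n) (X n)) \<longlonglongrightarrow> 0"
  shows "G X Y"
proof -
  note [simp] = s.cauchy_mem[OF Y] X
  have "\<exists>N. \<forall>m\<ge>N. \<forall>n\<ge>N. t.p (X m - X n) < e" if e: "e > 0" for e
  proof -
    have e3: "e / 3 > 0" using e by simp
    obtain N where N: "\<And>m n. m \<ge> N \<Longrightarrow> n \<ge> N \<Longrightarrow> s.p (Y m - Y n) < e / 3" using s.cauchyD[OF Y e3] by metis
    obtain M where M: "\<And>n. n \<ge> M \<Longrightarrow> D (Y n) (X n) < e / 3"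
      using order_tendstoD(2)[OF D e3] by (auto simp: eventually_sequentially)
    have "t.p (X m - X n) < e" if "m \<ge> max N M" "n \<ge> max N M" for m n
      using seminorm_source_le[of "Y m" "X m" "Y n" "X n"] N[of m n] M[of m] M[of n] that by simp
    then show ?thesis by blast
  qed
  then have "X \<in> gns_cauchy B \<tau>" unfolding gns_cauchy_def by simp
  then show ?thesis using Y D by (simp add: G_def)
qed

lemma G_total:
  assumes X: "X \<in> gns_cauchy B \<tau>" obtains Y where "G X Y"
proof -
  note [simp] = t.cauchy_mem[OF X]
  have "\<exists>y\<in>B. D y (X n) < 1 / real (Suc n)" for n
  proof -
    define e where "e = 1 / real (Suc n)"
    have e: "e / 2 > 0" by (simp add: e_def)
    \<comment> \<open>A late \<open>\<eta> N\<close> stands in for the limit vector. The margin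
      \<open>e / 2\<close> is used because a strict bound becomes a weak one in the limit.\<close>
    obtain N where N: "\<And>i j. i \<ge> N \<Longrightarrow> j \<ge> N \<Longrightarrow> s.p (X n * \<eta> i - X n * \<eta> j) < e / 2"
      using s.cauchyD[OF s.cauchy_mult_left[OF \<eta>, of "X n"] e] by auto
    have "D (X n * \<eta> N) (X n) \<le> e / 2"
      by (rule LIMSEQ_le_const2[OF D_tendsto]) (use N[of N] less_imp_le in auto)
    then have "D (X n * \<eta> N) (X n) < e" using e by simp
    moreover have "X n * \<eta> N \<in> B" by simp
    ultimately show ?thesis unfolding e_def by blast
  qed
  then obtain Y where Y: "\<And>n. Y n \<in> B" "\<And>n. D (Y n) (X n) < 1 / real (Suc n)" by metis
  have D: "(\<lambda>n. D (Y n) (X n)) \<longlonglongrightarrow> 0"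
    by (rule null_D[OF Y(1) _ less_imp_le[OF Y(2)]])
      (use LIMSEQ_inverse_real_of_nat in \<open>simp_all add: inverse_eq_divide\<close>)
  have "\<exists>N. \<forall>m\<ge>N. \<forall>n\<ge>N. s.p (Y m - Y n) < e" if e: "e > 0" for e
  proof -
    have e3: "e / 3 > 0" using e by simp
    obtain N where N: "\<And>m n. m \<ge> N \<Longrightarrow> n \<ge> N \<Longrightarrow> t.p (X m - X n) < e / 3" using t.cauchyD[OF X e3] by metis
    obtain M where M: "\<And>n. n \<ge> M \<Longrightarrow> D (Y n) (X n) < e / 3"
      using order_tendstoD(2)[OF D e3] by (auto simp: eventually_sequentially)
    have "s.p (Y m - Y n) < e" if "m \<ge> max N M" "n \<ge> max N M" for m n
      using seminorm_target_le[of "Y m" "X m" "Y n" "X n"] N[of m n] M[of m] M[of n] that Y(1) by simp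
    then show ?thesis by blast
  qed
  then have "Y \<in> gns_cauchy B \<sigma>" using Y(1) unfolding gns_cauchy_def by simp
  then show ?thesis using that D X by (simp add: G_def)
qed

lemma G_add:
  assumes "G X Y" "G X' Y'" shows "G (\<lambda>n. X n + X' n) (\<lambda>n. Y n + Y' n)"
proof -
  have C: "X \<in> gns_cauchy B \<tau>" "Y \<in> gns_cauchy B \<sigma>" "X' \<in> gns_cauchy B \<tau>" "Y' \<in> gns_cauchy B \<sigma>"
    using assms by (auto simp: G_def)
  note mem = t.cauchy_mem[OF C(1)] s.cauchy_mem[OF C(2)] t.cauchy_mem[OF C(3)] s.cauchy_mem[OF C(4)]
  have "(\<lambda>n. D (Y n + Y' n) (X n + X' n)) \<longlonglongrightarrow> 0"
  proof (rule null_D)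
    show "D (Y n + Y' n) (X n + X' n) \<le> D (Y n) (X n) + D (Y' n) (X' n)" for n
      using mem by (intro D_triangle)
    show "(\<lambda>n. D (Y n) (X n) + D (Y' n) (X' n)) \<longlonglongrightarrow> 0"
      using assms tendsto_add[of "\<lambda>n. D (Y n) (X n)" 0 sequentially "\<lambda>n. D (Y' n) (X' n)" 0] by (simp add: G_def)
  qed (use mem in auto)
  then show ?thesis using s.cauchy_add[OF C(2,4)] t.cauchy_add[OF C(1,3)] by (simp add: G_def)
qed

lemma G_mult_left:
  assumes "G X Y" and b: "b \<in> B" shows "G (\<lambda>n. b * X n) (\<lambda>n. b * Y n)"
proof -
  have C: "X \<in> gns_cauchy B \<tau>" "Y \<in> gns_cauchy B \<sigma>"
    using assms by (auto simp: G_def)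
  note mem = t.cauchy_mem[OF C(1)] s.cauchy_mem[OF C(2)]
  have "(\<lambda>n. D (b * Y n) (b * X n)) \<longlonglongrightarrow> 0"
  proof (rule null_D)
    show "D (b * Y n) (b * X n) \<le> norm b * D (Y n) (X n)" for n
      using mem b by (intro D_mult_left)
    show "(\<lambda>n. norm b * D (Y n) (X n)) \<longlonglongrightarrow> 0"
      using assms tendsto_mult_right_zero by (auto simp: G_def)
  qed (use mem b in auto)
  then show ?thesis using s.cauchy_mult_left[OF C(2) b] t.cauchy_mult_left[OF C(1) b] by (simp add: G_def)
qed

lemma G_scaleC: "G X Y \<Longrightarrow> G (\<lambda>n. c *\<^sub>C X n) (\<lambda>n. c *\<^sub>C Y n)"
  using G_mult_left[of X Y "c *\<^sub>C 1"] by (simp add: scaleC_mult_left)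

text \<open>From left to right this makes \<open>U\<close> well defined on classes, from right to
  left injective.\<close>

lemma G_gns_rel_iff:
  assumes "G X Y" "G X' Y'"
  shows "(X, X') \<in> gns_rel B \<tau> \<longleftrightarrow> (Y, Y') \<in> gns_rel B \<sigma>"
proof -
  have C: "X \<in> gns_cauchy B \<tau>" "Y \<in> gns_cauchy B \<sigma>" "X' \<in> gns_cauchy B \<tau>" "Y' \<in> gns_cauchy B \<sigma>"
    and D: "(\<lambda>n. D (Y n) (X n) + D (Y' n) (X' n)) \<longlonglongrightarrow> 0"
    using assms tendsto_add[of "\<lambda>n. D (Y n) (X n)" 0 sequentially "\<lambda>n. D (Y' n) (X' n)" 0] by (auto simp: G_def)
  note mem = t.cauchy_mem[OF C(1)] s.cauchy_mem[OF C(2)] t.cauchy_mem[OF C(3)] s.cauchy_mem[OF C(4)]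
  have "(\<lambda>n. s.p (Y n - Y' n)) \<longlonglongrightarrow> 0" if "(\<lambda>n. t.p (X n - X' n)) \<longlonglongrightarrow> 0"
  proof (rule s.null_seminormI)
    show "s.p (Y n - Y' n) \<le> D (Y n) (X n) + D (Y' n) (X' n) + t.p (X n - X' n)" for n
      using mem by (intro seminorm_target_le)
    show "(\<lambda>n. D (Y n) (X n) + D (Y' n) (X' n) + t.p (X n - X' n)) \<longlonglongrightarrow> 0"
      using tendsto_add[OF D that] by simp
  qed (use mem in auto)
  moreover have "(\<lambda>n. t.p (X n - X' n)) \<longlonglongrightarrow> 0" if "(\<lambda>n. s.p (Y n - Y' n)) \<longlonglongrightarrow> 0"
  proof (rule t.null_seminormI)
    show "t.p (X n - X' n) \<le> D (Y n) (X n) + D (Y' n) (X' n) + s.p (Y n - Y' n)" for n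
      using mem by (intro seminorm_source_le)
    show "(\<lambda>n. D (Y n) (X n) + D (Y' n) (X' n) + s.p (Y n - Y' n)) \<longlonglongrightarrow> 0"
      using tendsto_add[OF D that] by simp
  qed (use mem in auto)
  ultimately show ?thesis using C by (auto simp: s.gns_rel_iff t.gns_rel_iff)
qed

lemma G_target_cong:
  assumes "G X Y" "(Y, Y') \<in> gns_rel B \<sigma>" shows "G X Y'"
proof -
  have C: "X \<in> gns_cauchy B \<tau>" "Y \<in> gns_cauchy B \<sigma>" "Y' \<in> gns_cauchy B \<sigma>"
    and D: "(\<lambda>n. D (Y n) (X n)) \<longlonglongrightarrow> 0" and Y: "(\<lambda>n. s.p (Y n - Y' n)) \<longlonglongrightarrow> 0"
    using assms by (auto simp: G_def s.gns_rel_iff)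
  note mem = t.cauchy_mem[OF C(1)] s.cauchy_mem[OF C(2)] s.cauchy_mem[OF C(3)]
  have "(\<lambda>n. D (Y' n) (X n)) \<longlonglongrightarrow> 0"
  proof (rule null_D)
    show "D (Y' n) (X n) \<le> D (Y n) (X n) + s.p (Y n - Y' n)" for n
      using D_le_target[of "Y n" "X n" "Y' n"] mem s.seminorm_minus_commute[of "Y' n" "Y n"] by simp
    show "(\<lambda>n. D (Y n) (X n) + s.p (Y n - Y' n)) \<longlonglongrightarrow> 0" using tendsto_add[OF D Y] by simp
  qed (use mem in auto)
  then show ?thesis using C by (simp add: G_def)
qed

lemma G_inner:
  assumes "G X Y" "G X' Y'"
  shows "lim (\<lambda>n. \<sigma> (adj (Y n) * Y' n)) = lim (\<lambda>n. \<tau> (adj (X n) * X' n))"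
proof -
  have C: "X \<in> gns_cauchy B \<tau>" "Y \<in> gns_cauchy B \<sigma>" "X' \<in> gns_cauchy B \<tau>" "Y' \<in> gns_cauchy B \<sigma>"
    and D: "(\<lambda>n. D (Y n) (X n)) \<longlonglongrightarrow> 0" "(\<lambda>n. D (Y' n) (X' n)) \<longlonglongrightarrow> 0"
    using assms by (auto simp: G_def)
  note mem = t.cauchy_mem[OF C(1)] s.cauchy_mem[OF C(2)] t.cauchy_mem[OF C(3)] s.cauchy_mem[OF C(4)]
  have "(\<lambda>n. \<sigma> (adj (Y n) * Y' n) - \<tau> (adj (X n) * X' n)) \<longlonglongrightarrow> 0"
  proof (rule Lim_null_comparison)
    show "\<forall>\<^sub>F n in sequentially. norm (\<sigma> (adj (Y n) * Y' n) - \<tau> (adj (X n) * X' n))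
        \<le> D (Y n) (X n) * s.p (Y' n) + t.p (X n) * D (Y' n) (X' n)"
      using inner_D_bound mem by simp
    show "(\<lambda>n. D (Y n) (X n) * s.p (Y' n) + t.p (X n) * D (Y' n) (X' n)) \<longlonglongrightarrow> 0"
      using tendsto_add[OF tendsto_mult[OF D(1) s.seminorm_tendsto[OF C(4)]]
          tendsto_mult[OF t.seminorm_tendsto[OF C(1)] D(2)]] by simp
  qed
  from tendsto_add[OF this t.inner_tendsto[OF C(1,3)]]
  have "(\<lambda>n. \<sigma> (adj (Y n) * Y' n)) \<longlonglongrightarrow> lim (\<lambda>n. \<tau> (adj (X n) * X' n))" by simp
  from LIMSEQ_unique[OF s.inner_tendsto[OF C(2,4)] this] show ?thesis .
qed

text \<open>A relational image, so that no representatives have to be chosen. That it is exactly one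
  class follows from \<open>G_gns_rel_iff\<close> and \<open>G_target_cong\<close>.\<close>

definition U :: "(nat \<Rightarrow> 'a) set \<Rightarrow> (nat \<Rightarrow> 'a) set" where
  "U u = {Y. \<exists>X\<in>u. G X Y}"

lemma U_cls:
  assumes "G X Y" shows "U (t.cls X) = s.cls Y"
proof -
  have C: "X \<in> gns_cauchy B \<tau>" using assms by (simp add: G_def)
  have "Y' \<in> s.cls Y" if "X' \<in> t.cls X" "G X' Y'" for X' Y'
    using G_gns_rel_iff[OF assms that(2)] that(1) by (simp add: t.mem_cls s.mem_cls)
  moreover have "\<exists>X'\<in>t.cls X. G X' Y'" if "Y' \<in> s.cls Y" for Y'
    using G_target_cong[OF assms] that t.cls_self[OF C] s.mem_cls by blast
  ultimately show ?thesis unfolding U_def by blast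
qed

lemma vecs_cases:
  assumes "u \<in> vecs (gns B \<tau>)"
  obtains X Y where "G X Y" "u = t.cls X" "U u = s.cls Y" "X \<in> gns_cauchy B \<tau>" "Y \<in> gns_cauchy B \<sigma>"
proof -
  obtain X where X: "X \<in> gns_cauchy B \<tau>" "u = t.cls X" using assms unfolding t.vecs_gns by blast
  obtain Y where G: "G X Y" using G_total[OF X(1)] by metis
  then have "Y \<in> gns_cauchy B \<sigma>" by (simp add: G_def)
  from that[OF G X(2) _ X(1) this] show ?thesis using U_cls[OF G] X(2) by simp
qed

lemma U_add:
  assumes "u \<in> vecs (gns B \<tau>)" "v \<in> vecs (gns B \<tau>)"
  shows "vadd (gns B \<tau>) u v \<in> vecs (gns B \<tau>)"
    "U (vadd (gns B \<tau>) u v) = vadd (gns B \<sigma>) (U u) (U v)"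
proof -
  obtain X Y where X: "G X Y" "u = t.cls X" "U u = s.cls Y" "X \<in> gns_cauchy B \<tau>" "Y \<in> gns_cauchy B \<sigma>"
    using vecs_cases[OF assms(1)] by metis
  obtain X' Y' where X': "G X' Y'" "v = t.cls X'" "U v = s.cls Y'" "X' \<in> gns_cauchy B \<tau>" "Y' \<in> gns_cauchy B \<sigma>"
    using vecs_cases[OF assms(2)] by metis
  show "vadd (gns B \<tau>) u v \<in> vecs (gns B \<tau>)"
    using X X' t.cauchy_add[of X X'] by (simp add: t.vadd_gns t.vecs_gns)
  show "U (vadd (gns B \<tau>) u v) = vadd (gns B \<sigma>) (U u) (U v)"
    using U_cls[OF G_add[OF X(1) X'(1)]] X X' by (simp add: t.vadd_gns s.vadd_gns)
qed

lemma U_scale: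
  assumes "u \<in> vecs (gns B \<tau>)"
  shows "vscale (gns B \<tau>) c u \<in> vecs (gns B \<tau>)"
    "U (vscale (gns B \<tau>) c u) = vscale (gns B \<sigma>) c (U u)"
proof -
  obtain X Y where X: "G X Y" "u = t.cls X" "U u = s.cls Y" "X \<in> gns_cauchy B \<tau>" "Y \<in> gns_cauchy B \<sigma>"
    using vecs_cases[OF assms(1)] by metis
  show "vscale (gns B \<tau>) c u \<in> vecs (gns B \<tau>)"
    using X t.cauchy_scaleC[of X c] by (simp add: t.vscale_gns t.vecs_gns)
  show "U (vscale (gns B \<tau>) c u) = vscale (gns B \<sigma>) c (U u)"
    using U_cls[OF G_scaleC[OF X(1)]] X by (simp add: t.vscale_gns s.vscale_gns)
qed

lemma U_act:
  assumes "u \<in> vecs (gns B \<tau>)" and b: "b \<in> B"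
  shows "act (gns B \<tau>) b u \<in> vecs (gns B \<tau>)"
    "U (act (gns B \<tau>) b u) = act (gns B \<sigma>) b (U u)"
proof -
  obtain X Y where X: "G X Y" "u = t.cls X" "U u = s.cls Y" "X \<in> gns_cauchy B \<tau>" "Y \<in> gns_cauchy B \<sigma>"
    using vecs_cases[OF assms(1)] by metis
  show "act (gns B \<tau>) b u \<in> vecs (gns B \<tau>)"
    using X b t.cauchy_mult_left[of X b] by (simp add: t.act_gns t.vecs_gns)
  show "U (act (gns B \<tau>) b u) = act (gns B \<sigma>) b (U u)"
    using U_cls[OF G_mult_left[OF X(1) b]] X b by (simp add: t.act_gns s.act_gns)
qed

lemma U_inner:
  assumes "u \<in> vecs (gns B \<tau>)" "v \<in> vecs (gns B \<tau>)"
  shows "vinner (gns B \<sigma>) (U u) (U v) = vinner (gns B \<tau>) u v"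
proof -
  obtain X Y where X: "G X Y" "u = t.cls X" "U u = s.cls Y" "X \<in> gns_cauchy B \<tau>" "Y \<in> gns_cauchy B \<sigma>"
    using vecs_cases[OF assms(1)] by metis
  obtain X' Y' where X': "G X' Y'" "v = t.cls X'" "U v = s.cls Y'" "X' \<in> gns_cauchy B \<tau>" "Y' \<in> gns_cauchy B \<sigma>"
    using vecs_cases[OF assms(2)] by metis
  show ?thesis
    using G_inner[OF X(1) X'(1)] X X' by (simp add: t.vinner_gns s.vinner_gns)
qed

lemma U_inj: "inj_on U (vecs (gns B \<tau>))"
proof (rule inj_onI)
  fix u v assume uv: "u \<in> vecs (gns B \<tau>)" "v \<in> vecs (gns B \<tau>)" "U u = U v"
  obtain X Y where X: "G X Y" "u = t.cls X" "U u = s.cls Y"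
    using vecs_cases[OF uv(1)] by metis
  obtain X' Y' where X': "G X' Y'" "v = t.cls X'" "U v = s.cls Y'" "Y' \<in> gns_cauchy B \<sigma>"
    using vecs_cases[OF uv(2)] by metis
  show "u = v"
    using G_gns_rel_iff[OF X(1) X'(1)] s.cls_eqD[of Y Y'] X X' uv(3) t.cls_eqI by simp
qed

text \<open>By \<open>near\<close>, for every \<open>e\<close> a single point of the source
  approximates all late \<open>Z n\<close> up to \<open>e\<close>. Taking for \<open>X n\<close> a
  best approximation of \<open>Z n\<close> up to 1/(n+1), independently of \<open>e\<close>, makes
  \<open>D (Z n) (X n)\<close> tend to 0, and isometry pulls the Cauchy property back from
  \<open>Z\<close> to \<open>X\<close>.\<close>

lemma U_image_closed:
  assumes s: "\<And>n. s n \<in> U ` vecs (gns B \<tau>)" and u: "u \<in> vecs (gns B \<sigma>)"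
    and lim: "(\<lambda>n. vdist (gns B \<sigma>) (s n) u) \<longlonglongrightarrow> 0"
  shows "u \<in> U ` vecs (gns B \<tau>)"
proof -
  obtain Z where Z: "Z \<in> gns_cauchy B \<sigma>" "u = s.cls Z" using u unfolding s.vecs_gns by blast
  note [simp] = s.cauchy_mem[OF Z(1)]
  have near: "\<exists>x\<in>B. \<exists>N. \<forall>n\<ge>N. D (Z n) x < e" if e: "e > 0" for e
  proof -
    have e3: "e / 3 > 0" using e by simp
    obtain j where j: "vdist (gns B \<sigma>) (s j) u < e / 3"
      using order_tendstoD(2)[OF lim e3] by (auto simp: eventually_sequentially)
    obtain w where w: "w \<in> vecs (gns B \<tau>)" "s j = U w" using s[of j] by blast
    obtain X Y where X: "G X Y" "U w = s.cls Y" "X \<in> gns_cauchy B \<tau>" "Y \<in> gns_cauchy B \<sigma>"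
      using vecs_cases[OF w(1)] by metis
    note [simp] = t.cauchy_mem[OF X(3)] s.cauchy_mem[OF X(4)]
    have "(\<lambda>n. s.p (Y n - Z n)) \<longlonglongrightarrow> vdist (gns B \<sigma>) (s j) u"
      using s.vdist_gns[OF X(4) Z(1)] X(2) w(2) Z(2) by simp
    then have "\<forall>\<^sub>F n in sequentially. s.p (Y n - Z n) < e / 3" using order_tendstoD(2) j by blast
    moreover have "\<forall>\<^sub>F n in sequentially. D (Y n) (X n) < e / 3"
      using X(1) order_tendstoD(2) e3 unfolding G_def by blast
    ultimately have "\<forall>\<^sub>F n in sequentially. s.p (Y n - Z n) < e / 3 \<and> D (Y n) (X n) < e / 3"
      by (rule eventually_conj)
    then obtain M where M: "\<And>n. n \<ge> M \<Longrightarrow> s.p (Y n - Z n) < e / 3 \<and> D (Y n) (X n) < e / 3"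
      by (auto simp: eventually_sequentially)
    obtain N where N: "\<And>m n. m \<ge> N \<Longrightarrow> n \<ge> N \<Longrightarrow> s.p (Z m - Z n) < e / 3" using s.cauchyD[OF Z(1) e3] by metis
    define m where "m = max M N"
    have "D (Z n) (X m) < e" if "n \<ge> N" for n
    proof -
      have "D (Z n) (X m) \<le> D (Y m) (X m) + s.p (Z n - Y m)" by (rule D_le_target) auto
      moreover have "s.p (Z n - Y m) \<le> s.p (Z n - Z m) + s.p (Z m - Y m)" by (rule s.seminorm_diff_triangle) auto
      moreover have "s.p (Z m - Y m) = s.p (Y m - Z m)" by (rule s.seminorm_minus_commute) auto
      ultimately show ?thesis using M[of m] N[of n m] that by (simp add: m_def)
    qed
    then show ?thesis by (intro bexI[of _ "X m"]) auto
  qed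
  have "\<exists>x\<in>B. \<forall>x'\<in>B. D (Z n) x \<le> D (Z n) x' + 1 / real (Suc n)" for n
  proof -
    have ne: "D (Z n) ` B \<noteq> {}" using s.one_mem by blast
    have bdd: "bdd_below (D (Z n) ` B)" using D_nonneg[of "Z n"] by (intro bdd_belowI2[of _ 0]) auto
    have "Inf (D (Z n) ` B) < Inf (D (Z n) ` B) + 1 / real (Suc n)" by simp
    from cInf_lessD[OF ne this] obtain x where x: "x \<in> B" "D (Z n) x < Inf (D (Z n) ` B) + 1 / real (Suc n)" by blast
    moreover have "Inf (D (Z n) ` B) \<le> D (Z n) x'" if "x' \<in> B" for x' using bdd that by (intro cInf_lower) auto
    ultimately have "D (Z n) x \<le> D (Z n) x' + 1 / real (Suc n)" if "x' \<in> B" for x' using that by force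
    then show ?thesis using x(1) by blast
  qed
  then obtain X where X: "\<And>n. X n \<in> B" "\<And>n x'. x' \<in> B \<Longrightarrow> D (Z n) (X n) \<le> D (Z n) x' + 1 / real (Suc n)" by metis
  have "(\<lambda>n. D (Z n) (X n)) \<longlonglongrightarrow> 0"
  proof (rule LIMSEQ_I)
    fix e :: real assume e: "e > 0"
    then have e2: "e / 2 > 0" by simp
    obtain x N where x: "x \<in> B" and N: "\<And>n. n \<ge> N \<Longrightarrow> D (Z n) x < e / 2" using near[OF e2] by blast
    obtain M where M: "\<And>n. n \<ge> M \<Longrightarrow> 1 / real (Suc n) < e / 2"
      using order_tendstoD(2)[OF LIMSEQ_inverse_real_of_nat e2] by (auto simp: eventually_sequentially inverse_eq_divide)
    have "norm (D (Z n) (X n) - 0) < e" if "n \<ge> max M N" for n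
      using X(2)[OF x, of n] N[of n] M[of n] that D_nonneg[of "Z n" "X n"] X(1) by simp
    then show "\<exists>no. \<forall>n\<ge>no. norm (D (Z n) (X n) - 0) < e" by blast
  qed
  then have G: "G X Z" using X(1) Z(1) by (intro G_source_cauchy)
  then have "t.cls X \<in> vecs (gns B \<tau>)" by (simp add: t.vecs_gns G_def)
  then show ?thesis using U_cls[OF G] Z(2) by blast
qed

lemma vzero_mem: "vzero (gns B \<tau>) \<in> vecs (gns B \<tau>)"
  using t.cauchy_const[of 0] by (auto simp: t.vzero_gns t.vecs_gns)

lemma U_zero: "U (vzero (gns B \<tau>)) = vzero (gns B \<sigma>)"
proof -
  have "G (\<lambda>n. 0) (\<lambda>n. 0)"
    using t.cauchy_const[of 0] s.cauchy_const[of 0] D_zero_left[of 0] by (simp add: G_def)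
  from U_cls[OF this] show ?thesis by (simp add: t.vzero_gns s.vzero_gns)
qed

lemma vecs_closed_subspace: "closed_subspace (gns B \<tau>) (vecs (gns B \<tau>))"
  using vzero_mem U_add(1) U_scale(1) by (simp add: closed_subspace_def)

lemma vecs_nonzero: "vecs (gns B \<tau>) \<noteq> {vzero (gns B \<tau>)}"
proof
  assume a: "vecs (gns B \<tau>) = {vzero (gns B \<tau>)}"
  have "t.cls (\<lambda>n. 1) \<in> vecs (gns B \<tau>)" using t.cauchy_const[of 1] by (simp add: t.vecs_gns)
  then have "t.cls (\<lambda>n. 1) = t.cls (\<lambda>n. 0)" using a t.vzero_gns by simp
  from t.cls_eqD[OF this] t.cauchy_const[of 0] have "(\<lambda>n::nat. t.p 1) \<longlonglongrightarrow> 0"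
    by (simp add: t.gns_rel_iff)
  then show False by (simp add: LIMSEQ_const_iff)
qed

text \<open>The full GNS space of \<tau> serves as one subrepresentation, the range of
  \<open>U\<close> as the other.\<close>

lemma not_disjoint_reps: "\<not> disjoint_reps B (gns B \<tau>) (gns B \<sigma>)"
proof -
  let ?V = "vecs (gns B \<tau>)"
  define K where "K = U ` ?V"
  have "nonzero_subrep B (gns B \<tau>) (gns B \<tau>\<lparr>vecs := ?V\<rparr>)"
    unfolding nonzero_subrep_def using vecs_closed_subspace vecs_nonzero U_act(1) by blast
  moreover have "nonzero_subrep B (gns B \<sigma>) (gns B \<sigma>\<lparr>vecs := K\<rparr>)"
  proof -
    have KV: "K \<subseteq> vecs (gns B \<sigma>)"
    proof
      fix w assume "w \<in> K"
      then obtain u where u: "u \<in> ?V" "w = U u" by (auto simp: K_def)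
      show "w \<in> vecs (gns B \<sigma>)" using vecs_cases[OF u(1)] u(2) by (metis s.vecs_gns imageI)
    qed
    have K0: "vzero (gns B \<sigma>) \<in> K" unfolding K_def using U_zero vzero_mem by (metis imageI)
    have Kadd: "vadd (gns B \<sigma>) w w' \<in> K" if w: "w \<in> K" and w': "w' \<in> K" for w w'
    proof -
      obtain u v where uv: "u \<in> ?V" "w = U u" "v \<in> ?V" "w' = U v" using w w' by (auto simp: K_def)
      show ?thesis using U_add[OF uv(1,3)] uv unfolding K_def by (metis imageI)
    qed
    have Ksc: "vscale (gns B \<sigma>) c w \<in> K" if w: "w \<in> K" for c w
    proof -
      obtain u where u: "u \<in> ?V" "w = U u" using w by (auto simp: K_def)
      show ?thesis using U_scale[OF u(1)] u unfolding K_def by (metis imageI)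
    qed
    have Kact: "act (gns B \<sigma>) b w \<in> K" if b: "b \<in> B" and w: "w \<in> K" for b w
    proof -
      obtain u where u: "u \<in> ?V" "w = U u" using w by (auto simp: K_def)
      show ?thesis using U_act[OF u(1) b] u unfolding K_def by (metis imageI)
    qed
    have "closed_subspace (gns B \<sigma>) K"
      unfolding closed_subspace_def
    proof (intro conjI allI ballI impI)
      show "u \<in> K" if "u \<in> vecs (gns B \<sigma>)" "(\<forall>n. s n \<in> K) \<and> (\<lambda>n. vdist (gns B \<sigma>) (s n) u) \<longlonglongrightarrow> 0" for s u
        using U_image_closed[folded K_def, of s u] that by blast
    qed (use KV K0 Kadd Ksc in auto)
    moreover have "K \<noteq> {vzero (gns B \<sigma>)}"
    proof
      assume K: "K = {vzero (gns B \<sigma>)}"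
      have "u = vzero (gns B \<tau>)" if u: "u \<in> ?V" for u
      proof (rule inj_onD[OF U_inj _ u vzero_mem])
        have "U u \<in> K" using u by (simp add: K_def)
        then show "U u = U (vzero (gns B \<tau>))" using K U_zero by simp
      qed
      then show False using vecs_nonzero vzero_mem by blast
    qed
    ultimately show ?thesis unfolding nonzero_subrep_def using Kact by blast
  qed
  moreover have "unitarily_equivalent B (gns B \<tau>\<lparr>vecs := ?V\<rparr>) (gns B \<sigma>\<lparr>vecs := K\<rparr>)"
    unfolding unitarily_equivalent_def
    using U_inj U_add(2) U_scale(2) U_inner U_act(2)
    by (intro exI[of _ U]) (simp add: bij_betw_def K_def)
  ultimately show ?thesis unfolding disjoint_reps_def by blast
qed

end

lemma disjoint_reps_no_intertwiner:
  fixes B :: "'a::cstar_algebra set"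
  assumes B: "cstar_subalgebra B" and \<sigma>: "state_on B \<sigma>" and pure: "pure_state_on B \<tau>"
    and dis: "disjoint_reps B (gns B \<tau>) (gns B \<sigma>)"
    and g: "functional_on B g"
    and bound: "\<And>x y. x \<in> B \<Longrightarrow> y \<in> B \<Longrightarrow> cmod (g (adj x * y)) \<le> C * gns_seminorm \<sigma> x * gns_seminorm \<tau> y"
    and x: "x \<in> B"
  shows "g x = 0"
proof (rule ccontr)
  assume gx: "g x \<noteq> 0"
  obtain \<eta> where \<eta>: "\<eta> \<in> gns_cauchy B \<sigma>"
    "\<And>b. b \<in> B \<Longrightarrow> (\<lambda>k. \<sigma> (adj (\<eta> k) * (b * \<eta> k))) \<longlonglongrightarrow> \<tau> b"
    using intertwiner_vector[OF B \<sigma> pure g bound x gx] by metis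
  interpret vector_state B \<sigma> \<tau> \<eta>
    using B \<sigma> pure \<eta> by (intro vector_state.intro vector_state_axioms.intro cstar_stateI)
      (auto simp: pure_state_on_def)
  show False using not_disjoint_reps dis by contradiction
qed

section \<open>The CAR algebra\<close>

text \<open>One step of Gram--Schmidt on \<open>y\<close> splits off a matrix of rank one.\<close>

lemma Schur_product_nonneg:
  assumes \<sigma>: "cstar_state A \<sigma>" and \<tau>: "cstar_state C \<tau>" and "finite F"
    and "\<And>i. x i \<in> A" "\<And>i. y i \<in> C"
  shows "(\<Sum>i\<in>F. \<Sum>j\<in>F. \<sigma> (adj (x i) * x j) * \<tau> (adj (y i) * y j)) \<in> \<real>\<^sub>\<ge>\<^sub>0"
  using assms(3,5)
proof (induction F arbitrary: y rule: finite_induct)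
  case empty
  then show ?case by simp
next
  case (insert k F)
  interpret s: cstar_state A \<sigma> by (rule \<sigma>)
  interpret t: cstar_state C \<tau> by (rule \<tau>)
  note [simp] = assms(4) insert.prems
  define l where "l = (t.p (y k))\<^sup>2"
  define m where "m i = \<tau> (adj (y k) * y i)" for i
  define y' where "y' i = y i - (m i / l) *\<^sub>C y k" for i
  have [simp]: "y' i \<in> C" for i by (auto simp: y'_def)
  have mk: "m k = complex_of_real l" by (simp add: m_def l_def t.map_adj_mult_self)
  have m_cnj: "\<tau> (adj (y i) * y k) = cnj (m i)" for i by (simp add: m_def t.map_adj_mult_swap[of "y k" "y i"])
  \<comment> \<open>For \<open>l = 0\<close> the quotients \<open>m i / l\<close> are 0 by
    convention; Cauchy-Schwarz makes the \<open>m i\<close> vanish too, so \<open>split\<close> also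
    covers this case.\<close>
  have m0: "m i = 0" if "l = 0" for i
    using t.Cauchy_Schwarz[of "y k" "y i"] that by (simp add: m_def l_def)
  have split: "\<tau> (adj (y i) * y j) = \<tau> (adj (y' i) * y' j) + cnj (m i) * m j / l" for i j
  proof (cases "l = 0")
    case True
    then show ?thesis by (simp add: m0 y'_def)
  next
    case False
    have "\<tau> (adj (y' i) * y' j) = \<tau> (adj (y i) * y j) - (m j / l) * \<tau> (adj (y i) * y k)
        - cnj (m i / l) * \<tau> (adj (y k) * y j) + cnj (m i / l) * (m j / l) * \<tau> (adj (y k) * y k)"
      by (simp add: y'_def adj_diff adj_scaleC ring_distribs t.map_linear scaleC_mult_left
          scaleC_mult_right scaleC_scaleC)
    also have "\<dots> = \<tau> (adj (y i) * y j) - cnj (m i) * m j / l"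
      unfolding m_cnj m_def[symmetric] mk using False by (simp add: field_simps)
    finally show ?thesis by simp
  qed
  have k0: "\<tau> (adj (y' k) * y' j) = 0" for j
    using split[of k j] mk m0[of j] by (cases "l = 0") (simp_all add: m_def)
  have k0': "\<tau> (adj (y' j) * y' k) = 0" for j
    using k0[of j] t.map_adj_mult_swap[of "y' k" "y' j"] by simp
  have "(\<Sum>i\<in>insert k F. \<Sum>j\<in>insert k F. \<sigma> (adj (x i) * x j) * \<tau> (adj (y i) * y j)) =
      (\<Sum>i\<in>insert k F. \<Sum>j\<in>insert k F. \<sigma> (adj (x i) * x j) * \<tau> (adj (y' i) * y' j)) +
      (\<Sum>i\<in>insert k F. \<Sum>j\<in>insert k F. \<sigma> (adj (x i) * x j) * (cnj (m i) * m j / l))"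
    by (simp only: split distrib_left sum.distrib)
  also have "(\<Sum>i\<in>insert k F. \<Sum>j\<in>insert k F. \<sigma> (adj (x i) * x j) * \<tau> (adj (y' i) * y' j)) =
      (\<Sum>i\<in>F. \<Sum>j\<in>F. \<sigma> (adj (x i) * x j) * \<tau> (adj (y' i) * y' j))"
    using insert.hyps by (simp add: k0 k0')
  \<comment> \<open>The rank-one part is a single square, that of the sum of all
    \<open>m i *\<^sub>C x i\<close>, divided by \<open>l\<close>.\<close>
  also have "(\<Sum>i\<in>insert k F. \<Sum>j\<in>insert k F. \<sigma> (adj (x i) * x j) * (cnj (m i) * m j / l)) =
      \<sigma> (adj (\<Sum>i\<in>insert k F. m i *\<^sub>C x i) * (\<Sum>i\<in>insert k F. m i *\<^sub>C x i)) / l"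
  proof -
    have "\<sigma> (adj (\<Sum>i\<in>F'. m i *\<^sub>C x i) * (\<Sum>i\<in>F'. m i *\<^sub>C x i)) / l =
        (\<Sum>i\<in>F'. \<Sum>j\<in>F'. \<sigma> (adj (x i) * x j) * (cnj (m i) * m j / l))" for F'
      by (simp add: adj_sum adj_scaleC sum_product s.map_sum s.sum_mem s.map_linear scaleC_mult_left
          scaleC_mult_right scaleC_scaleC sum_divide_distrib mult_ac)
    then show ?thesis by simp
  qed
  also have "(\<Sum>i\<in>F. \<Sum>j\<in>F. \<sigma> (adj (x i) * x j) * \<tau> (adj (y' i) * y' j)) + \<dots> \<in> \<real>\<^sub>\<ge>\<^sub>0"
    by (intro nonneg_Reals_add_I insert.IH nonneg_Reals_divide_I s.positive s.sum_mem)
      (simp_all add: l_def flip: of_real_power)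
  finally show ?case .
qed

section \<open>Generated subalgebras and the parity automorphism\<close>

lemma cstar_subalgebra_closure:
  fixes S :: "'a::cstar_algebra set"
  assumes one: "1 \<in> S" and add: "\<And>x y. x \<in> S \<Longrightarrow> y \<in> S \<Longrightarrow> x + y \<in> S"
    and scaleC: "\<And>c x. x \<in> S \<Longrightarrow> c *\<^sub>C x \<in> S" and mult: "\<And>x y. x \<in> S \<Longrightarrow> y \<in> S \<Longrightarrow> x * y \<in> S"
    and adj: "\<And>x. x \<in> S \<Longrightarrow> adj x \<in> S"
  shows "cstar_subalgebra (closure S)"
proof -
  have limI: "x \<in> closure S" if "\<And>n. f n \<in> S" "f \<longlonglongrightarrow> x" for f x
    using that unfolding closure_sequential by blast
  have "x + y \<in> closure S \<and> x * y \<in> closure S" if xy: "x \<in> closure S" "y \<in> closure S" for x y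
  proof -
    obtain f g where f: "\<And>n. f n \<in> S" "f \<longlonglongrightarrow> x" and g: "\<And>n. g n \<in> S" "g \<longlonglongrightarrow> y"
      using xy unfolding closure_sequential by blast
    show ?thesis
      using limI[OF add[OF f(1) g(1)] tendsto_add[OF f(2) g(2)]]
        limI[OF mult[OF f(1) g(1)] tendsto_mult[OF f(2) g(2)]] by blast
  qed
  moreover have "c *\<^sub>C x \<in> closure S \<and> adj x \<in> closure S" if x: "x \<in> closure S" for c x
  proof -
    obtain f where f: "\<And>n. f n \<in> S" "f \<longlonglongrightarrow> x" using x unfolding closure_sequential by blast
    show ?thesis
      using limI[OF scaleC[OF f(1)] tendsto_scaleC[OF f(2)]] limI[OF adj[OF f(1)] tendsto_adj[OF f(2)]]
      by blast
  qed
  moreover have "1 \<in> closure S" using one closure_subset by blast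
  ultimately show ?thesis unfolding cstar_subalgebra_def by simp
qed

lemma cstar_generated_least: "cstar_subalgebra B \<Longrightarrow> S \<subseteq> B \<Longrightarrow> cstar_generated S \<subseteq> B"
  by (auto simp: cstar_generated_def)

lemma cstar_generated_subset: "S \<subseteq> cstar_generated S"
  by (auto simp: cstar_generated_def)

lemma cstar_subalgebra_generated: "cstar_subalgebra (cstar_generated S)"
  unfolding cstar_subalgebra_def cstar_generated_def by (auto intro!: closed_Inter)

lemma cstar_subalgebra_car_sub: "cstar_subalgebra (car_sub a I)"
  by (simp add: car_sub_def cstar_subalgebra_generated)

lemma car_sub_generator: "i \<in> I \<Longrightarrow> a i \<in> car_sub a I"
  unfolding car_sub_def by (rule subsetD[OF cstar_generated_subset]) simp

lemma car_sub_least: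
  assumes "cstar_subalgebra B" "\<And>i. i \<in> I \<Longrightarrow> a i \<in> B" shows "car_sub a I \<subseteq> B"
proof -
  interpret cstar_sub B using assms(1) by unfold_locales
  show ?thesis unfolding car_sub_def using assms by (intro cstar_generated_least) auto
qed

lemma car_sub_mono: "I \<subseteq> J \<Longrightarrow> car_sub a I \<subseteq> car_sub a J"
  by (intro car_sub_least cstar_subalgebra_car_sub) (auto intro: car_sub_generator)

locale car =
  fixes a :: "nat \<Rightarrow> 'a::cstar_algebra" and \<Theta> :: "'a \<Rightarrow> 'a"
  assumes generators: "car_generators a" and parity: "parity_automorphism a \<Theta>"
begin

lemma automorphism: "star_automorphism \<Theta>"
  and \<Theta>_gen [simp]: "\<Theta> (a i) = - a i"
  and \<Theta>_add: "\<Theta> (x + y) = \<Theta> x + \<Theta> y"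
  and \<Theta>_scaleC: "\<Theta> (c *\<^sub>C x) = c *\<^sub>C \<Theta> x"
  and \<Theta>_mult: "\<Theta> (x * y) = \<Theta> x * \<Theta> y"
  and \<Theta>_adj: "\<Theta> (adj x) = adj (\<Theta> x)"
  using parity by (auto simp: parity_automorphism_def star_automorphism_def)

lemma \<Theta>_one [simp]: "\<Theta> 1 = 1"
  by (rule star_automorphism_one[OF automorphism])

lemma \<Theta>_minus: "\<Theta> (- x) = - \<Theta> x"
  using \<Theta>_scaleC[of "-1" x] by simp

lemma \<Theta>_diff: "\<Theta> (x - y) = \<Theta> x - \<Theta> y"
  using \<Theta>_add[of x "- y"] by (simp add: \<Theta>_minus)

lemma \<Theta>_zero [simp]: "\<Theta> 0 = 0"
  using \<Theta>_diff[of 1 1] by simp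

lemmas \<Theta>_hom = \<Theta>_add \<Theta>_scaleC \<Theta>_mult \<Theta>_adj \<Theta>_minus \<Theta>_diff

lemmas continuous_\<Theta> = bounded_linear.continuous_on[OF bounded_linear_star_automorphism[OF automorphism]]

lemma \<Theta>_involution [simp]: "\<Theta> (\<Theta> x) = x"
proof -
  have "cstar_subalgebra {x. \<Theta> (\<Theta> x) = x}"
    unfolding cstar_subalgebra_def
    by (auto simp: \<Theta>_hom intro!: closed_Collect_eq continuous_\<Theta> continuous_intros)
  then have "car_sub a UNIV \<subseteq> {x. \<Theta> (\<Theta> x) = x}"
    by (rule car_sub_least) (simp add: \<Theta>_minus)
  moreover have "car_sub a UNIV = UNIV"
    using generators by (simp add: car_sub_def car_generators_def)
  ultimately show ?thesis by auto
qed

lemma \<Theta>_mem: "x \<in> car_sub a I \<Longrightarrow> \<Theta> x \<in> car_sub a I"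
proof -
  interpret cstar_sub "car_sub a I" using cstar_subalgebra_car_sub by unfold_locales
  have "closed (\<Theta> -` car_sub a I)"
    by (rule closed_vimage[OF closed]) (intro continuous_\<Theta> continuous_intros)
  then have "cstar_subalgebra (\<Theta> -` car_sub a I)"
    unfolding cstar_subalgebra_def by (simp add: \<Theta>_hom)
  then have "car_sub a I \<subseteq> \<Theta> -` car_sub a I"
    by (rule car_sub_least) (simp add: car_sub_generator)
  then show "x \<in> car_sub a I \<Longrightarrow> \<Theta> x \<in> car_sub a I" by blast
qed

section \<open>Even and odd parts, and graded commutation\<close>

definition ev :: "'a \<Rightarrow> 'a" where "ev x = (1/2) *\<^sub>C (x + \<Theta> x)"
definition od :: "'a \<Rightarrow> 'a" where "od x = (1/2) *\<^sub>C (x - \<Theta> x)"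

lemma ev_od: "ev x + od x = x"
  using scaleC_add_left[of "1/2" "1/2" x]
  unfolding ev_def od_def by (simp add: scaleC_add_right scaleC_diff_right)

lemma \<Theta>_ev [simp]: "\<Theta> (ev x) = ev x"
  by (simp add: ev_def \<Theta>_hom add.commute)

lemma \<Theta>_od [simp]: "\<Theta> (od x) = - od x"
  by (simp add: od_def \<Theta>_hom flip: scaleC_minus_right)

lemma ev_mem: "x \<in> car_sub a I \<Longrightarrow> ev x \<in> car_sub a I"
  and od_mem: "x \<in> car_sub a I \<Longrightarrow> od x \<in> car_sub a I"
proof -
  interpret cstar_sub "car_sub a I" using cstar_subalgebra_car_sub by unfold_locales
  show "x \<in> car_sub a I \<Longrightarrow> ev x \<in> car_sub a I" "x \<in> car_sub a I \<Longrightarrow> od x \<in> car_sub a I"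
    using \<Theta>_mem by (auto simp: ev_def od_def)
qed

lemma even_iff: "ev x = x \<longleftrightarrow> \<Theta> x = x"
  using \<Theta>_ev[of x] scaleC_add_left[of "1/2" "1/2" x] by (auto simp: ev_def scaleC_add_right)

lemma cstar_subalgebra_car_even: "cstar_subalgebra (car_even a \<Theta> I)"
proof -
  interpret cstar_sub "car_sub a I" using cstar_subalgebra_car_sub by unfold_locales
  have "closed {x. \<Theta> x = x}" by (intro closed_Collect_eq continuous_\<Theta> continuous_intros)
  then have "closed (car_sub a I \<inter> {x. \<Theta> x = x})" using closed by (intro closed_Int)
  then show ?thesis unfolding cstar_subalgebra_def car_even_def by (simp add: \<Theta>_hom Int_def)
qed

text \<open>A generation argument in \<open>y\<close>. The set of \<open>y\<close> that pass both
  \<open>a i\<close> and \<open>adj (a i)\<close> at the cost of \<Theta> is a closed subalgebra;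
  the two conditions are kept together because taking adjoints exchanges them.\<close>

lemma anticommute_generator:
  assumes IJ: "I \<inter> J = {}" and i: "i \<in> I" and y: "y \<in> car_sub a J"
  shows "y * a i = a i * \<Theta> y"
proof -
  let ?C = "{y. y * a i = a i * \<Theta> y} \<inter> {y. y * adj (a i) = adj (a i) * \<Theta> y}"
  have ac: "a j * a i = - (a i * a j)" "a j * adj (a i) = - (adj (a i) * a j)" if "j \<in> J" for j
  proof -
    have "anticommutator (a j) (a i) = 0" "anticommutator (adj (a i)) (a j) = 0"
      using generators IJ i that by (auto simp: car_generators_def)
    then show "a j * a i = - (a i * a j)" "a j * adj (a i) = - (adj (a i) * a j)"
      by (auto simp: anticommutator_def eq_neg_iff_add_eq_0 add.commute)
  qed
  have adj1: "adj y * a i = a i * \<Theta> (adj y)" if "y * adj (a i) = adj (a i) * \<Theta> y" for y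
  proof -
    have "\<Theta> (adj (y * adj (a i))) = \<Theta> (adj (adj (a i) * \<Theta> y))" using that by simp
    then show ?thesis by (simp add: adj_mult adj_adj \<Theta>_hom)
  qed
  have adj2: "adj y * adj (a i) = adj (a i) * \<Theta> (adj y)" if "y * a i = a i * \<Theta> y" for y
  proof -
    have "\<Theta> (adj (y * a i)) = \<Theta> (adj (a i * \<Theta> y))" using that by simp
    then show ?thesis by (simp add: adj_mult adj_adj \<Theta>_hom)
  qed
  have mult: "y * y' * u = u * \<Theta> (y * y')" if "y * u = u * \<Theta> y" "y' * u = u * \<Theta> y'" for y y' u
  proof -
    have "y * y' * u = y * (u * \<Theta> y')" by (simp only: that(2) mult.assoc)
    also have "\<dots> = (y * u) * \<Theta> y'" by (simp only: mult.assoc)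
    also have "\<dots> = u * \<Theta> (y * y')" by (simp only: that(1) mult.assoc \<Theta>_mult)
    finally show ?thesis .
  qed
  have "closed ?C"
    by (intro closed_Int closed_Collect_eq continuous_\<Theta> continuous_intros)
  then have "cstar_subalgebra ?C"
    unfolding cstar_subalgebra_def using adj1 adj2 mult
    by (auto simp: \<Theta>_add \<Theta>_scaleC ring_distribs scaleC_mult_left scaleC_mult_right)
  then have "car_sub a J \<subseteq> ?C" by (rule car_sub_least) (use ac in auto)
  then show ?thesis using y by blast
qed

text \<open>A second generation argument, now in \<open>x\<close>. The set quantifies over all even
  and all odd \<open>y\<close> because taking the adjoint of \<open>x\<close> replaces
  \<open>y\<close> by \<open>adj y\<close>; on generators the claim is
  \<open>anticommute_generator\<close>.\<close>

lemma graded_commute: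
  assumes IJ: "I \<inter> J = {}" and x: "x \<in> car_sub a I" and y: "y \<in> car_sub a J"
  shows "\<Theta> y = y \<Longrightarrow> y * x = x * y" "\<Theta> y = - y \<Longrightarrow> y * x = \<Theta> x * y"
proof -
  interpret J: cstar_sub "car_sub a J" using cstar_subalgebra_car_sub by unfold_locales
  let ?C = "(\<Inter>y\<in>{y\<in>car_sub a J. \<Theta> y = y}. {x. y * x = x * y}) \<inter>
    (\<Inter>y\<in>{y\<in>car_sub a J. \<Theta> y = - y}. {x. y * x = \<Theta> x * y})"
  have adj1: "y * adj x = adj x * y" if x: "x \<in> ?C" and y: "y \<in> car_sub a J" "\<Theta> y = y" for x y
  proof -
    have "adj y * x = x * adj y" using x y by (auto simp: \<Theta>_adj)
    then have "adj (adj y * x) = adj (x * adj y)" by simp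
    then show ?thesis by (simp add: adj_mult adj_adj)
  qed
  have adj2: "y * adj x = \<Theta> (adj x) * y" if x: "x \<in> ?C" and y: "y \<in> car_sub a J" "\<Theta> y = - y" for x y
  proof -
    have "adj y * x = \<Theta> x * adj y" using x y by (auto simp: \<Theta>_adj)
    then have "\<Theta> (adj (adj y * x)) = \<Theta> (adj (\<Theta> x * adj y))" by simp
    then show ?thesis using y(2) by (simp add: adj_mult adj_adj \<Theta>_hom)
  qed
  have mult1: "y * (x * x') = x * x' * y" if "y * x = x * y" "y * x' = x' * y" for x x' y :: 'a
  proof -
    have "y * (x * x') = (y * x) * x'" by (simp only: mult.assoc)
    also have "\<dots> = x * (y * x')" by (simp only: that(1) mult.assoc)
    also have "\<dots> = x * x' * y" by (simp only: that(2) mult.assoc)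
    finally show ?thesis .
  qed
  have mult2: "y * (x * x') = \<Theta> (x * x') * y" if "y * x = \<Theta> x * y" "y * x' = \<Theta> x' * y" for x x' y
  proof -
    have "y * (x * x') = (y * x) * x'" by (simp only: mult.assoc)
    also have "\<dots> = \<Theta> x * (y * x')" by (simp only: that(1) mult.assoc)
    also have "\<dots> = \<Theta> (x * x') * y" by (simp only: that(2) mult.assoc \<Theta>_mult)
    finally show ?thesis .
  qed
  have "closed ?C"
    by (intro closed_Int closed_INT ballI closed_Collect_eq continuous_\<Theta> continuous_intros)
  moreover have "adj x \<in> ?C" if "x \<in> ?C" for x using adj1[OF that] adj2[OF that] by blast
  ultimately have "cstar_subalgebra ?C"
    unfolding cstar_subalgebra_def
    by (intro conjI ballI allI) (auto simp: \<Theta>_add \<Theta>_scaleC ring_distribs scaleC_mult_left scaleC_mult_right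
        mult1 mult2)
  then have "car_sub a I \<subseteq> ?C"
    by (rule car_sub_least) (use anticommute_generator[OF IJ] in auto)
  then show "\<Theta> y = y \<Longrightarrow> y * x = x * y" "\<Theta> y = - y \<Longrightarrow> y * x = \<Theta> x * y" using x y by blast+
qed

lemma commute_split:
  assumes IJ: "I \<inter> J = {}" and x: "x \<in> car_sub a I" and y: "y \<in> car_sub a J"
  shows "y * x = x * ev y + \<Theta> x * od y"
proof -
  have "y * x = ev y * x + od y * x" by (simp add: ev_od flip: distrib_right)
  then show ?thesis using graded_commute[OF IJ x] ev_mem[OF y] od_mem[OF y] by simp
qed

definition products :: "nat set \<Rightarrow> nat set \<Rightarrow> 'a set" where
  "products I J = {x * y | x y. x \<in> car_sub a I \<and> y \<in> car_sub a J}"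

lemma productsI: "x \<in> car_sub a I \<Longrightarrow> y \<in> car_sub a J \<Longrightarrow> x * y \<in> span (products I J)"
  unfolding products_def by (rule span_base) blast

text \<open>\<open>commute_split\<close> rewrites a factor in the wrong order as a sum of products
  in the right order, so the span is closed under multiplication and adjoints. It is a real span;
  complex scalars are absorbed by the left factor.\<close>

lemma span_products_dense:
  assumes IJ: "I \<inter> J = {}" shows "car_sub a (I \<union> J) \<subseteq> closure (span (products I J))"
proof -
  interpret I: cstar_sub "car_sub a I" using cstar_subalgebra_car_sub by unfold_locales
  interpret J: cstar_sub "car_sub a J" using cstar_subalgebra_car_sub by unfold_locales
  let ?S = "span (products I J)"
  have sc: "c *\<^sub>C z \<in> ?S" if "z \<in> ?S" for c z
    using that
  proof (induction rule: span_induct)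
    case base
    show ?case
      by (auto simp: subspace_def scaleC_add_right scaleC_scaleR span_add span_zero span_scale)
  next
    case (step z)
    then obtain x y where z: "z = x * y" "x \<in> car_sub a I" "y \<in> car_sub a J" by (auto simp: products_def)
    then have "(c *\<^sub>C x) * y \<in> ?S" by (intro productsI) auto
    then show ?case by (simp add: z scaleC_mult_left)
  qed
  have adj: "adj z \<in> ?S" if "z \<in> ?S" for z
    using that
  proof (induction rule: span_induct)
    case base
    show ?case by (auto simp: subspace_def adj_add span_add span_zero span_scale)
  next
    case (step z)
    then obtain x y where z: "z = x * y" "x \<in> car_sub a I" "y \<in> car_sub a J" by (auto simp: products_def)
    have "adj z = adj x * ev (adj y) + \<Theta> (adj x) * od (adj y)"
      using commute_split[OF IJ, of "adj x" "adj y"] z by (simp add: adj_mult)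
    moreover have "\<dots> \<in> ?S" using z by (intro span_add productsI \<Theta>_mem ev_mem od_mem) auto
    ultimately show ?case by simp
  qed
  have mult1: "x * y * z' \<in> ?S" if xy: "x \<in> car_sub a I" "y \<in> car_sub a J" and "z' \<in> ?S" for x y z'
    using that(3)
  proof (induction rule: span_induct)
    case base
    show ?case by (auto simp: subspace_def distrib_left span_add span_zero span_scale)
  next
    case (step z)
    then obtain x' y' where z: "z = x' * y'" "x' \<in> car_sub a I" "y' \<in> car_sub a J" by (auto simp: products_def)
    have "x * y * z = x * (y * x') * y'" by (simp add: z mult.assoc)
    also have "\<dots> = (x * x') * (ev y * y') + (x * \<Theta> x') * (od y * y')"
      unfolding commute_split[OF IJ z(2) xy(2)] by (simp add: ring_distribs mult.assoc)
    also have "\<dots> \<in> ?S" using xy z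
      by (intro span_add productsI I.mult_mem J.mult_mem \<Theta>_mem ev_mem od_mem)
    finally show ?case .
  qed
  have mult: "z * z' \<in> ?S" if "z \<in> ?S" and z': "z' \<in> ?S" for z z'
    using that(1)
  proof (induction rule: span_induct)
    case base
    show ?case by (auto simp: subspace_def distrib_right span_add span_zero span_scale)
  next
    case (step z)
    then show ?case using mult1[OF _ _ z'] by (auto simp: products_def)
  qed
  have one: "1 \<in> ?S" using productsI[OF I.one_mem J.one_mem] by simp
  have "cstar_subalgebra (closure ?S)"
    by (rule cstar_subalgebra_closure[OF one span_add sc mult adj])
  then show ?thesis
  proof (rule car_sub_least)
    fix i assume "i \<in> I \<union> J"
    then have "a i \<in> ?S"
      using productsI[OF car_sub_generator J.one_mem] productsI[OF I.one_mem car_sub_generator] by auto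
    then show "a i \<in> closure ?S" using closure_subset by blast
  qed
qed

lemma products_approximate:
  assumes "I \<inter> J = {}" "z \<in> car_sub a (I \<union> J)"
  obtains w where "\<And>n. w n \<in> span (products I J)" "w \<longlonglongrightarrow> z"
proof -
  have "z \<in> closure (span (products I J))" using span_products_dense assms by blast
  then show ?thesis using that unfolding closure_sequential by blast
qed

lemma functional_eq_on_products:
  assumes IJ: "I \<inter> J = {}"
    and f: "functional_on (car_sub a (I \<union> J)) f" "\<And>x. x \<in> car_sub a (I \<union> J) \<Longrightarrow> cmod (f x) \<le> K * norm x"
    and zero: "\<And>x y. x \<in> car_sub a I \<Longrightarrow> y \<in> car_sub a J \<Longrightarrow> f (x * y) = 0"
    and z: "z \<in> car_sub a (I \<union> J)"
  shows "f z = 0"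
proof -
  interpret cstar_functional "car_sub a (I \<union> J)" f
    using cstar_subalgebra_car_sub f(1) by unfold_locales
  have sub: "car_sub a I \<subseteq> car_sub a (I \<union> J)" "car_sub a J \<subseteq> car_sub a (I \<union> J)"
    by (intro car_sub_mono; blast)+
  have S: "w \<in> car_sub a (I \<union> J) \<and> f w = 0" if "w \<in> span (products I J)" for w
    using that
  proof (induction rule: span_induct)
    case base
    show ?case by (auto simp: subspace_def map_linear)
  next
    case (step z)
    then show ?case using zero sub by (auto simp: products_def)
  qed
  obtain w where w: "\<And>n. w n \<in> span (products I J)" "w \<longlonglongrightarrow> z"
    using products_approximate[OF IJ z] by metis
  have "(\<lambda>n. K * norm (z - w n)) \<longlonglongrightarrow> K * norm (z - z)" by (intro tendsto_intros w(2))
  moreover have "cmod (f z) \<le> K * norm (z - w n)" for n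
    using f(2)[of "z - w n"] S[OF w(1)[of n]] z by (simp add: map_diff)
  ultimately have "cmod (f z) \<le> K * norm (z - z)" by (intro LIMSEQ_le_const) auto
  then show ?thesis by simp
qed

lemma state_comp_\<Theta>:
  assumes "state_on (car_sub a I) \<sigma>" shows "state_on (car_sub a I) (\<sigma> \<circ> \<Theta>)"
  using assms \<Theta>_mem unfolding state_on_def by (auto simp: \<Theta>_hom)

lemma even_zero_on_odd:
  assumes "cstar_functional (car_sub a J) \<sigma>" "even_on (car_sub a J) \<Theta> \<sigma>" "y \<in> car_sub a J" "\<Theta> y = - y"
  shows "\<sigma> y = 0"
proof -
  interpret cstar_functional "car_sub a J" \<sigma> by (rule assms(1))
  have "\<sigma> y = - \<sigma> y" using assms(2-4) map_minus unfolding even_on_def by metis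
  then show ?thesis by simp
qed

text \<open>Moving \<open>adj y\<close> past \<open>adj x * x'\<close> leaves its even part alone
  and costs a \<Theta> for its odd part; products of mixed parity vanish under the even \<tau>. So
  the matrix of \<open>f\<close> on a sum of products is the sum of two Schur products, one of
  \<sigma> with the even parts and one of \<sigma> \<circ> \<Theta> with the odd parts. Boundedness
  of \<open>f\<close> carries positivity to the closure.\<close>

lemma product_functional_state:
  assumes IJ: "I \<inter> J = {}" and \<sigma>: "state_on (car_sub a I) \<sigma>" and \<tau>: "state_on (car_sub a J) \<tau>"
    and even: "even_on (car_sub a J) \<Theta> \<tau>"
    and f: "functional_on (car_sub a (I \<union> J)) f" "\<And>x. x \<in> car_sub a (I \<union> J) \<Longrightarrow> cmod (f x) \<le> K * norm x"
    and prod: "\<And>x y. x \<in> car_sub a I \<Longrightarrow> y \<in> car_sub a J \<Longrightarrow> f (x * y) = \<sigma> x * \<tau> y"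
  shows "state_on (car_sub a (I \<union> J)) f"
proof -
  interpret s: cstar_state "car_sub a I" \<sigma> using cstar_subalgebra_car_sub \<sigma> by (rule cstar_stateI)
  interpret s': cstar_state "car_sub a I" "\<sigma> \<circ> \<Theta>"
    using cstar_subalgebra_car_sub state_comp_\<Theta>[OF \<sigma>] by (rule cstar_stateI)
  interpret t: cstar_state "car_sub a J" \<tau> using cstar_subalgebra_car_sub \<tau> by (rule cstar_stateI)
  interpret cstar_functional "car_sub a (I \<union> J)" f
    using cstar_subalgebra_car_sub f(1) by unfold_locales
  let ?B = "car_sub a (I \<union> J)"
  have sub: "x \<in> car_sub a I \<Longrightarrow> x \<in> ?B" "y \<in> car_sub a J \<Longrightarrow> y \<in> ?B" for x y
    using car_sub_mono[of I "I \<union> J" a] car_sub_mono[of J "I \<union> J" a] by blast+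
  have odd0: "\<tau> y = 0" if "y \<in> car_sub a J" "\<Theta> y = - y" for y
    using even_zero_on_odd[OF t.cstar_functional_axioms even that] .
  have expand: "f (adj (x * y) * (x' * y')) = \<sigma> (adj x * x') * \<tau> (adj (ev y) * ev y')
      + (\<sigma> \<circ> \<Theta>) (adj x * x') * \<tau> (adj (od y) * od y')"
    if x: "x \<in> car_sub a I" "x' \<in> car_sub a I" and y: "y \<in> car_sub a J" "y' \<in> car_sub a J" for x x' y y'
  proof -
    let ?w = "adj x * x'"
    have w: "?w \<in> car_sub a I" using x by blast
    have e: "ev (adj y) = adj (ev y)" and o: "od (adj y) = adj (od y)"
      by (simp_all add: ev_def od_def adj_scaleC adj_add adj_diff \<Theta>_adj)
    note mem = ev_mem[OF y(1)] ev_mem[OF y(2)] od_mem[OF y(1)] od_mem[OF y(2)] \<Theta>_mem[OF w]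
    have "adj (x * y) * (x' * y') = (adj y * ?w) * y'" by (simp add: adj_mult mult.assoc)
    also have "adj y * ?w = ?w * adj (ev y) + \<Theta> ?w * adj (od y)"
      using commute_split[OF IJ w t.adj_mem[OF y(1)]] by (simp only: e o)
    also have "(?w * adj (ev y) + \<Theta> ?w * adj (od y)) * y' =
        ?w * (adj (ev y) * y') + \<Theta> ?w * (adj (od y) * y')" by (simp add: ring_distribs mult.assoc)
    also have "f \<dots> = \<sigma> ?w * \<tau> (adj (ev y) * y') + \<sigma> (\<Theta> ?w) * \<tau> (adj (od y) * y')"
      using mem w y sub by (simp add: map_add prod)
    also have "\<tau> (adj (ev y) * y') = \<tau> (adj (ev y) * ev y') + \<tau> (adj (ev y) * od y')"
      using mem by (simp add: ev_od t.map_add[symmetric] flip: distrib_left)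
    also have "\<tau> (adj (ev y) * od y') = 0"
      using mem by (intro odd0) (auto simp: \<Theta>_mult \<Theta>_adj)
    also have "\<tau> (adj (od y) * y') = \<tau> (adj (od y) * ev y') + \<tau> (adj (od y) * od y')"
      using mem by (simp add: ev_od t.map_add[symmetric] flip: distrib_left)
    also have "\<tau> (adj (od y) * ev y') = 0"
      using mem by (intro odd0) (auto simp: \<Theta>_mult \<Theta>_adj)
    finally show ?thesis by simp
  qed
  have pos: "z \<in> ?B \<and> f (adj z * z) \<in> \<real>\<^sub>\<ge>\<^sub>0" if z0: "z \<in> span (products I J)" for z
  proof -
    obtain t r where t: "finite t" "t \<subseteq> products I J" "z = (\<Sum>b\<in>t. r b *\<^sub>R b)"
      using z0 unfolding span_explicit by blast
    \<comment> \<open>The real coefficients go into the left factor.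
      \<open>Schur_product_nonneg\<close> wants families of algebra elements at every index, so
      indices outside \<open>t\<close> receive factors as well.\<close>
    have "\<forall>b. \<exists>x y. x \<in> car_sub a I \<and> y \<in> car_sub a J \<and> (b \<in> t \<longrightarrow> r b *\<^sub>R b = x * y)"
    proof
      fix b
      show "\<exists>x y. x \<in> car_sub a I \<and> y \<in> car_sub a J \<and> (b \<in> t \<longrightarrow> r b *\<^sub>R b = x * y)"
      proof (cases "b \<in> t")
        case True
        then obtain x y where "b = x * y" "x \<in> car_sub a I" "y \<in> car_sub a J"
          using t(2) unfolding products_def by blast
        then show ?thesis by (intro exI[of _ "r b *\<^sub>R x"] exI[of _ y]) simp
      next
        case False
        then show ?thesis using s.one_mem t.one_mem by blast
      qed
    qed
    then obtain x y where xy: "\<And>b. x b \<in> car_sub a I" "\<And>b. y b \<in> car_sub a J"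
      "\<And>b. b \<in> t \<Longrightarrow> r b *\<^sub>R b = x b * y b" by metis
    have z: "z = (\<Sum>b\<in>t. x b * y b)" using t(3) xy(3) by simp
    note xyB = sub(1)[OF xy(1)] sub(2)[OF xy(2)]
    have zB: "z \<in> ?B" unfolding z by (intro sum_mem mult_mem xyB)
    have "f (adj z * z) = (\<Sum>i\<in>t. \<Sum>j\<in>t. f (adj (x i * y i) * (x j * y j)))"
      unfolding z using xyB by (simp add: adj_sum sum_product map_sum sum_mem)
    also have "\<dots> = (\<Sum>i\<in>t. \<Sum>j\<in>t. \<sigma> (adj (x i) * x j) * \<tau> (adj (ev (y i)) * ev (y j)))
        + (\<Sum>i\<in>t. \<Sum>j\<in>t. (\<sigma> \<circ> \<Theta>) (adj (x i) * x j) * \<tau> (adj (od (y i)) * od (y j)))"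
      using xy by (simp only: expand sum.distrib)
    also have "\<dots> \<in> \<real>\<^sub>\<ge>\<^sub>0"
      using Schur_product_nonneg[OF s.cstar_state_axioms t.cstar_state_axioms t(1) xy(1) ev_mem[OF xy(2)]]
        Schur_product_nonneg[OF s'.cstar_state_axioms t.cstar_state_axioms t(1) xy(1) od_mem[OF xy(2)]]
      by (rule nonneg_Reals_add_I)
    finally show ?thesis using zB by blast
  qed
  have "f (adj z * z) \<in> \<real>\<^sub>\<ge>\<^sub>0" if z: "z \<in> ?B" for z
  proof -
    obtain w where w: "\<And>n. w n \<in> span (products I J)" "w \<longlonglongrightarrow> z"
      using products_approximate[OF IJ z] by metis
    have lim: "(\<lambda>n. adj (w n) * w n) \<longlonglongrightarrow> adj z * z" by (intro tendsto_intros tendsto_adj w(2))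
    have "(\<lambda>n. f (adj (w n) * w n) - f (adj z * z)) \<longlonglongrightarrow> 0"
    proof (rule Lim_null_comparison)
      show "\<forall>\<^sub>F n in sequentially. norm (f (adj (w n) * w n) - f (adj z * z)) \<le> K * norm (adj (w n) * w n - adj z * z)"
        using f(2)[of "adj (w n) * w n - adj z * z" for n] pos[OF w(1)] z by (simp add: map_diff)
      have "(\<lambda>n. K * norm (adj (w n) * w n - adj z * z)) \<longlonglongrightarrow> K * norm (adj z * z - adj z * z)"
        by (intro tendsto_intros lim)
      then show "(\<lambda>n. K * norm (adj (w n) * w n - adj z * z)) \<longlonglongrightarrow> 0" by simp
    qed
    then have "(\<lambda>n. f (adj (w n) * w n)) \<longlonglongrightarrow> f (adj z * z)" by (simp add: LIM_zero_iff)
    then show ?thesis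
      by (rule closed_sequentially[OF closed_nonneg_Reals_complex, rotated]) (use pos[OF w(1)] in blast)
  qed
  moreover have "f 1 = 1" using prod[of 1 1] by simp
  ultimately show ?thesis unfolding state_on_def using map_add map_scaleC by blast
qed

end

section \<open>Product states\<close>

text \<open>A decomposition can be read with its components exchanged and \<open>t\<close> replaced
  by \<open>1 - t\<close>, so treating the first component is enough.\<close>

lemma pure_state_onI:
  assumes \<phi>: "state_on B \<phi>"
    and eq: "\<And>\<psi> \<omega> t x. state_on B \<psi> \<Longrightarrow> state_on B \<omega> \<Longrightarrow> 0 < t \<Longrightarrow> t < 1 \<Longrightarrow>
      (\<And>x. x \<in> B \<Longrightarrow> \<phi> x = complex_of_real t * \<psi> x + complex_of_real (1 - t) * \<omega> x) \<Longrightarrow>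
      x \<in> B \<Longrightarrow> \<psi> x = \<phi> x"
  shows "pure_state_on B \<phi>"
  unfolding pure_state_on_def
proof (intro conjI allI impI ballI \<phi>)
  fix \<psi> \<omega> t x
  assume a: "state_on B \<psi> \<and> state_on B \<omega> \<and> 0 < t \<and> t < 1 \<and>
      (\<forall>x\<in>B. \<phi> x = complex_of_real t * \<psi> x + complex_of_real (1 - t) * \<omega> x)" and x: "x \<in> B"
  show "\<psi> x = \<phi> x" by (rule eq[of \<psi> \<omega> t]) (use a x in auto)
  show "\<omega> x = \<phi> x" by (rule eq[of \<omega> \<psi> "1 - t"]) (use a x in auto)
qed

lemma state_on_subset:
  "state_on B \<phi> \<Longrightarrow> B' \<subseteq> B \<Longrightarrow> state_on B' \<phi>"
  unfolding state_on_def by blast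

lemma (in cstar_state) convex_component_seminorm:
  assumes \<psi>: "state_on B \<psi>" and \<omega>: "state_on B \<omega>" and t: "0 < t" "t < 1"
    and dec: "\<And>x. x \<in> B \<Longrightarrow> \<phi> x = complex_of_real t * \<psi> x + complex_of_real (1 - t) * \<omega> x"
    and x: "x \<in> B"
  shows "gns_seminorm \<psi> x \<le> 1 / sqrt t * p x"
proof -
  interpret n: cstar_state B \<psi> using subalgebra \<psi> by (rule cstar_stateI)
  interpret w: cstar_state B \<omega> using subalgebra \<omega> by (rule cstar_stateI)
  have "Re (\<phi> (adj x * x)) = t * Re (\<psi> (adj x * x)) + (1 - t) * Re (\<omega> (adj x * x))"
    using x by (simp add: dec)
  then have "t * (n.p x)\<^sup>2 \<le> (p x)\<^sup>2"
    using x t w.Re_positive[OF x] by (simp add: seminorm_sq n.seminorm_sq)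
  then have "sqrt (t * (n.p x)\<^sup>2) \<le> sqrt ((p x)\<^sup>2)" by (rule real_sqrt_le_mono)
  then show ?thesis using x t by (simp add: real_sqrt_mult field_simps)
qed

text \<open>A Radon-Nikodym theorem in vector form: a component of \<phi> is x \<mapsto>
  \<langle>\<Omega>, x v\<rangle> for the class \<open>v\<close> of \<open>\<eta>\<close>. As
  \<open>\<eta>\<close> consists of elements of \<open>B\<close>, the same formula still makes sense
  on a larger algebra with a state extending \<phi>, and there it extends the component.\<close>

lemma (in cstar_state) convex_component_vector:
  assumes \<psi>: "state_on B \<psi>" and \<omega>: "state_on B \<omega>" and t: "0 < t" "t < 1"
    and dec: "\<And>x. x \<in> B \<Longrightarrow> \<phi> x = complex_of_real t * \<psi> x + complex_of_real (1 - t) * \<omega> x"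
  obtains \<eta> where "\<eta> \<in> gns_cauchy B \<phi>" "\<And>x. x \<in> B \<Longrightarrow> (\<lambda>k. \<phi> (x * \<eta> k)) \<longlonglongrightarrow> \<psi> x"
proof -
  interpret n: cstar_state B \<psi> using subalgebra \<psi> by (rule cstar_stateI)
  have hb: "cmod (\<psi> (adj x)) \<le> 1 / sqrt t * p x" if x: "x \<in> B" for x
    using n.Cauchy_Schwarz[OF x one_mem] convex_component_seminorm[OF assms x] by simp
  obtain \<eta> \<epsilon> where \<eta>: "\<And>k. \<eta> k \<in> B" "\<eta> \<in> gns_cauchy B \<phi>" "\<epsilon> \<longlonglongrightarrow> 0"
    and est: "\<And>k x. x \<in> B \<Longrightarrow> cmod (\<phi> (adj x * \<eta> k) - \<psi> (adj x)) \<le> \<epsilon> k * p x"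
    by (rule Riesz[of B "\<lambda>x. \<psi> (adj x)" "1 / sqrt t"])
      (use hb in \<open>auto simp: adj_add adj_scaleC n.map_linear\<close>)
  have "(\<lambda>k. \<phi> (x * \<eta> k)) \<longlonglongrightarrow> \<psi> x" if x: "x \<in> B" for x
  proof -
    have "(\<lambda>k. \<phi> (x * \<eta> k) - \<psi> x) \<longlonglongrightarrow> 0"
    proof (rule Lim_null_comparison)
      show "\<forall>\<^sub>F k in sequentially. norm (\<phi> (x * \<eta> k) - \<psi> x) \<le> \<epsilon> k * p (adj x)"
        using est[of "adj x"] x by (simp add: adj_adj)
      show "(\<lambda>k. \<epsilon> k * p (adj x)) \<longlonglongrightarrow> 0" using tendsto_mult_left_zero[OF \<eta>(3)] .
    qed
    then show ?thesis by (simp add: LIM_zero_iff)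
  qed
  from that[OF \<eta>(2) this] show ?thesis .
qed

section \<open>Extending states from the even part\<close>

lemma (in car) odd_unitary:
  assumes "j \<in> J"
  obtains u where "u \<in> car_sub a J" "adj u = u" "u * u = 1" "\<Theta> u = - u"
proof -
  interpret cstar_sub "car_sub a J" using cstar_subalgebra_car_sub by unfold_locales
  have g: "anticommutator (adj (a j)) (a j) = 1" "anticommutator (adj (a j)) (adj (a j)) = 0"
    "anticommutator (a j) (a j) = 0"
    using generators by (auto simp: car_generators_def)
  have sq: "a j * a j = 0" "adj (a j) * adj (a j) = 0"
    using g(2,3) scaleR_2[of "a j * a j"] scaleR_2[of "adj (a j) * adj (a j)"]
    by (auto simp: anticommutator_def)
  have "(a j + adj (a j)) * (a j + adj (a j)) = 1"
    using g(1) by (simp add: ring_distribs sq anticommutator_def add.commute)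
  moreover have "a j + adj (a j) \<in> car_sub a J" using car_sub_generator[OF assms] by blast
  ultimately show ?thesis
    using that[of "a j + adj (a j)"] by (simp add: adj_add adj_adj \<Theta>_hom add.commute)
qed

lemma (in car) car_even_iff: "x \<in> car_even a \<Theta> J \<longleftrightarrow> x \<in> car_sub a J \<and> \<Theta> x = x"
  by (simp add: car_even_def)

text \<open>An odd \<open>y\<close> satisfies \<open>y\<^sup>* y = (u y)\<^sup>* (u y)\<close> with \<open>u y\<close> even, for \<open>u = a\<^sub>j + a\<^sub>j\<^sup>*\<close>.\<close>

lemma (in car) state_on_even_extension:
  assumes \<psi>: "state_on (car_even a \<Theta> J) \<psi>"
  shows "state_on (car_sub a J) (\<lambda>x. \<psi> (ev x))" "even_on (car_sub a J) \<Theta> (\<lambda>x. \<psi> (ev x))"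
proof -
  interpret J: cstar_sub "car_sub a J" using cstar_subalgebra_car_sub by unfold_locales
  interpret e: cstar_state "car_even a \<Theta> J" \<psi> using cstar_subalgebra_car_even \<psi> by (rule cstar_stateI)
  have evE: "ev x \<in> car_even a \<Theta> J" if "x \<in> car_sub a J" for x
    using ev_mem[OF that] by (simp add: car_even_iff)
  have ev_add: "ev (x + y) = ev x + ev y" for x y
    by (simp add: ev_def \<Theta>_hom scaleC_add_right)
  have ev_sc: "ev (c *\<^sub>C x) = c *\<^sub>C ev x" for c x
    by (simp add: ev_def \<Theta>_hom scaleC_add_right scaleC_scaleC mult.commute)
  have sq: "\<psi> (adj y * y) \<in> \<real>\<^sub>\<ge>\<^sub>0" if y: "y \<in> car_sub a J" "\<Theta> y = - y" for y
  proof (cases "J = {}")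
    \<comment> \<open>There is no generator to build \<open>u\<close> from. Everything in the
      algebra is then even, so an odd \<open>y\<close> is 0.\<close>
    case True
    have "car_sub a J \<subseteq> {x. \<Theta> x = x}"
      by (rule car_sub_least)
        (use True in \<open>auto simp: cstar_subalgebra_def \<Theta>_hom intro!: closed_Collect_eq continuous_\<Theta> continuous_intros\<close>)
    then have "- y = y" using y by auto
    then have "y + y = 0" by (metis add.right_inverse)
    then have "2 *\<^sub>R y = 0" by (simp add: scaleR_2)
    then have "y = 0" by simp
    then show ?thesis by simp
  next
    case False
    then obtain u where u: "u \<in> car_sub a J" "adj u = u" "u * u = 1" "\<Theta> u = - u"
      using odd_unitary by blast
    have "u * y \<in> car_even a \<Theta> J" using u y by (simp add: car_even_iff \<Theta>_hom)
    from e.positive[OF this] show ?thesis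
      using u by (simp add: adj_mult mult.assoc) (simp flip: mult.assoc[of u u])
  qed
  have "\<psi> (ev (adj x * x)) \<in> \<real>\<^sub>\<ge>\<^sub>0" if x: "x \<in> car_sub a J" for x
  proof -
    define y z where "y = ev x" and "z = od x"
    have yz: "y \<in> car_sub a J" "\<Theta> y = y" "z \<in> car_sub a J" "\<Theta> z = - z"
      using x ev_mem od_mem by (simp_all add: y_def z_def)
    have "x = y + z" by (simp add: y_def z_def ev_od)
    then have "adj x * x = (adj y * y + adj z * z) + (adj y * z + adj z * y)"
      by (simp add: adj_add ring_distribs)
    moreover have "ev (adj y * z + adj z * y) = 0" using yz by (simp add: ev_def \<Theta>_hom)
    moreover have "ev (adj y * y + adj z * z) = adj y * y + adj z * z" using yz by (simp add: even_iff \<Theta>_hom)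
    ultimately have "ev (adj x * x) = adj y * y + adj z * z" by (simp add: ev_add)
    moreover have "adj y * y \<in> car_even a \<Theta> J" "adj z * z \<in> car_even a \<Theta> J"
      using yz by (simp_all add: car_even_iff \<Theta>_hom)
    ultimately have "\<psi> (ev (adj x * x)) = \<psi> (adj y * y) + \<psi> (adj z * z)" by (simp add: e.map_add)
    moreover have "\<psi> (adj y * y) \<in> \<real>\<^sub>\<ge>\<^sub>0" using yz by (intro e.positive) (simp add: car_even_iff)
    ultimately show ?thesis using sq yz by (simp add: nonneg_Reals_add_I)
  qed
  moreover have "ev 1 = 1" by (simp add: even_iff)
  ultimately show "state_on (car_sub a J) (\<lambda>x. \<psi> (ev x))"
    unfolding state_on_def using evE by (simp add: ev_add ev_sc e.map_linear)
  have "ev (\<Theta> x) = ev x" for x by (simp add: ev_def add.commute)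
  then show "even_on (car_sub a J) \<Theta> (\<lambda>x. \<psi> (ev x))" by (simp add: even_on_def)
qed

section \<open>Product states and purity of their factors\<close>

locale car_product = car +
  fixes I J :: "nat set" and \<phi>\<^sub>1 \<phi>\<^sub>2 \<phi> :: "'a \<Rightarrow> complex"
  assumes IJ: "I \<inter> J = {}"
    and state1: "state_on (car_sub a I) \<phi>\<^sub>1" and state2: "state_on (car_sub a J) \<phi>\<^sub>2"
    and even2: "even_on (car_sub a J) \<Theta> \<phi>\<^sub>2"
    and product: "product_state_extension a I J \<phi>\<^sub>1 \<phi>\<^sub>2 \<phi>"
begin

sublocale s1: cstar_state "car_sub a I" \<phi>\<^sub>1 using cstar_subalgebra_car_sub state1 by (rule cstar_stateI)
sublocale s2: cstar_state "car_sub a J" \<phi>\<^sub>2 using cstar_subalgebra_car_sub state2 by (rule cstar_stateI)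
sublocale s: cstar_state "car_sub a (I \<union> J)" \<phi>
  using cstar_subalgebra_car_sub product by (intro cstar_stateI) (auto simp: product_state_extension_def)

abbreviation "A \<equiv> car_sub a I"
abbreviation "C \<equiv> car_sub a J"
abbreviation "B \<equiv> car_sub a (I \<union> J)"
abbreviation "E \<equiv> car_even a \<Theta> J"

lemma A_B: "x \<in> A \<Longrightarrow> x \<in> B" and C_B: "x \<in> C \<Longrightarrow> x \<in> B" and E_C: "x \<in> E \<Longrightarrow> x \<in> C"
  using car_sub_mono[of I "I \<union> J" a] car_sub_mono[of J "I \<union> J" a] by (auto simp: car_even_iff)

lemma prod: "x \<in> A \<Longrightarrow> y \<in> C \<Longrightarrow> \<phi> (x * y) = \<phi>\<^sub>1 x * \<phi>\<^sub>2 y"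
  using product by (simp add: product_state_extension_def)

lemma \<phi>_A: "x \<in> A \<Longrightarrow> \<phi> x = \<phi>\<^sub>1 x"
  using prod[of x 1] by simp

lemma \<phi>_C: "x \<in> C \<Longrightarrow> \<phi> x = \<phi>\<^sub>2 x"
  using prod[of 1 x] by simp

lemma odd_zero: "y \<in> C \<Longrightarrow> \<Theta> y = - y \<Longrightarrow> \<phi>\<^sub>2 y = 0"
  using even_zero_on_odd[OF s2.cstar_functional_axioms even2] .

lemma \<phi>\<^sub>2_ev: "y \<in> C \<Longrightarrow> \<phi>\<^sub>2 (ev y) = \<phi>\<^sub>2 y"
  using odd_zero[of "od y"] s2.map_add[of "ev y" "od y"] ev_mem[of y J] od_mem[of y J] by (simp add: ev_od)

text \<open>Serves both factors: either the second states are all \<open>\<phi>\<^sub>2\<close>, or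
  the first are all \<open>\<phi>\<^sub>1\<close>. The functional \<open>f\<close>, z \<mapsto>
  \<langle>\<Omega>, z \<eta>\<rangle>, provides a bounded extension of the component to
  \<open>B\<close>; \<open>g\<close> is the rest of \<phi>, rescaled, and factorises by
  \<open>dec\<close>. \<open>product_functional_state\<close> makes both of them states, and then
  purity of \<phi> applies.\<close>

lemma product_decomposition:
  assumes pure: "pure_state_on B \<phi>"
    and \<sigma>: "state_on A \<sigma>" "state_on A \<sigma>'" and \<tau>: "state_on C \<tau>" "state_on C \<tau>'"
    and even: "even_on C \<Theta> \<tau>" "even_on C \<Theta> \<tau>'" and t: "0 < t" "t < 1"
    and \<eta>: "\<eta> \<in> gns_cauchy B \<phi>"
    and lim: "\<And>x y. x \<in> A \<Longrightarrow> y \<in> C \<Longrightarrow> (\<lambda>k. \<phi> (x * y * \<eta> k)) \<longlonglongrightarrow> \<sigma> x * \<tau> y"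
    and dec: "\<And>x y. x \<in> A \<Longrightarrow> y \<in> C \<Longrightarrow>
      \<phi>\<^sub>1 x * \<phi>\<^sub>2 y = complex_of_real t * (\<sigma> x * \<tau> y) + complex_of_real (1 - t) * (\<sigma>' x * \<tau>' y)"
    and x: "x \<in> A" and y: "y \<in> C"
  shows "\<sigma> x * \<tau> y = \<phi>\<^sub>1 x * \<phi>\<^sub>2 y"
proof -
  define f where "f z = lim (\<lambda>k. \<phi> (z * \<eta> k))" for z
  note \<eta>B = s.cauchy_mem[OF \<eta>]
  have f: "(\<lambda>k. \<phi> (z * \<eta> k)) \<longlonglongrightarrow> f z" if "z \<in> B" for z
    using s.cauchy_inner_convergent[OF s.cauchy_const[of "adj z"] \<eta>] that
    unfolding f_def by (simp add: adj_adj convergent_LIMSEQ_iff)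
  obtain K where K: "K > 0" "\<And>k. s.p (\<eta> k) \<le> K" using s.cauchy_bounded[OF \<eta>] by metis
  have f_fun: "functional_on B f"
    by (rule functional_on_limit[OF s.subalgebra _ f])
      (use \<eta>B in \<open>simp add: functional_on_def distrib_right scaleC_mult_left s.map_linear\<close>)
  interpret f: cstar_functional B f using f_fun by unfold_locales
  have f_bound: "cmod (f z) \<le> K * norm z" if z: "z \<in> B" for z
  proof (rule LIMSEQ_le_const2[OF tendsto_norm[OF f[OF z]]])
    have "cmod (\<phi> (z * \<eta> k)) \<le> K * norm z" for k
    proof -
      have "cmod (\<phi> (z * \<eta> k)) \<le> s.p (adj z) * s.p (\<eta> k)"
        using s.Cauchy_Schwarz[of "adj z" "\<eta> k"] z \<eta>B by (simp add: adj_adj)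
      also have "\<dots> \<le> norm z * K"
        using s.seminorm_le_norm[of "adj z"] K z \<eta>B by (intro mult_mono) auto
      finally show ?thesis by (simp add: mult.commute)
    qed
    then show "\<exists>N. \<forall>k\<ge>N. cmod (\<phi> (z * \<eta> k)) \<le> K * norm z" by blast
  qed
  have f_prod: "f (x * y) = \<sigma> x * \<tau> y" if "x \<in> A" "y \<in> C" for x y
    using LIMSEQ_unique[OF f lim] that A_B C_B by blast
  have f_state: "state_on B f"
    by (rule product_functional_state[OF IJ \<sigma>(1) \<tau>(1) even(1) f_fun f_bound f_prod])
  define g where "g z = (\<phi> z - complex_of_real t * f z) / complex_of_real (1 - t)" for z
  have t1: "complex_of_real (1 - t) \<noteq> 0" using t by (metis of_real_eq_0_iff diff_gt_0_iff_gt less_irrefl)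
  have g_fun: "functional_on B g"
    using t1 by (simp add: functional_on_def g_def s.map_linear f.map_linear diff_divide_distrib add_divide_distrib algebra_simps)
  have g_bound: "cmod (g z) \<le> ((1 + t * K) / (1 - t)) * norm z" if z: "z \<in> B" for z
  proof -
    have "cmod (\<phi> z - complex_of_real t * f z) \<le> cmod (\<phi> z) + cmod (complex_of_real t * f z)"
      by (rule norm_triangle_ineq4)
    also have "\<dots> \<le> norm z + t * (K * norm z)"
      using s.map_norm_le[OF z] f_bound[OF z] t by (simp add: norm_mult add_mono mult_left_mono)
    also have "\<dots> = (1 + t * K) * norm z" by (simp add: algebra_simps)
    finally show ?thesis
      using t unfolding g_def norm_divide by (simp add: divide_right_mono del: of_real_diff)
  qed
  have g_prod: "g (x * y) = \<sigma>' x * \<tau>' y" if "x \<in> A" "y \<in> C" for x y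
    using that t1 dec[OF that] by (simp add: g_def f_prod prod)
  have g_state: "state_on B g"
    by (rule product_functional_state[OF IJ \<sigma>(2) \<tau>(2) even(2) g_fun g_bound g_prod])
  have "\<forall>z\<in>B. f z = \<phi> z \<and> g z = \<phi> z"
    by (rule pure_state_onD[OF pure f_state g_state t]) (use t1 in \<open>simp add: g_def\<close>)
  then show ?thesis using f_prod[OF x y] prod[OF x y] A_B[OF x] C_B[OF y] by auto
qed

text \<open>Equality of the seminorms embeds the GNS space of the smaller algebra isometrically into
  that of \<phi>; used with \<open>S\<close> equal to \<open>A\<close> and to
  \<open>E\<close>.\<close>

lemma cauchy_transfer:
  assumes "X \<in> gns_cauchy S \<psi>" "\<And>x. x \<in> S \<Longrightarrow> x \<in> B"
    "\<And>x y. x \<in> S \<Longrightarrow> y \<in> S \<Longrightarrow> x - y \<in> S" "\<And>x. x \<in> S \<Longrightarrow> gns_seminorm \<psi> x = s.p x"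
  shows "X \<in> gns_cauchy B \<phi>"
proof -
  have X: "X n \<in> S" for n using assms(1) by (simp add: gns_cauchy_def)
  have "gns_seminorm \<psi> (X m - X n) = s.p (X m - X n)" for m n
    using assms(3,4) X by blast
  then show ?thesis using assms(1,2) X unfolding gns_cauchy_def by simp
qed

lemma pure_product_imp_pure1:
  assumes pure: "pure_state_on B \<phi>" shows "pure_state_on A \<phi>\<^sub>1"
proof (rule pure_state_onI[OF state1])
  fix \<psi> \<omega> t x
  assume \<psi>: "state_on A \<psi>" and \<omega>: "state_on A \<omega>" and t: "0 < t" "t < 1"
    and dec: "\<And>x. x \<in> A \<Longrightarrow> \<phi>\<^sub>1 x = complex_of_real t * \<psi> x + complex_of_real (1 - t) * \<omega> x"
    and x: "x \<in> A"
  obtain \<eta> where \<eta>: "\<eta> \<in> gns_cauchy A \<phi>\<^sub>1" and lim: "\<And>x. x \<in> A \<Longrightarrow> (\<lambda>k. \<phi>\<^sub>1 (x * \<eta> k)) \<longlonglongrightarrow> \<psi> x"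
    using s1.convex_component_vector[OF \<psi> \<omega> t dec] by metis
  note \<eta>A = s1.cauchy_mem[OF \<eta>]
  have \<eta>B: "\<eta> \<in> gns_cauchy B \<phi>"
    by (rule cauchy_transfer[OF \<eta>]) (use A_B \<phi>_A in \<open>auto simp: gns_seminorm_def\<close>)
  have "\<psi> x * \<phi>\<^sub>2 1 = \<phi>\<^sub>1 x * \<phi>\<^sub>2 1"
  proof (rule product_decomposition[OF pure \<psi> \<omega> state2 state2 even2 even2 t \<eta>B _ _ x s2.one_mem])
    fix x y assume x: "x \<in> A" and y: "y \<in> C"
    have "\<phi> (x * y * \<eta> k) = \<phi>\<^sub>1 (x * \<eta> k) * \<phi>\<^sub>2 y" for k
    proof -
      \<comment> \<open>Moving \<open>\<eta> k\<close> to the left of \<open>y\<close> twists it by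
        \<Theta> only next to \<open>od y\<close>, where \<open>\<phi>\<^sub>2\<close>
        vanishes.\<close>
      have "x * y * \<eta> k = (x * \<eta> k) * ev y + (x * \<Theta> (\<eta> k)) * od y"
        using commute_split[OF IJ \<eta>A y] by (simp add: mult.assoc distrib_left)
      moreover have "x * \<eta> k \<in> A" "x * \<Theta> (\<eta> k) \<in> A" using x \<eta>A \<Theta>_mem by auto
      moreover note ev_mem[OF y] od_mem[OF y]
      ultimately show ?thesis
        using odd_zero[of "od y"] \<phi>\<^sub>2_ev[OF y] by (simp add: s.map_add A_B C_B prod)
    qed
    then show "(\<lambda>k. \<phi> (x * y * \<eta> k)) \<longlonglongrightarrow> \<psi> x * \<phi>\<^sub>2 y" using lim[OF x] by (simp add: tendsto_mult_right)
    show "\<phi>\<^sub>1 x * \<phi>\<^sub>2 y = complex_of_real t * (\<psi> x * \<phi>\<^sub>2 y) + complex_of_real (1 - t) * (\<omega> x * \<phi>\<^sub>2 y)"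
      using x by (simp add: dec algebra_simps)
  qed
  then show "\<psi> x = \<phi>\<^sub>1 x" by simp
qed

lemma state_E: "state_on E \<phi>\<^sub>2"
  using state2 by (rule state_on_subset) (auto simp: E_C)

sublocale e: cstar_state E \<phi>\<^sub>2
  using cstar_subalgebra_car_even state_E by (rule cstar_stateI)

lemma pure_product_imp_pure_even:
  assumes pure: "pure_state_on B \<phi>" shows "pure_state_on E \<phi>\<^sub>2"
proof (rule pure_state_onI[OF state_E])
  fix \<psi> \<omega> t y
  assume \<psi>: "state_on E \<psi>" and \<omega>: "state_on E \<omega>" and t: "0 < t" "t < 1"
    and dec: "\<And>x. x \<in> E \<Longrightarrow> \<phi>\<^sub>2 x = complex_of_real t * \<psi> x + complex_of_real (1 - t) * \<omega> x"
    and y: "y \<in> E"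
  obtain \<eta> where \<eta>: "\<eta> \<in> gns_cauchy E \<phi>\<^sub>2" and lim: "\<And>x. x \<in> E \<Longrightarrow> (\<lambda>k. \<phi>\<^sub>2 (x * \<eta> k)) \<longlonglongrightarrow> \<psi> x"
    using e.convex_component_vector[OF \<psi> \<omega> t dec] by metis
  note \<eta>E = e.cauchy_mem[OF \<eta>]
  have \<eta>B: "\<eta> \<in> gns_cauchy B \<phi>"
    by (rule cauchy_transfer[OF \<eta>]) (use E_C C_B \<phi>_C in \<open>auto simp: gns_seminorm_def\<close>)
  \<comment> \<open>The components live on \<open>E\<close> only; composing them with
    \<open>ev\<close> gives the even states of \<open>C\<close> that
    \<open>product_decomposition\<close> requires.\<close>
  note ext = state_on_even_extension[OF \<psi>] state_on_even_extension[OF \<omega>]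
  have "\<phi>\<^sub>1 1 * \<psi> (ev y) = \<phi>\<^sub>1 1 * \<phi>\<^sub>2 y"
  proof (rule product_decomposition[OF pure state1 state1 ext(1,3,2,4) t \<eta>B _ _ s1.one_mem E_C[OF y]])
    fix x y assume x: "x \<in> A" and y: "y \<in> C"
    have evE: "ev y \<in> E" using ev_mem[OF y] by (simp add: car_even_iff)
    have "\<phi> (x * y * \<eta> k) = \<phi>\<^sub>1 x * \<phi>\<^sub>2 (ev y * \<eta> k)" for k
    proof -
      have \<eta>k: "\<eta> k \<in> C" "\<Theta> (\<eta> k) = \<eta> k" using \<eta>E[of k] by (auto simp: car_even_iff)
      have "\<phi> (x * y * \<eta> k) = \<phi>\<^sub>1 x * \<phi>\<^sub>2 (y * \<eta> k)"
        using prod[OF x, of "y * \<eta> k"] y \<eta>k by (simp add: mult.assoc)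
      also have "y * \<eta> k = ev y * \<eta> k + od y * \<eta> k" by (simp add: ev_od flip: distrib_right)
      also have "\<phi>\<^sub>2 \<dots> = \<phi>\<^sub>2 (ev y * \<eta> k)"
        using \<eta>k ev_mem[OF y] od_mem[OF y] odd_zero[of "od y * \<eta> k"] by (simp add: s2.map_add \<Theta>_mult)
      finally show ?thesis .
    qed
    then show "(\<lambda>k. \<phi> (x * y * \<eta> k)) \<longlonglongrightarrow> \<phi>\<^sub>1 x * \<psi> (ev y)" using lim[OF evE] by (simp add: tendsto_mult_left)
    show "\<phi>\<^sub>1 x * \<phi>\<^sub>2 y = complex_of_real t * (\<phi>\<^sub>1 x * \<psi> (ev y)) + complex_of_real (1 - t) * (\<phi>\<^sub>1 x * \<omega> (ev y))"
    proof -
      have "\<phi>\<^sub>1 x * \<phi>\<^sub>2 y =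
          \<phi>\<^sub>1 x * (complex_of_real t * \<psi> (ev y) + complex_of_real (1 - t) * \<omega> (ev y))"
        using dec[OF evE] \<phi>\<^sub>2_ev[OF y] by simp
      then show ?thesis by (simp only: distrib_left mult.left_commute)
    qed
  qed
  moreover have "ev y = y" using y by (simp add: even_iff car_even_iff)
  ultimately show "\<psi> y = \<phi>\<^sub>2 y" by simp
qed

section \<open>Purity of the product from purity of the factors\<close>

lemma seminorm_even:
  assumes x: "x \<in> A" and y: "y \<in> C" "\<Theta> y = y"
  shows "s.p (x * y) = s1.p x * s2.p y"
proof -
  have "adj (x * y) * (x * y) = (adj y * (adj x * x)) * y" by (simp add: adj_mult mult.assoc)
  also have "\<dots> = (adj x * x) * (adj y * y)"
    using graded_commute(1)[OF IJ, of "adj x * x" "adj y"] x y by (simp add: \<Theta>_hom mult.assoc)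
  finally have "(s.p (x * y))\<^sup>2 = Re (\<phi>\<^sub>1 (adj x * x) * \<phi>\<^sub>2 (adj y * y))"
    using x y by (simp add: s.seminorm_sq A_B C_B prod)
  also have "\<dots> = (s1.p x * s2.p y)\<^sup>2"
    using x y by (simp add: s1.map_adj_mult_self s2.map_adj_mult_self power_mult_distrib flip: of_real_power)
  finally show ?thesis using x y by (simp add: power2_eq_iff_nonneg A_B C_B)
qed

text \<open>Moving the odd \<open>adj y\<close> past \<open>adj x * x\<close> applies \<Theta> to
  the latter. An odd right factor thus trades the seminorm of \<open>\<phi>\<^sub>1\<close> for that
  of \<open>\<phi>\<^sub>1 \<circ> \<Theta>\<close>, which is where the disjointness hypothesis gets
  its hold.\<close>

lemma seminorm_odd:
  assumes x: "x \<in> A" and y: "y \<in> C" "\<Theta> y = - y"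
  shows "s.p (x * y) = gns_seminorm (\<phi>\<^sub>1 \<circ> \<Theta>) x * s2.p y"
proof -
  interpret t: cstar_state A "\<phi>\<^sub>1 \<circ> \<Theta>"
    using cstar_subalgebra_car_sub state_comp_\<Theta>[OF state1] by (rule cstar_stateI)
  have "adj (x * y) * (x * y) = (adj y * (adj x * x)) * y" by (simp add: adj_mult mult.assoc)
  also have "\<dots> = \<Theta> (adj x * x) * (adj y * y)"
    using graded_commute(2)[OF IJ, of "adj x * x" "adj y"] x y by (simp add: \<Theta>_hom mult.assoc)
  finally have "(s.p (x * y))\<^sup>2 = Re ((\<phi>\<^sub>1 \<circ> \<Theta>) (adj x * x) * \<phi>\<^sub>2 (adj y * y))"
    using x y \<Theta>_mem[of "adj x * x" I] by (simp add: s.seminorm_sq A_B C_B prod)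
  also have "\<dots> = (t.p x * s2.p y)\<^sup>2"
    using x y by (simp only: t.map_adj_mult_self s2.map_adj_mult_self power_mult_distrib of_real_mult[symmetric] Re_complex_of_real)
  finally show ?thesis using x y by (simp add: power2_eq_iff_nonneg A_B C_B)
qed

lemma pure_product_if:
  assumes pure1: "pure_state_on A \<phi>\<^sub>1" and pure2: "pure_state_on E \<phi>\<^sub>2"
    and dis: "disjoint_reps A (gns A \<phi>\<^sub>1) (gns A (\<phi>\<^sub>1 \<circ> \<Theta>))"
  shows "pure_state_on B \<phi>"
proof (rule pure_state_onI[OF s.state])
  fix \<psi> \<omega> t z
  assume \<psi>: "state_on B \<psi>" and \<omega>: "state_on B \<omega>" and t: "0 < t" "t < 1"
    and dec: "\<And>x. x \<in> B \<Longrightarrow> \<phi> x = complex_of_real t * \<psi> x + complex_of_real (1 - t) * \<omega> x"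
    and z: "z \<in> B"
  interpret n: cstar_state B \<psi> using cstar_subalgebra_car_sub \<psi> by (rule cstar_stateI)
  define r where "r = 1 / sqrt t"
  have r: "r \<ge> 0" using t by (simp add: r_def)
  have le: "n.p x \<le> r * s.p x" if "x \<in> B" for x
    using s.convex_component_seminorm[OF \<psi> \<omega> t dec that] by (simp add: r_def)
  have p_A: "s.p x = s1.p x" if "x \<in> A" for x using that by (simp add: gns_seminorm_def \<phi>_A)
  have EB: "E \<subseteq> B" using E_C C_B by blast
  have on_E: "\<psi> y = \<phi>\<^sub>2 y" if y: "y \<in> E" for y
  proof -
    have "\<forall>y\<in>E. \<psi> y = \<phi>\<^sub>2 y \<and> \<omega> y = \<phi>\<^sub>2 y"
      by (rule pure_state_onD[OF pure2 state_on_subset[OF \<psi> EB] state_on_subset[OF \<omega> EB] t])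
        (use dec[OF C_B[OF E_C]] \<phi>_C[OF E_C] in metis)
    then show ?thesis using y by blast
  qed
  have even: "\<psi> (x * y) = \<phi>\<^sub>1 x * \<phi>\<^sub>2 y" if x: "x \<in> A" and y: "y \<in> E" for x y
  proof -
    have yC: "y \<in> C" "\<Theta> y = y" using y by (auto simp: car_even_iff)
    \<comment> \<open>For fixed even \<open>y\<close>, \<open>seminorm_even\<close> pulls
      \<open>y\<close> out as a constant factor, so this functional of \<open>x\<close> is dominated
      by the pure state \<open>\<phi>\<^sub>1\<close>.\<close>
    have "\<psi> (x * y) = \<psi> (1 * y) * \<phi>\<^sub>1 x"
    proof (rule s1.pure_dominated[OF pure1 _ _ x])
      show "functional_on A (\<lambda>x. \<psi> (x * y))"
        using A_B C_B[OF yC(1)]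
        by (simp add: functional_on_def distrib_right scaleC_mult_left n.map_linear)
      fix x x' assume x: "x \<in> A" and x': "x' \<in> A"
      have "cmod (\<psi> (adj x * x' * y)) \<le> n.p x * n.p (x' * y)"
        using n.Cauchy_Schwarz[of x "x' * y"] x x' yC by (simp add: A_B C_B mult.assoc)
      also have "\<dots> \<le> (r * s.p x) * (r * s.p (x' * y))"
        using le x x' yC r by (intro mult_mono) (auto simp: A_B C_B)
      also have "\<dots> = (r * r * s2.p y) * s1.p x * s1.p x'"
        using seminorm_even[OF x' yC] p_A[OF x] by simp
      finally show "cmod (\<psi> (adj x * x' * y)) \<le> (r * r * s2.p y) * s1.p x * s1.p x'" .
    qed
    then show ?thesis using on_E[OF y] by simp
  qed
  have odd: "\<psi> (x * y) = 0" if x: "x \<in> A" and y: "y \<in> C" "\<Theta> y = - y" for x y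
  proof -
    define w where "w = adj y"
    have w: "w \<in> C" "\<Theta> w = - w" using y by (auto simp: w_def \<Theta>_adj)
    \<comment> \<open>\<open>\<psi> (adj w * (adj x * x'))\<close> is \<langle>x w, x'\<rangle> in
      the GNS space of \<psi>, with seminorm \<open>\<phi>\<^sub>1 \<circ> \<Theta>\<close> in
      \<open>x\<close> and \<open>\<phi>\<^sub>1\<close> in \<open>x'\<close>. The argument
      \<open>\<Theta> x\<close> is taken because \<open>y * \<Theta> x = x * y\<close> for odd
      \<open>y\<close>.\<close>
    have "\<psi> (adj w * \<Theta> x) = 0"
    proof (rule disjoint_reps_no_intertwiner[OF cstar_subalgebra_car_sub state_comp_\<Theta>[OF state1] pure1 dis _ _ \<Theta>_mem[OF x]])
      show "functional_on A (\<lambda>x. \<psi> (adj w * x))"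
        using A_B C_B[OF w(1)]
        by (simp add: functional_on_def distrib_left scaleC_mult_right n.map_linear)
      fix x x' assume x: "x \<in> A" and x': "x' \<in> A"
      have "cmod (\<psi> (adj w * (adj x * x'))) \<le> n.p (x * w) * n.p x'"
        using n.Cauchy_Schwarz[of "x * w" x'] x x' w by (simp add: A_B C_B adj_mult mult.assoc)
      also have "\<dots> \<le> (r * s.p (x * w)) * (r * s.p x')"
        using le x x' w r by (intro mult_mono) (auto simp: A_B C_B)
      also have "\<dots> = (r * r * s2.p w) * gns_seminorm (\<phi>\<^sub>1 \<circ> \<Theta>) x * s1.p x'"
        using seminorm_odd[OF x w] p_A[OF x'] by simp
      finally show "cmod (\<psi> (adj w * (adj x * x'))) \<le> (r * r * s2.p w) * gns_seminorm (\<phi>\<^sub>1 \<circ> \<Theta>) x * s1.p x'" .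
    qed
    moreover have "adj w * \<Theta> x = x * y"
      using graded_commute(2)[OF IJ \<Theta>_mem[OF x] y(1) y(2)] by (simp add: w_def adj_adj)
    ultimately show ?thesis by simp
  qed
  have "\<psi> z - \<phi> z = 0"
  proof (rule functional_eq_on_products[OF IJ, where K = 2, OF _ _ _ z])
    show "functional_on B (\<lambda>z. \<psi> z - \<phi> z)"
      by (simp add: functional_on_def n.map_linear s.map_linear algebra_simps)
    show "cmod (\<psi> x - \<phi> x) \<le> 2 * norm x" if "x \<in> B" for x
      using norm_triangle_ineq4[of "\<psi> x" "\<phi> x"] n.map_norm_le[OF that] s.map_norm_le[OF that] by linarith
    show "\<psi> (x * y) - \<phi> (x * y) = 0" if x: "x \<in> A" and y: "y \<in> C" for x y
    proof -
      have evE: "ev y \<in> E" using ev_mem[OF y] by (simp add: car_even_iff)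
      have "x * y = x * ev y + x * od y" by (simp add: ev_od flip: distrib_left)
      then have "\<psi> (x * y) = \<psi> (x * ev y) + \<psi> (x * od y)"
        using x ev_mem[OF y] od_mem[OF y] by (simp add: n.map_add A_B C_B)
      then show ?thesis
        using even[OF x evE] odd[OF x od_mem[OF y]] \<phi>\<^sub>2_ev[OF y] prod[OF x y] by simp
    qed
  qed
  then show "\<psi> z = \<phi> z" by simp
qed

end

section \<open>Even states that are pure on the even part\<close>

context car
begin

text \<open>On the GNS space of an even state \<open>\<phi>\<close> that is pure on the even part but not pure, there is
  an odd self-adjoint unitary \<open>S\<close> commuting with the algebra. The sequence \<open>\<theta>\<close> approximates the
  vector \<open>S \<Omega>\<close>, and \<open>\<psi>\<close> is the vector state of \<open>(\<Omega> + S \<Omega>) / \<surd>2\<close>, for which \<open>S\<close> acts as the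
  identity: this is \<open>key\<close> below.\<close>

lemma even_state_splits:
  assumes \<phi>: "state_on (car_sub a J) \<phi>" and even: "even_on (car_sub a J) \<Theta> \<phi>"
    and pure: "pure_state_on (car_even a \<Theta> J) \<phi>"
    and not_pure: "\<not> pure_state_on (car_sub a J) \<phi>"
  obtains \<psi> where "pure_state_on (car_sub a J) \<psi>"
    "disjoint_reps (car_sub a J) (gns (car_sub a J) \<psi>) (gns (car_sub a J) (\<psi> \<circ> \<Theta>))"
    "\<And>x. x \<in> car_sub a J \<Longrightarrow> \<phi> x = 1 / 2 * (\<psi> x + \<psi> (\<Theta> x))"
proof -
  let ?C = "car_sub a J" and ?E = "car_even a \<Theta> J"
  have EC: "?E \<subseteq> ?C" by (auto simp: car_even_iff)
  interpret s: cstar_state ?C \<phi> using cstar_subalgebra_car_sub \<phi> by (rule cstar_stateI)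
  interpret e: cstar_state ?E \<phi>
    using cstar_subalgebra_car_even state_on_subset[OF \<phi> EC] by (rule cstar_stateI)
  have odd0: "\<phi> y = 0" if "y \<in> ?C" "\<Theta> y = - y" for y
    using even_zero_on_odd[OF s.cstar_functional_axioms even that] .
  have evE: "ev y \<in> ?E" if "y \<in> ?C" for y using ev_mem[OF that] by (simp add: car_even_iff)

  obtain \<psi>' \<omega>' t x0 where \<psi>': "state_on ?C \<psi>'" and \<omega>': "state_on ?C \<omega>'" and t: "0 < t" "t < 1"
    and dec: "\<And>x. x \<in> ?C \<Longrightarrow> \<phi> x = complex_of_real t * \<psi>' x + complex_of_real (1 - t) * \<omega>' x"
    and x0: "x0 \<in> ?C" "\<psi>' x0 \<noteq> \<phi> x0"
  proof -
    have "\<not> (\<forall>\<psi> \<omega> t x. state_on ?C \<psi> \<longrightarrow> state_on ?C \<omega> \<longrightarrow> 0 < t \<longrightarrow> t < 1 \<longrightarrow>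
        (\<forall>x\<in>?C. \<phi> x = complex_of_real t * \<psi> x + complex_of_real (1 - t) * \<omega> x) \<longrightarrow>
        x \<in> ?C \<longrightarrow> \<psi> x = \<phi> x)"
    proof
      assume *: "\<forall>\<psi> \<omega> t x. state_on ?C \<psi> \<longrightarrow> state_on ?C \<omega> \<longrightarrow> 0 < t \<longrightarrow> t < 1 \<longrightarrow>
        (\<forall>x\<in>?C. \<phi> x = complex_of_real t * \<psi> x + complex_of_real (1 - t) * \<omega> x) \<longrightarrow>
        x \<in> ?C \<longrightarrow> \<psi> x = \<phi> x"
      have "pure_state_on ?C \<phi>" by (rule pure_state_onI[OF \<phi>]) (use * in blast)
      then show False using not_pure by contradiction
    qed
    then show thesis using that by blast
  qed
  interpret n: cstar_state ?C \<psi>' using cstar_subalgebra_car_sub \<psi>' by (rule cstar_stateI)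
  have \<psi>'_E: "\<psi>' b = \<phi> b" if b: "b \<in> ?E" for b
  proof -
    have "\<forall>b\<in>?E. \<psi>' b = \<phi> b \<and> \<omega>' b = \<phi> b"
      by (rule pure_state_onD[OF pure state_on_subset[OF \<psi>' EC] state_on_subset[OF \<omega>' EC] t dec])
        (use EC in blast)
    then show ?thesis using b by blast
  qed
  \<comment> \<open>By purity on the even part the component agrees with \<phi> there, so only odd
    parts contribute to this difference.\<close>
  define o' where "o' x = \<psi>' x - \<phi> x" for x
  have o_fun: "functional_on ?C o'"
    by (simp add: functional_on_def o'_def n.map_linear s.map_linear algebra_simps)
  interpret o': cstar_functional ?C o' using o_fun by unfold_locales
  have o_adj: "o' (adj x) = cnj (o' x)" if "x \<in> ?C" for x
    using that by (simp add: o'_def n.map_adj s.map_adj)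
  have o_E: "o' b = 0" if "b \<in> ?E" for b using \<psi>'_E[OF that] by (simp add: o'_def)
  \<comment> \<open>\<open>1 / t\<close> comes from the component \<open>\<psi>'\<close>, and 1 from
    \<phi> itself.\<close>
  define K where "K = 1 / sqrt t * (1 / sqrt t) + 1"
  have K: "K \<ge> 0" using t by (simp add: K_def)
  have o_bound: "cmod (o' (adj x * y)) \<le> K * s.p x * s.p y" if x: "x \<in> ?C" and y: "y \<in> ?C" for x y
  proof -
    have le: "n.p x \<le> 1 / sqrt t * s.p x" if "x \<in> ?C" for x
      by (rule s.convex_component_seminorm[OF \<psi>' \<omega>' t dec]) (use that in simp_all)
    have "cmod (o' (adj x * y)) \<le> cmod (\<psi>' (adj x * y)) + cmod (\<phi> (adj x * y))"
      unfolding o'_def by (rule norm_triangle_ineq4)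
    also have "\<dots> \<le> n.p x * n.p y + s.p x * s.p y"
      using n.Cauchy_Schwarz[OF x y] s.Cauchy_Schwarz[OF x y] by simp
    also have "n.p x * n.p y \<le> (1 / sqrt t * s.p x) * (1 / sqrt t * s.p y)"
      using le[OF x] le[OF y] x y t by (intro mult_mono) auto
    finally show ?thesis by (simp add: K_def algebra_simps)
  qed

  let ?M = "{x \<in> ?C. \<Theta> x = - x}"
  \<comment> \<open>Applying \<open>Riesz\<close> on the odd subspace makes every
    \<open>\<eta> k\<close> odd. The sequence stands for \<open>S \<Omega>\<close> before
    scaling.\<close>
  obtain \<eta> \<epsilon> where \<eta>M: "\<And>k. \<eta> k \<in> ?M" and \<eta>: "\<eta> \<in> gns_cauchy ?C \<phi>" and \<epsilon>: "\<epsilon> \<longlonglongrightarrow> 0"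
    and est: "\<And>k x. x \<in> ?M \<Longrightarrow> cmod (\<phi> (adj x * \<eta> k) - o' (adj x)) \<le> \<epsilon> k * s.p x"
  proof (rule s.Riesz[of ?M "\<lambda>x. o' (adj x)" K])
    show "cmod (o' (adj x)) \<le> K * s.p x" if "x \<in> ?M" for x using o_bound[of x 1] that by simp
  qed (auto simp: \<Theta>_hom adj_add adj_scaleC o'.map_linear)
  have \<eta>C: "\<eta> k \<in> ?C" and \<Theta>_\<eta>: "\<Theta> (\<eta> k) = - \<eta> k" for k using \<eta>M by auto
  note \<eta>_lim = s.seminorm_mult_tendsto[OF \<eta>]
  have seminorm_le: "lim (\<lambda>k. s.p (b * \<eta> k)) \<le> K * s.p b" if b: "b \<in> ?E" for b
  proof (rule s.Riesz_seminorm_le[where h = "\<lambda>x. o' (adj x)", OF \<eta>C \<epsilon>])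
    have bC: "b \<in> ?C" "\<Theta> b = b" using b by (auto simp: car_even_iff)
    show "b \<in> ?C" by (rule bC)
    show "0 \<le> K * s.p b" using K bC by simp
    show "cmod (\<phi> (adj (adj b * (b * \<eta> k)) * \<eta> k) - o' (adj (adj b * (b * \<eta> k)))) \<le>
        \<epsilon> k * s.p (adj b * (b * \<eta> k))" for k
      using bC \<eta>C \<Theta>_\<eta> by (intro est) (simp add: \<Theta>_hom)
    show "cmod (o' (adj (adj b * (b * \<eta> k)))) \<le> K * s.p b * s.p (b * \<eta> k)" for k
      using o_bound[of "b * \<eta> k" b] bC \<eta>C by (simp add: adj_mult adj_adj mult_ac)
    show "(\<lambda>k. s.p (b * \<eta> k)) \<longlonglongrightarrow> lim (\<lambda>k. s.p (b * \<eta> k))" by (rule \<eta>_lim[OF bC(1)])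
  qed
  \<comment> \<open>\<langle>S \<Omega>, b S \<Omega>\<rangle> is dominated by \<phi> on the even
    part, hence proportional to it. In this form the square of \<open>S\<close> is seen to be a
    scalar.\<close>
  have vf: "s.vf \<eta> b = s.vf \<eta> 1 * \<phi> b" if b: "b \<in> ?E" for b
  proof (rule e.pure_dominated[OF pure _ _ b])
    show "functional_on ?E (s.vf \<eta>)"
      using s.vf_functional[OF \<eta>] EC unfolding functional_on_def by blast
    fix x y assume xy: "x \<in> ?E" "y \<in> ?E"
    then have xyC: "x \<in> ?C" "y \<in> ?C" using EC by auto
    have "cmod (s.vf \<eta> (adj x * y)) \<le> lim (\<lambda>k. s.p (x * \<eta> k)) * lim (\<lambda>k. s.p (y * \<eta> k))"
      by (rule s.vf_bound[OF \<eta> xyC])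
    also have "\<dots> \<le> (K * s.p x) * (K * s.p y)"
      using seminorm_le xy xyC s.lim_seminorm_nonneg[OF \<eta>] K by (intro mult_mono) auto
    finally show "cmod (s.vf \<eta> (adj x * y)) \<le> K * K * s.p x * s.p y" by (simp add: mult_ac)
  qed
  have o_lim: "(\<lambda>k. \<phi> (x * \<eta> k)) \<longlonglongrightarrow> o' x" if x: "x \<in> ?C" for x
  proof -
    have xx: "ev x \<in> ?C" "od x \<in> ?C" using ev_mem[OF x] od_mem[OF x] by auto
    have eq: "\<phi> (x * \<eta> k) = \<phi> (od x * \<eta> k)" for k
    proof -
      have "\<phi> (x * \<eta> k) = \<phi> (ev x * \<eta> k) + \<phi> (od x * \<eta> k)"
        using xx \<eta>C s.map_add[of "ev x * \<eta> k" "od x * \<eta> k"] by (simp add: ev_od flip: distrib_right)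
      then show ?thesis using odd0[of "ev x * \<eta> k"] xx \<eta>C \<Theta>_\<eta> by (simp add: \<Theta>_mult)
    qed
    have oeq: "o' x = o' (od x)"
      using xx o'.map_add[of "ev x" "od x"] o_E[OF evE[OF x]] by (simp add: ev_od)
    have "(\<lambda>k. \<phi> (x * \<eta> k) - o' x) \<longlonglongrightarrow> 0"
    proof (rule Lim_null_comparison)
      show "\<forall>\<^sub>F k in sequentially. norm (\<phi> (x * \<eta> k) - o' x) \<le> \<epsilon> k * s.p (adj (od x))"
        using est[of "adj (od x)"] xx unfolding eq oeq by (simp add: adj_adj \<Theta>_adj)
      show "(\<lambda>k. \<epsilon> k * s.p (adj (od x))) \<longlonglongrightarrow> 0" using tendsto_mult_left_zero[OF \<epsilon>] .
    qed
    then show ?thesis by (simp add: LIM_zero_iff)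
  qed
  define l where "l = lim (\<lambda>k. s.p (1 * \<eta> k))"
  have l_lim: "(\<lambda>k. s.p (\<eta> k)) \<longlonglongrightarrow> l" using \<eta>_lim[of 1] by (simp add: l_def)
  have vf1: "s.vf \<eta> 1 = complex_of_real (l\<^sup>2)" using s.vf_adj_mult_self[OF \<eta> s.one_mem] by (simp add: l_def)
  have "l \<ge> 0" unfolding l_def by (rule s.lim_seminorm_nonneg[OF \<eta> s.one_mem])
  moreover have "l \<noteq> 0"
  proof
    assume "l = 0"
    have "(\<lambda>k. \<phi> (x0 * \<eta> k)) \<longlonglongrightarrow> 0"
    proof (rule Lim_null_comparison)
      show "\<forall>\<^sub>F k in sequentially. norm (\<phi> (x0 * \<eta> k)) \<le> s.p (adj x0) * s.p (\<eta> k)"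
        using s.Cauchy_Schwarz[of "adj x0" "\<eta> k" for k] x0 \<eta>C by (simp add: adj_adj)
      show "(\<lambda>k. s.p (adj x0) * s.p (\<eta> k)) \<longlonglongrightarrow> 0"
        using tendsto_mult_left[OF l_lim, of "s.p (adj x0)"] \<open>l = 0\<close> by simp
    qed
    from LIMSEQ_unique[OF o_lim[OF x0(1)] this] show False using x0(2) by (simp add: o'_def)
  qed
  ultimately have l: "l > 0" by simp

  \<comment> \<open>\<open>l\<close> is the norm of the unscaled \<open>S \<Omega>\<close>. From
    here on \<open>\<theta>\<close> stands for \<open>S \<Omega>\<close> with \<open>S\<close>
    scaled to square 1, and \<open>q x\<close> for \<langle>\<Omega>, x S \<Omega>\<rangle>.\<close>
  define c where "c = complex_of_real (1 / l)"
  have c: "c \<noteq> 0" "cnj c = c" "cmod c = 1 / l" using l by (auto simp: c_def norm_divide)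
  define \<theta> where "\<theta> k = c *\<^sub>C \<eta> k" for k
  define q where "q x = c * o' x" for x
  have \<theta>C: "\<theta> k \<in> ?C" and \<Theta>_\<theta>: "\<Theta> (\<theta> k) = - \<theta> k" for k
    using \<eta>C \<Theta>_\<eta> by (auto simp: \<theta>_def \<Theta>_hom)
  have \<theta>: "\<theta> \<in> gns_cauchy ?C \<phi>" unfolding \<theta>_def by (rule s.cauchy_scaleC[OF \<eta>])
  have q_fun: "functional_on ?C q" by (simp add: functional_on_def q_def o'.map_linear algebra_simps)
  interpret q: cstar_functional ?C q using q_fun by unfold_locales
  have q_adj: "q (adj x) = cnj (q x)" if "x \<in> ?C" for x using o_adj[OF that] c by (simp add: q_def)
  have q_E: "q b = 0" if "b \<in> ?E" for b using o_E[OF that] by (simp add: q_def)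
  have q_lim: "(\<lambda>k. \<phi> (x * \<theta> k)) \<longlonglongrightarrow> q x" if x: "x \<in> ?C" for x
    using tendsto_mult_left[OF o_lim[OF x], of c] x \<eta>C
    by (simp add: \<theta>_def q_def scaleC_mult_right s.map_linear)
  have \<theta>_vf: "s.vf \<theta> b = \<phi> b" if b: "b \<in> ?E" for b
    using s.vf_scale[OF \<eta>, of b c] EC b vf[OF b] l
    by (auto simp: \<theta>_def[abs_def] vf1 c power_divide)
  have \<theta>_seminorm: "(\<lambda>k. s.p (b * \<theta> k)) \<longlonglongrightarrow> s.p b" if b: "b \<in> ?E" for b
  proof -
    have bC: "b \<in> ?C" using b EC by auto
    have "complex_of_real ((lim (\<lambda>k. s.p (b * \<theta> k)))\<^sup>2) = complex_of_real ((s.p b)\<^sup>2)"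
      using s.vf_adj_mult_self[OF \<theta> bC] \<theta>_vf[of "adj b * b"] b s.map_adj_mult_self[OF bC] by simp
    then have "(lim (\<lambda>k. s.p (b * \<theta> k)))\<^sup>2 = (s.p b)\<^sup>2" by (simp only: of_real_eq_iff)
    then have "lim (\<lambda>k. s.p (b * \<theta> k)) = s.p b"
      using s.lim_seminorm_nonneg[OF \<theta> bC] bC by (simp add: power2_eq_iff_nonneg)
    then show ?thesis using s.seminorm_mult_tendsto[OF \<theta> bC] by simp
  qed
  \<comment> \<open>The limit is the squared norm of \<open>S \<Omega>\<close>: \<open>est\<close>
    compares \<open>q (adj (\<theta> k))\<close> with the squared seminorm of
    \<open>\<theta> k\<close>.\<close>
  have q_\<theta>: "(\<lambda>k. q (adj (\<theta> k))) \<longlonglongrightarrow> 1"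
  proof -
    have "(\<lambda>k. s.p (\<theta> k)) \<longlonglongrightarrow> 1" using \<theta>_seminorm[of 1] by simp
    note lim1 = this
    have "(\<lambda>k. q (adj (\<theta> k)) - \<phi> (adj (\<theta> k) * \<theta> k)) \<longlonglongrightarrow> 0"
    proof (rule Lim_null_comparison)
      have "norm (q (adj (\<theta> k)) - \<phi> (adj (\<theta> k) * \<theta> k)) \<le> 1 / l * (\<epsilon> k * s.p (\<theta> k))" for k
      proof -
        have "q (adj (\<theta> k)) - \<phi> (adj (\<theta> k) * \<theta> k) = - (c * (\<phi> (adj (\<theta> k) * \<eta> k) - o' (adj (\<theta> k))))"
          using \<theta>C \<eta>C by (simp add: q_def \<theta>_def[of k] scaleC_mult_right s.map_linear algebra_simps)
        then have "norm (q (adj (\<theta> k)) - \<phi> (adj (\<theta> k) * \<theta> k)) =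
            1 / l * cmod (\<phi> (adj (\<theta> k) * \<eta> k) - o' (adj (\<theta> k)))"
          by (simp only: norm_minus_cancel norm_mult c)
        also have "\<dots> \<le> 1 / l * (\<epsilon> k * s.p (\<theta> k))"
          using l \<theta>C \<Theta>_\<theta> by (intro mult_left_mono est) auto
        finally show ?thesis .
      qed
      then show "\<forall>\<^sub>F k in sequentially. norm (q (adj (\<theta> k)) - \<phi> (adj (\<theta> k) * \<theta> k)) \<le> 1 / l * (\<epsilon> k * s.p (\<theta> k))"
        by simp
      show "(\<lambda>k. 1 / l * (\<epsilon> k * s.p (\<theta> k))) \<longlonglongrightarrow> 0"
        using tendsto_mult_left[OF tendsto_mult[OF \<epsilon> lim1], of "1 / l"] by simp
    qed
    moreover have "(\<lambda>k. \<phi> (adj (\<theta> k) * \<theta> k)) \<longlonglongrightarrow> 1"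
      using s.vf_tendsto[OF \<theta> s.one_mem] \<theta>_vf[of 1] by simp
    ultimately show ?thesis using tendsto_add by fastforce
  qed

  \<comment> \<open>This is the vector state of (1 + S) \<Omega> divided by the square root of 2:
    \<open>S\<close> is self-adjoint, commutes with \<open>x\<close> and has square 1, so half the
    square of 1 + S is 1 + S.\<close>
  define \<psi> where "\<psi> x = \<phi> x + q x" for x
  have \<psi>_E: "\<psi> b = \<phi> b" if "b \<in> ?E" for b using q_E[OF that] by (simp add: \<psi>_def)
  have \<psi>_fun: "functional_on ?C \<psi>" by (simp add: functional_on_def \<psi>_def q.map_linear s.map_linear algebra_simps)
  have \<psi>_state: "state_on ?C \<psi>"
  proof -
    have pos: "\<psi> (adj x * x) \<in> \<real>\<^sub>\<ge>\<^sub>0" if x: "x \<in> ?C" for x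
    proof -
      define y z where "y = ev x" and "z = od x"
      have yz: "y \<in> ?C" "\<Theta> y = y" "z \<in> ?C" "\<Theta> z = - z"
        using x ev_mem od_mem by (simp_all add: y_def z_def)
      have "x = y + z" by (simp add: y_def z_def ev_od)
      then have "adj x * x = (adj y * y + adj z * z) + (adj y * z + adj z * y)"
        by (simp add: adj_add ring_distribs)
      moreover have "adj y * y + adj z * z \<in> ?E" using yz by (simp add: car_even_iff \<Theta>_hom)
      moreover have "adj y * z + adj z * y \<in> ?C" "\<Theta> (adj y * z + adj z * y) = - (adj y * z + adj z * y)"
        using yz by (simp_all add: \<Theta>_hom)
      ultimately have "\<psi> (adj x * x) = \<phi> (adj y * y + adj z * z) + q (adj y * z + adj z * y)"
        using EC q_E odd0 by (simp add: \<psi>_def s.map_add[of "adj y * y + adj z * z"] q.map_add[of "adj y * y + adj z * z"] subset_iff)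
      also have "\<phi> (adj y * y + adj z * z) = complex_of_real ((s.p y)\<^sup>2 + (s.p z)\<^sup>2)"
        using yz by (simp add: s.map_add s.map_adj_mult_self)
      also have "q (adj y * z + adj z * y) = complex_of_real (2 * Re (q (adj z * y)))"
        using yz q_adj[of "adj z * y"] by (simp add: q.map_add adj_mult adj_adj complex_eq_iff)
      finally have eq: "\<psi> (adj x * x) = complex_of_real ((s.p y)\<^sup>2 + (s.p z)\<^sup>2 + 2 * Re (q (adj z * y)))" by simp
      have yE: "y \<in> ?E" using yz by (simp add: car_even_iff)
      \<comment> \<open>\<open>S\<close> preserves the norm of the even vector
        \<open>y \<Omega>\<close>, so the cross term is at most the product of the two seminorms,
        and the squares outweigh it.\<close>
      have "cmod (q (adj z * y)) \<le> s.p z * s.p y"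
      proof (rule LIMSEQ_le[OF tendsto_norm[OF q_lim] tendsto_mult_left[OF \<theta>_seminorm[OF yE]]])
        show "adj z * y \<in> ?C" using yz by simp
        show "\<exists>N. \<forall>k\<ge>N. cmod (\<phi> (adj z * y * \<theta> k)) \<le> s.p z * s.p (y * \<theta> k)"
          using s.Cauchy_Schwarz[of z "y * \<theta> k" for k] yz \<theta>C by (simp add: mult.assoc)
      qed
      then have "- (s.p z * s.p y) \<le> Re (q (adj z * y))" using abs_Re_le_cmod[of "q (adj z * y)"] by linarith
      moreover have "2 * (s.p z * s.p y) \<le> (s.p y)\<^sup>2 + (s.p z)\<^sup>2"
        using sum_squares_bound[of "s.p z" "s.p y"] by (simp add: add.commute mult.assoc)
      ultimately have "0 \<le> (s.p y)\<^sup>2 + (s.p z)\<^sup>2 + 2 * Re (q (adj z * y))" by linarith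
      then show ?thesis unfolding eq by (simp only: nonneg_Reals_of_real_iff)
    qed
    moreover have "\<psi> 1 = 1" using \<psi>_E[of 1] by simp
    ultimately show ?thesis using \<psi>_fun by (simp add: state_on_def functional_on_def)
  qed
  interpret m: cstar_state ?C \<psi> using cstar_subalgebra_car_sub \<psi>_state by (rule cstar_stateI)
  interpret m': cstar_state ?C "\<psi> \<circ> \<Theta>"
    using cstar_subalgebra_car_sub state_comp_\<Theta>[OF \<psi>_state] by (rule cstar_stateI)
  have key: "(\<lambda>k. m.p (1 - \<theta> k)) \<longlonglongrightarrow> 0"
  proof -
    have eq: "\<psi> (adj (1 - \<theta> k) * (1 - \<theta> k)) = 1 - cnj (q (adj (\<theta> k))) - q (adj (\<theta> k)) + \<phi> (adj (\<theta> k) * \<theta> k)" for k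
    proof -
      have "adj (\<theta> k) * \<theta> k \<in> ?E" using \<theta>C \<Theta>_\<theta> by (simp add: car_even_iff \<Theta>_hom)
      moreover have "\<phi> (\<theta> k) = 0" "\<phi> (adj (\<theta> k)) = 0" using odd0 \<theta>C \<Theta>_\<theta> by (simp_all add: \<Theta>_adj)
      moreover have "q (\<theta> k) = cnj (q (adj (\<theta> k)))" using q_adj[OF \<theta>C] by simp
      ultimately have "\<psi> (\<theta> k) = cnj (q (adj (\<theta> k)))" "\<psi> (adj (\<theta> k)) = q (adj (\<theta> k))"
        "\<psi> (adj (\<theta> k) * \<theta> k) = \<phi> (adj (\<theta> k) * \<theta> k)"
        using \<psi>_E by (simp_all add: \<psi>_def)
      then show ?thesis using \<theta>C by (simp add: adj_diff ring_distribs m.map_linear)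
    qed
    have "(\<lambda>k. \<phi> (adj (\<theta> k) * \<theta> k)) \<longlonglongrightarrow> 1"
      using s.vf_tendsto[OF \<theta> s.one_mem] \<theta>_vf[of 1] by simp
    then have "(\<lambda>k. \<psi> (adj (1 - \<theta> k) * (1 - \<theta> k))) \<longlonglongrightarrow> 1 - cnj 1 - 1 + 1"
      unfolding eq by (intro tendsto_intros q_\<theta>)
    then have "(\<lambda>k. sqrt (Re (\<psi> (adj (1 - \<theta> k) * (1 - \<theta> k))))) \<longlonglongrightarrow> sqrt (Re 0)"
      by (intro tendsto_intros) simp
    then show ?thesis by (simp add: gns_seminorm_def)
  qed
  \<comment> \<open>By \<open>key\<close>, \<open>\<theta> k\<close> converges to the cyclic vector
    of \<psi>, so a functional continuous in its right argument does not notice it in the limit. For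
    odd \<open>x\<close> the product \<open>x * \<theta> k\<close> is even: values on odd elements
    are determined by values on even ones.\<close>
  have absorb: "(\<lambda>k. g (x * \<theta> k)) \<longlonglongrightarrow> g x"
    if g: "functional_on ?C g" and L: "\<And>x y. x \<in> ?C \<Longrightarrow> y \<in> ?C \<Longrightarrow> cmod (g (adj x * y)) \<le> L x * m.p y"
      and x: "x \<in> ?C" for g L x
  proof -
    interpret g: cstar_functional ?C g using g by unfold_locales
    have "(\<lambda>k. g (x * \<theta> k) - g x) \<longlonglongrightarrow> 0"
    proof (rule Lim_null_comparison)
      have "norm (g (x * \<theta> k) - g x) \<le> L (adj x) * m.p (1 - \<theta> k)" for k
      proof -
        have "g (x * \<theta> k) - g x = - g (adj (adj x) * (1 - \<theta> k))"
          using x \<theta>C by (simp add: adj_adj right_diff_distrib g.map_linear)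
        then show ?thesis using L[of "adj x" "1 - \<theta> k"] x \<theta>C by simp
      qed
      then show "\<forall>\<^sub>F k in sequentially. norm (g (x * \<theta> k) - g x) \<le> L (adj x) * m.p (1 - \<theta> k)" by simp
      show "(\<lambda>k. L (adj x) * m.p (1 - \<theta> k)) \<longlonglongrightarrow> 0" using tendsto_mult_left[OF key, of "L (adj x)"] by simp
    qed
    then show ?thesis by (simp add: LIM_zero_iff)
  qed
  have odd_\<theta>: "x * \<theta> k \<in> ?E" if "x \<in> ?C" "\<Theta> x = - x" for x k
    using that \<theta>C \<Theta>_\<theta> by (simp add: car_even_iff \<Theta>_mult)

  have "pure_state_on ?C \<psi>"
  proof (rule pure_state_onI[OF \<psi>_state])
    fix \<psi>2 \<omega>2 t x
    assume \<psi>2: "state_on ?C \<psi>2" and \<omega>2: "state_on ?C \<omega>2" and t: "0 < t" "t < 1"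
      and dec: "\<And>x. x \<in> ?C \<Longrightarrow> \<psi> x = complex_of_real t * \<psi>2 x + complex_of_real (1 - t) * \<omega>2 x"
      and x: "x \<in> ?C"
    interpret n2: cstar_state ?C \<psi>2 using cstar_subalgebra_car_sub \<psi>2 by (rule cstar_stateI)
    have "\<forall>b\<in>?E. \<psi>2 b = \<phi> b \<and> \<omega>2 b = \<phi> b"
      by (rule pure_state_onD[OF pure state_on_subset[OF \<psi>2 EC] state_on_subset[OF \<omega>2 EC] t])
        (use dec \<psi>_E EC in \<open>metis subsetD\<close>)
    then have onE: "\<psi>2 b = \<phi> b" if "b \<in> ?E" for b using that by blast
    have xx: "od x \<in> ?C" "ev x \<in> ?C" using x od_mem ev_mem by auto
    \<comment> \<open>The component already agrees with \<phi> on even elements, and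
      \<open>absorb\<close> forces its value at \<open>od x\<close> to be \<open>q (od x)\<close>,
      the same as for \<psi>.\<close>
    have "(\<lambda>k. \<psi>2 (od x * \<theta> k)) \<longlonglongrightarrow> \<psi>2 (od x)"
    proof (rule absorb[where L = "\<lambda>x. n2.p x * (1 / sqrt t)", OF n2.functional _ xx(1)])
      fix x y assume x: "x \<in> ?C" and y: "y \<in> ?C"
      have "n2.p y \<le> 1 / sqrt t * m.p y"
        by (rule m.convex_component_seminorm[OF \<psi>2 \<omega>2 t dec]) (use y in simp_all)
      from order_trans[OF n2.Cauchy_Schwarz[OF x y] mult_left_mono[OF this n2.seminorm_nonneg[OF x]]]
      show "cmod (\<psi>2 (adj x * y)) \<le> n2.p x * (1 / sqrt t) * m.p y" by (simp add: mult.assoc)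
    qed
    moreover have "\<psi>2 (od x * \<theta> k) = \<phi> (od x * \<theta> k)" for k using onE odd_\<theta> xx by simp
    ultimately have "\<psi>2 (od x) = q (od x)" using LIMSEQ_unique[OF q_lim[OF xx(1)]] by simp
    moreover have "\<psi>2 (ev x) = \<phi> (ev x)" using onE evE[OF x] by blast
    moreover have "\<psi> x = \<phi> (ev x) + q (od x)"
    proof -
      have "\<psi> x = \<psi> (ev x) + \<psi> (od x)" using xx m.map_add[of "ev x" "od x"] by (simp add: ev_od)
      then show ?thesis using \<psi>_E[OF evE[OF x]] odd0[of "od x"] xx by (simp add: \<psi>_def)
    qed
    moreover have "\<psi>2 x = \<psi>2 (ev x) + \<psi>2 (od x)" using xx n2.map_add[of "ev x" "od x"] by (simp add: ev_od)
    ultimately show "\<psi>2 x = \<psi> x" by simp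
  qed
  moreover have "disjoint_reps ?C (gns ?C \<psi>) (gns ?C (\<psi> \<circ> \<Theta>))"
  proof (rule disjoint_reps_if_no_intertwiner[OF cstar_subalgebra_car_sub \<psi>_state state_comp_\<Theta>[OF \<psi>_state]])
    fix g x
    assume g: "functional_on ?C g"
      and bound: "\<And>x y. x \<in> ?C \<Longrightarrow> y \<in> ?C \<Longrightarrow> cmod (g (adj x * y)) \<le> m'.p x * m.p y"
      and x: "x \<in> ?C"
    interpret g: cstar_functional ?C g using g by unfold_locales
    have p_E: "m.p b = s.p b" "m'.p b = s.p b" if "b \<in> ?E" for b
    proof -
      have "adj b * b \<in> ?E" "\<Theta> (adj b * b) = adj b * b" using that by (simp_all add: car_even_iff \<Theta>_hom)
      then show "m.p b = s.p b" "m'.p b = s.p b" using \<psi>_E by (simp_all add: gns_seminorm_def)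
    qed
    have g_E: "g b = g 1 * \<phi> b" if b: "b \<in> ?E" for b
    proof (rule e.pure_dominated[OF pure _ _ b])
      show "functional_on ?E g" using g EC unfolding functional_on_def by blast
      show "cmod (g (adj x * y)) \<le> 1 * s.p x * s.p y" if "x \<in> ?E" "y \<in> ?E" for x y
        using bound[of x y] that EC p_E by auto
    qed
    \<comment> \<open>\<open>\<theta>\<close> acts as 1 on the cyclic vector of \<psi>, in the right
      argument, and as -1 on that of \<psi> \<circ> \<Theta>, in the left argument. Inserting it on
      either side gives the same value with opposite signs, which forces
      \<open>g 1 = 0\<close>.\<close>
    have right: "g y = g 1 * q y" if y: "y \<in> ?C" "\<Theta> y = - y" for y
    proof -
      have "(\<lambda>k. g (y * \<theta> k)) \<longlonglongrightarrow> g y" by (rule absorb[OF g bound y(1)])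
      moreover have "(\<lambda>k. g (y * \<theta> k)) \<longlonglongrightarrow> g 1 * q y"
        unfolding g_E[OF odd_\<theta>[OF y]] by (rule tendsto_mult_left[OF q_lim[OF y(1)]])
      ultimately show ?thesis by (rule LIMSEQ_unique)
    qed
    have left: "g y = - (g 1 * q y)" if y: "y \<in> ?C" "\<Theta> y = - y" for y
    proof -
      have p': "m'.p (1 + \<theta> k) = m.p (1 - \<theta> k)" for k
        using \<Theta>_\<theta> by (simp add: gns_seminorm_def \<Theta>_hom)
      have "(\<lambda>k. g y + g (adj (\<theta> k) * y)) \<longlonglongrightarrow> 0"
      proof (rule Lim_null_comparison)
        have "norm (g y + g (adj (\<theta> k) * y)) \<le> m.p (1 - \<theta> k) * m.p y" for k
          using bound[of "1 + \<theta> k" y] y \<theta>C p' by (simp add: adj_add distrib_right g.map_linear)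
        then show "\<forall>\<^sub>F k in sequentially. norm (g y + g (adj (\<theta> k) * y)) \<le> m.p (1 - \<theta> k) * m.p y" by simp
        show "(\<lambda>k. m.p (1 - \<theta> k) * m.p y) \<longlonglongrightarrow> 0" using tendsto_mult_left_zero[OF key] .
      qed
      moreover have "(\<lambda>k. g y + g (adj (\<theta> k) * y)) \<longlonglongrightarrow> g y + g 1 * q y"
      proof -
        have "g (adj (\<theta> k) * y) = g 1 * cnj (\<phi> (adj y * \<theta> k))" for k
        proof -
          have "adj (\<theta> k) * y \<in> ?E" using y \<theta>C \<Theta>_\<theta> by (simp add: car_even_iff \<Theta>_hom)
          from g_E[OF this] show ?thesis using s.map_adj_mult_swap[of y "\<theta> k"] y \<theta>C by simp
        qed
        moreover have "(\<lambda>k. g 1 * cnj (\<phi> (adj y * \<theta> k))) \<longlonglongrightarrow> g 1 * cnj (q (adj y))"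
          using y by (intro tendsto_intros q_lim) auto
        ultimately show ?thesis using q_adj[OF y(1)] by (simp add: tendsto_add)
      qed
      ultimately have "g y + g 1 * q y = 0" using LIMSEQ_unique by blast
      then show ?thesis by (simp add: eq_neg_iff_add_eq_0)
    qed
    have xo: "od x0 \<in> ?C" "\<Theta> (od x0) = - od x0" using x0 od_mem by auto
    have "q (od x0) \<noteq> 0"
    proof -
      have "o' x0 = o' (ev x0) + o' (od x0)" using o'.map_add[of "ev x0" "od x0"] xo ev_mem[OF x0(1)] by (simp add: ev_od)
      moreover have "o' x0 \<noteq> 0" using x0(2) by (simp add: o'_def)
      ultimately have "o' (od x0) \<noteq> 0" using o_E[OF evE[OF x0(1)]] by simp
      then show ?thesis using c by (simp add: q_def)
    qed
    moreover have "2 * (g 1 * q (od x0)) = 0" using right[OF xo] left[OF xo] by simp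
    ultimately have g1: "g 1 = 0" by simp
    have xx: "od x \<in> ?C" "\<Theta> (od x) = - od x" using x od_mem by auto
    have "g x = g (ev x) + g (od x)" using g.map_add[of "ev x" "od x"] xx ev_mem[OF x] by (simp add: ev_od)
    also have "\<dots> = 0" using g_E[OF evE[OF x]] right[OF xx] g1 by simp
    finally show "g x = 0" .
  qed
  moreover have "\<phi> x = 1 / 2 * (\<psi> x + \<psi> (\<Theta> x))" if x: "x \<in> ?C" for x
  proof -
    have "ev x \<in> ?C" "od x \<in> ?C" using x ev_mem od_mem by auto
    moreover have "\<Theta> x = ev x - od x" using arg_cong[OF ev_od[of x], of \<Theta>] by (simp add: \<Theta>_hom)
    ultimately have "q x = q (od x)" "q (\<Theta> x) = - q (od x)"
      using q.map_add[of "ev x" "od x"] q.map_diff[of "ev x" "od x"] q_E[OF evE[OF x]] by (simp_all add: ev_od)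
    moreover have "\<phi> (\<Theta> x) = \<phi> x" using even x by (simp add: even_on_def)
    ultimately show ?thesis by (simp add: \<psi>_def)
  qed
  ultimately show ?thesis by (rule that)
qed

text \<open>Purity of \<phi> would make \<psi> and \<psi> \<circ> \<Theta> equal on the algebra.
  Then, by Cauchy-Schwarz, \<psi> itself is an intertwining functional with constant 1 between
  disjoint representations, although \<open>\<psi> 1 = 1\<close>.\<close>

lemma split_state_not_pure:
  assumes \<psi>: "pure_state_on (car_sub a J) \<psi>"
    and dis: "disjoint_reps (car_sub a J) (gns (car_sub a J) \<psi>) (gns (car_sub a J) (\<psi> \<circ> \<Theta>))"
    and eq: "\<And>x. x \<in> car_sub a J \<Longrightarrow> \<phi> x = 1 / 2 * (\<psi> x + \<psi> (\<Theta> x))"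
  shows "\<not> pure_state_on (car_sub a J) \<phi>"
proof
  let ?C = "car_sub a J"
  assume pure: "pure_state_on ?C \<phi>"
  have \<psi>s: "state_on ?C \<psi>" using \<psi> by (simp add: pure_state_on_def)
  interpret m: cstar_state ?C \<psi> using cstar_subalgebra_car_sub \<psi>s by (rule cstar_stateI)
  have "\<forall>x\<in>?C. \<psi> x = \<phi> x \<and> (\<psi> \<circ> \<Theta>) x = \<phi> x"
    by (rule pure_state_onD[OF pure \<psi>s state_comp_\<Theta>[OF \<psi>s], of "1/2"]) (use eq in \<open>auto simp: distrib_left\<close>)
  then have "gns_seminorm (\<psi> \<circ> \<Theta>) x = m.p x" if "x \<in> ?C" for x
    using that by (simp add: gns_seminorm_def del: o_apply)
  then have "\<psi> 1 = 0"
    by (intro disjoint_reps_no_intertwiner[OF cstar_subalgebra_car_sub state_comp_\<Theta>[OF \<psi>s] \<psi> dis m.functional, where C = 1])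
      (use m.Cauchy_Schwarz in auto)
  then show False by simp
qed

end

theorem theorem3:
  fixes a :: "nat \<Rightarrow> 'a::cstar_algebra"
    and \<Theta> :: "'a \<Rightarrow> 'a"
    and I\<^sub>1 I\<^sub>2 :: "nat set"
    and \<phi>\<^sub>1 \<phi>\<^sub>2 \<phi> :: "'a \<Rightarrow> complex"
  assumes "car_generators a"
    and "parity_automorphism a \<Theta>"
    and "I\<^sub>1 \<inter> I\<^sub>2 = {}"
    and "state_on (car_sub a I\<^sub>1) \<phi>\<^sub>1"
    and "state_on (car_sub a I\<^sub>2) \<phi>\<^sub>2"
    and "even_on (car_sub a I\<^sub>2) \<Theta> \<phi>\<^sub>2"
    and "disjoint_reps (car_sub a I\<^sub>1)
           (gns (car_sub a I\<^sub>1) \<phi>\<^sub>1) (gns (car_sub a I\<^sub>1) (\<phi>\<^sub>1 \<circ> \<Theta>))"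
    and "product_state_extension a I\<^sub>1 I\<^sub>2 \<phi>\<^sub>1 \<phi>\<^sub>2 \<phi>"
  shows "(pure_state_on (car_sub a (I\<^sub>1 \<union> I\<^sub>2)) \<phi> \<longleftrightarrow>
            pure_state_on (car_sub a I\<^sub>1) \<phi>\<^sub>1 \<and> pure_state_on (car_even a \<Theta> I\<^sub>2) \<phi>\<^sub>2)
       \<and> (pure_state_on (car_sub a (I\<^sub>1 \<union> I\<^sub>2)) \<phi> \<longrightarrow>
            (\<not> pure_state_on (car_sub a I\<^sub>2) \<phi>\<^sub>2 \<longleftrightarrow>
              (\<exists>\<psi>. pure_state_on (car_sub a I\<^sub>2) \<psi> \<and>
                 disjoint_reps (car_sub a I\<^sub>2)
                   (gns (car_sub a I\<^sub>2) \<psi>) (gns (car_sub a I\<^sub>2) (\<psi> \<circ> \<Theta>)) \<and>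
                 (\<forall>x\<in>car_sub a I\<^sub>2. \<phi>\<^sub>2 x = 1 / 2 * (\<psi> x + \<psi> (\<Theta> x))))))"
proof -
  interpret car_product a \<Theta> I\<^sub>1 I\<^sub>2 \<phi>\<^sub>1 \<phi>\<^sub>2 \<phi>
    using assms by unfold_locales
  have iff: "pure_state_on B \<phi> \<longleftrightarrow> pure_state_on A \<phi>\<^sub>1 \<and> pure_state_on E \<phi>\<^sub>2"
    using pure_product_imp_pure1 pure_product_imp_pure_even pure_product_if assms(7) by blast
  moreover have "(\<not> pure_state_on C \<phi>\<^sub>2) \<longleftrightarrow>
      (\<exists>\<psi>. pure_state_on C \<psi> \<and> disjoint_reps C (gns C \<psi>) (gns C (\<psi> \<circ> \<Theta>)) \<and>
        (\<forall>x\<in>C. \<phi>\<^sub>2 x = 1 / 2 * (\<psi> x + \<psi> (\<Theta> x))))" if "pure_state_on E \<phi>\<^sub>2"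
  proof
    assume "\<not> pure_state_on C \<phi>\<^sub>2"
    from even_state_splits[OF state2 even2 that this] obtain \<psi> where
      "pure_state_on C \<psi>" "disjoint_reps C (gns C \<psi>) (gns C (\<psi> \<circ> \<Theta>))"
      "\<And>x. x \<in> C \<Longrightarrow> \<phi>\<^sub>2 x = 1 / 2 * (\<psi> x + \<psi> (\<Theta> x))" by metis
    then show "\<exists>\<psi>. pure_state_on C \<psi> \<and> disjoint_reps C (gns C \<psi>) (gns C (\<psi> \<circ> \<Theta>)) \<and>
        (\<forall>x\<in>C. \<phi>\<^sub>2 x = 1 / 2 * (\<psi> x + \<psi> (\<Theta> x)))" by blast
  next
    assume "\<exists>\<psi>. pure_state_on C \<psi> \<and> disjoint_reps C (gns C \<psi>) (gns C (\<psi> \<circ> \<Theta>)) \<and>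
        (\<forall>x\<in>C. \<phi>\<^sub>2 x = 1 / 2 * (\<psi> x + \<psi> (\<Theta> x)))"
    then show "\<not> pure_state_on C \<phi>\<^sub>2" using split_state_not_pure by metis
  qed
  ultimately show ?thesis by blast
qed

end
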